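(* Let $h\in(0,\infty)$, let $\gamma,q\in[0,\infty)$, and let $(\phi_k)_{k\in\mathbb{N}}\subset[0,\infty)$ be such that $q+\sum_{k\in\mathbb{N}}\phi_k\in(0,\infty)$. Then there exists (in law) an upwards skip-free Lévy chain $X$ with values in $\mathbb{Z}_h$ and with - $\gamma$ being the killing rate of its strict ascending ladder heights process, and - $\phi(\beta)=q+\sum_{k=1}^\infty\phi_k(1-e^{-\beta kh})$, $\beta\ge0$, being the Laplace exponent of its descending ladder heights process, if and only if the following conditions are satisfied: (1) $\gamma q=0$. (2) Setting $x$ equal to $1$ when $\gamma=0$, or, otherwise, to the unique solution on the interval $x\in(1,\infty)$ of the equation $$\gamma=(1-1/x)\left(\phi_1+x\sum_{k\in\mathbb{N}}\phi_k\right)$$ (it is part of the condition that such an $x$ should exist; given the preceding assumptions there is automatically at most one), and then defining $\lambda_1:=q+\sum_{k\in\mathbb{N}}\phi_k$ and $\lambda_{-k}:=x\phi_k-\phi_{k+1}$, $k\in\mathbb{N}$, it holds that $\lambda_{-k}\ge0$ for all $k\in\mathbb{N}$. Such an $X$ is then unique (in law), its Lévy measure is given by $\sum_{k\in\mathbb{N}}\lambda_{-k}\delta_{-kh}+\lambda_1\delta_h$, and $x=e^{\Phi(0)h}$.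
   Context: $\mathbb{N}=\{1,2,\dots\}$, $\mathbb{Z}_h:=\{hk:k\in\mathbb{Z}\}$. An upwards skip-free Lévy chain with values in $\mathbb{Z}_h$ is a Lévy process $X$ (càdlàg paths, $X_0=0$ a.s.) that is compound Poisson (finite Lévy measure $\lambda$, no drift, no Gaussian part) with $\lambda$ supported in $\mathbb{Z}_h$ and with $\lambda|_{(0,\infty)}$ having support exactly $\{h\}$ (so $\lambda(\{h\})>0$). Its Laplace exponent is $\psi(\beta)=\int_{\mathbb{R}}(e^{\beta x}-1)\lambda(dx)$, $\beta\ge0$; $\psi$ is strictly convex and continuous on $[0,\infty)$ and tends to $+\infty$; $\Phi(0)$ is the largest root of $\psi|_{[0,\infty)}$, and $\Phi:[0,\infty)\to[\Phi(0),\infty)$ is the inverse of $\psi|_{[\Phi(0),\infty)}$. $\overline{X}_t:=\sup_{s\in[0,t]}X_s$, $\underline{X}_t:=\inf_{s\in[0,t]}X_s$. The right-continuous inverse of a nondecreasing process $A$ is $A^{-1}_t:=\inf\{s\ge0:A_s>t\}$ ($=+\infty$ if $t\ge A_\infty$). Strict ascending ladder heights process: let $\overline{G}^*_t:=\inf\{s\in[0,t]:X_s=\overline{X}_t\}$ and let $L^*_t$ be the amount of time up to $t$ that $X$ has spent at a newly achieved maximum (before first departing from it; the starting level counts as a new maximum), i.e. $L^*_t=\int_0^t\mathbf{1}\{X_u=\overline{X}_s\text{ for all }u\in[\overline{G}^*_s,s]\}\,ds$. Then $H^*:=X_{(L^* )^{-1}}$ on $\{(L^* )^{-1}<\infty\}$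 and $+\infty$ otherwise. $H^*/h$ is a killed Poisson process of intensity $\lambda(\mathbb{R})e^{-\Phi(0)h}$ and killing rate $\lambda(\mathbb{R})(1-e^{-\Phi(0)h})$; this is the killing rate meant in the claim. Descending ladder heights process: let $\hat L$ be the local time of $X$ at the minimum, normalized as follows: $\hat L_t:=e^{\Phi(0)h}\int_0^t\mathbf{1}\{X_s=\underline{X}_s\}\,ds$. Then $\hat H:=-X_{\hat L^{-1}}$ on $\{\hat L^{-1}<\infty\}$ and $+\infty$ otherwise; it is a (possibly killed) subordinator with Laplace exponent $\phi(\beta):=-\log\mathsf{E}[e^{-\beta\hat H_1}\mathbf{1}(\hat H_1<\infty)]$, $\beta\ge0$. Equivalently, the normalization of $\hat L$ is the one for which the bivariate ladder exponent $\hat\kappa$ given by $\mathsf{E}[e^{-\alpha\hat L^{-1}_1-\beta\hat H_1}\mathbf{1}_{\{1<\hat L_\infty\}}]=e^{-\hat\kappa(\alpha,\beta)}$ equals $e^{-\Phi(0)h}\frac{\alpha-\psi(\beta)}{1-e^{(\beta-\Phi(\alpha))h}}$ (for $\alpha>0$, $\beta\ge0$, $\alpha\neq\psi(\beta)$). *)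

theory Defs
  imports "HOL-Probability.Probability"
begin

section \<open>Upwards skip-free Levy chains\<close>

definition cadlag :: "(real \<Rightarrow> real) \<Rightarrow> bool" where
  "cadlag f \<longleftrightarrow> (\<forall>t\<ge>0. continuous (at_right t) f) \<and> (\<forall>t>0. \<exists>l. (f \<longlongrightarrow> l) (at_left t))"

text \<open>Processes are indexed by all reals, but only the times \<open>t \<ge> 0\<close> are ever referred to.\<close>

locale levy_process = prob_space M for M :: "'a measure" +
  fixes X :: "real \<Rightarrow> 'a \<Rightarrow> real"
  assumes measurable_X: "\<And>t. 0 \<le> t \<Longrightarrow> X t \<in> borel_measurable M"
    and cadlag_paths: "\<And>\<omega>. \<omega> \<in> space M \<Longrightarrow> cadlag (\<lambda>t. X t \<omega>)"
    and X_0: "AE \<omega> in M. X 0 \<omega> = 0"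
    and independent_increments:
      "\<And>n (t :: nat \<Rightarrow> real). 0 \<le> t 0 \<Longrightarrow> (\<forall>i<n. t i \<le> t (Suc i)) \<Longrightarrow>
         indep_vars (\<lambda>_. borel) (\<lambda>i \<omega>. X (t (Suc i)) \<omega> - X (t i) \<omega>) {..<n}"
    and stationary_increments:
      "\<And>s t. 0 \<le> s \<Longrightarrow> 0 \<le> t \<Longrightarrow>
         distr M borel (\<lambda>\<omega>. X (s + t) \<omega> - X s \<omega>) = distr M borel (X t)"

text \<open>The law of a process, as a probability measure on the product space \<open>\<real>\<close> to the power \<open>[0,\<infinity>)\<close>.\<close>

definition process_law :: "'a measure \<Rightarrow> (real \<Rightarrow> 'a \<Rightarrow> real) \<Rightarrow> (real \<Rightarrow> real) measure" where
  "process_law M X = distr M (PiM {0..} (\<lambda>_. borel)) (\<lambda>\<omega>. \<lambda>t\<in>{0..}. X t \<omega>)"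

text \<open>\<open>X\<close> is compound Poisson with Levy measure \<open>\<nu>\<close>: its Levy-Khintchine representation has
  no drift, no Gaussian part, and the finite Levy measure \<open>\<nu>\<close>.\<close>

definition compound_poisson ::
    "'a measure \<Rightarrow> (real \<Rightarrow> 'a \<Rightarrow> real) \<Rightarrow> real measure \<Rightarrow> bool" where
  "compound_poisson M X \<nu> \<longleftrightarrow>
     levy_process M X \<and> sets \<nu> = sets borel \<and> finite_measure \<nu> \<and> emeasure \<nu> {0} = 0 \<and>
     (\<forall>t\<ge>0. \<forall>u. char (distr M borel (X t)) u
        = exp (complex_of_real t * (CLINT x|\<nu>. iexp (u * x) - 1)))"

definition measure_support :: "real measure \<Rightarrow> real set" where
  "measure_support \<mu> = {x. \<forall>U. open U \<longrightarrow> x \<in> U \<longrightarrow> 0 < emeasure \<mu> U}"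

text \<open>The density below is the restriction of \<open>\<nu>\<close> to \<open>(0,\<infinity>)\<close>, viewed as a measure on \<open>\<real>\<close>.\<close>

definition upwards_skip_free_levy_chain ::
    "real \<Rightarrow> 'a measure \<Rightarrow> (real \<Rightarrow> 'a \<Rightarrow> real) \<Rightarrow> real measure \<Rightarrow> bool" where
  "upwards_skip_free_levy_chain h M X \<nu> \<longleftrightarrow>
     compound_poisson M X \<nu> \<and>
     measure_support \<nu> \<subseteq> range (\<lambda>k::int. h * of_int k) \<and>
     measure_support (density \<nu> (indicator {0<..})) = {h}"

definition levy_laplace_exponent :: "real measure \<Rightarrow> real \<Rightarrow> real" where
  "levy_laplace_exponent \<nu> \<beta> = (LINT x|\<nu>. exp (\<beta> * x) - 1)"

definition Phi_0 :: "real measure \<Rightarrow> real" where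
  "Phi_0 \<nu> = (GREATEST \<beta>. 0 \<le> \<beta> \<and> levy_laplace_exponent \<nu> \<beta> = 0)"


section \<open>Ladder heights of a path\<close>

definition running_sup :: "(real \<Rightarrow> real) \<Rightarrow> real \<Rightarrow> real" where
  "running_sup f t = (SUP s\<in>{0..t}. f s)"

definition running_inf :: "(real \<Rightarrow> real) \<Rightarrow> real \<Rightarrow> real" where
  "running_inf f t = (INF s\<in>{0..t}. f s)"

text \<open>The infimum is taken in \<open>ereal\<close>, hence is \<open>\<infinity>\<close> when \<open>A\<close> never exceeds \<open>t\<close>.\<close>

definition right_inverse :: "(real \<Rightarrow> real) \<Rightarrow> real \<Rightarrow> ereal" where
  "right_inverse A t = (INF s\<in>{s. 0 \<le> s \<and> t < A s}. ereal s)"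

definition first_time_at_sup :: "(real \<Rightarrow> real) \<Rightarrow> real \<Rightarrow> real" where
  "first_time_at_sup f t = Inf {s\<in>{0..t}. f s = running_sup f t}"

definition local_time_new_max :: "(real \<Rightarrow> real) \<Rightarrow> real \<Rightarrow> real" where
  "local_time_new_max f t =
     (LINT s:{0..t}|lborel. of_bool (\<forall>u\<in>{first_time_at_sup f s..s}. f u = running_sup f s))"

definition strict_ascending_ladder_height :: "(real \<Rightarrow> real) \<Rightarrow> real \<Rightarrow> ereal" where
  "strict_ascending_ladder_height f t =
     (let \<tau> = right_inverse (local_time_new_max f) t
      in if \<tau> < \<infinity> then ereal (f (real_of_ereal \<tau>)) else \<infinity>)"

text \<open>The normalizing constant \<open>c\<close> will be \<open>exp (\<Phi>(0) h)\<close>.\<close>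

definition local_time_min :: "real \<Rightarrow> (real \<Rightarrow> real) \<Rightarrow> real \<Rightarrow> real" where
  "local_time_min c f t = c * (LINT s:{0..t}|lborel. of_bool (f s = running_inf f s))"

definition descending_ladder_height :: "real \<Rightarrow> (real \<Rightarrow> real) \<Rightarrow> real \<Rightarrow> ereal" where
  "descending_ladder_height c f t =
     (let \<tau> = right_inverse (local_time_min c f) t
      in if \<tau> < \<infinity> then ereal (- f (real_of_ereal \<tau>)) else \<infinity>)"


section \<open>Killing rate and Laplace exponent of a killed subordinator\<close>

text \<open>Ladder heights are measurable functionals of a path only up to null sets (off which the
  path is a step function), so probabilities and expectations are taken in the completion.\<close>

definition has_killing_rate :: "'a measure \<Rightarrow> (real \<Rightarrow> 'a \<Rightarrow> ereal) \<Rightarrow> real \<Rightarrow> bool" where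
  "has_killing_rate M H \<gamma> \<longleftrightarrow>
     (\<forall>t\<ge>0. measure (completion M) {\<omega>\<in>space M. H t \<omega> < \<infinity>} = exp (- \<gamma> * t))"

definition killed_laplace_exponent :: "'a measure \<Rightarrow> (real \<Rightarrow> 'a \<Rightarrow> ereal) \<Rightarrow> real \<Rightarrow> real" where
  "killed_laplace_exponent M H \<beta> =
     - ln (LINT \<omega>|completion M. exp (- \<beta> * real_of_ereal (H 1 \<omega>)) * of_bool (H 1 \<omega> < \<infinity>))"


section \<open>Chains with prescribed ladder data\<close>

definition has_ladder_data ::
    "real \<Rightarrow> real \<Rightarrow> real \<Rightarrow> (nat \<Rightarrow> real) \<Rightarrow>
     'a measure \<Rightarrow> (real \<Rightarrow> 'a \<Rightarrow> real) \<Rightarrow> real measure \<Rightarrow> bool" where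
  "has_ladder_data h \<gamma> q \<phi> M X \<nu> \<longleftrightarrow>
     upwards_skip_free_levy_chain h M X \<nu> \<and>
     has_killing_rate M (\<lambda>t \<omega>. strict_ascending_ladder_height (\<lambda>s. X s \<omega>) t) \<gamma> \<and>
     (\<forall>\<beta>\<ge>0. killed_laplace_exponent M
          (\<lambda>t \<omega>. descending_ladder_height (exp (Phi_0 \<nu> * h)) (\<lambda>s. X s \<omega>) t) \<beta>
        = q + (\<Sum>\<^sub>\<infinity>k\<in>{1..}. \<phi> k * (1 - exp (- \<beta> * real k * h))))"

definition solves_x :: "real \<Rightarrow> (nat \<Rightarrow> real) \<Rightarrow> real \<Rightarrow> bool" where
  "solves_x \<gamma> \<phi> x \<longleftrightarrow> 1 < x \<and> \<gamma> = (1 - 1 / x) * (\<phi> 1 + x * (\<Sum>\<^sub>\<infinity>k\<in>{1..}. \<phi> k))"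

definition the_x :: "real \<Rightarrow> (nat \<Rightarrow> real) \<Rightarrow> real" where
  "the_x \<gamma> \<phi> = (if \<gamma> = 0 then 1 else (THE x. solves_x \<gamma> \<phi> x))"

definition mass_up :: "real \<Rightarrow> (nat \<Rightarrow> real) \<Rightarrow> real" where
  "mass_up q \<phi> = q + (\<Sum>\<^sub>\<infinity>k\<in>{1..}. \<phi> k)"

text \<open>\<open>mass_down \<gamma> \<phi> k\<close> is the mass to be placed at \<open>- k h\<close>, for \<open>k \<ge> 1\<close>.\<close>

definition mass_down :: "real \<Rightarrow> (nat \<Rightarrow> real) \<Rightarrow> nat \<Rightarrow> real" where
  "mass_down \<gamma> \<phi> k = the_x \<gamma> \<phi> * \<phi> k - \<phi> (k + 1)"

definition admissible :: "real \<Rightarrow> real \<Rightarrow> (nat \<Rightarrow> real) \<Rightarrow> bool" where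
  "admissible \<gamma> q \<phi> \<longleftrightarrow>
     \<gamma> * q = 0 \<and>
     (\<gamma> = 0 \<or> (\<exists>!x. solves_x \<gamma> \<phi> x)) \<and>
     (\<forall>k\<ge>1. 0 \<le> mass_down \<gamma> \<phi> k)"

end

theory Submission
  imports Defs
begin

text \<open>The chain is \<open>h\<close> times a walk whose exponential holding times are independent of the word of its
  jumps. Words ending at a strict maximum, or at a weak minimum, are regenerative: such a word
  factorises uniquely at its earlier records, so that the weighted count of the words reaching the
  \<open>n\<close>-th record level is the \<open>n\<close>-th power of the count for one level. By the lack of memory of the
  exponential law a clock that only runs in the marked epochs crosses its level like a Poisson
  process, hence the killing rate is \<open>lam * (1 - p)\<close>, where \<open>p\<close> is the probability of ever reaching
  level \<open>1\<close>. This \<open>p\<close> is the least fixed point of the generating function of the jumps, that is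
  \<open>1 / p = exp (Phi_0 * h)\<close>. Reversing words identifies the descending excursions with paths to
  strict maxima, whose weights are powers of \<open>p\<close>; this makes the exponent of the descending heights
  explicit. Any upwards skip-free chain can be replaced by this walk, because its characteristic
  functions determine the law of the process and the ladder events are measurable in the path at
  rational times. Comparing coefficients then expresses the jump rates through the ladder data, and
  conversely the same formulas define a chain.\<close>

section \<open>Weighted sums over words\<close>

text \<open>All sums over words are taken in \<open>ennreal\<close>, so that sums may be exchanged
  freely and finiteness is settled only at the end: for \<open>p\<close> because 1 is a solution of
  its equation, for the descending transform because it occurs inside an expectation of a quantity
  at most 1. The normalisation of the local time at the minimum turns its level 1 into level
  \<open>p\<close> of the time spent at the minimum; hence the exponent
  \<open>lam * p * (1 - y)\<close>, with \<open>y\<close> the transform of one excursion. Duality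
  makes \<open>lam * p * y\<close> a power series whose coefficients \<open>ladder_mass i\<close>
  sum \<open>p ^ (m + 1)\<close> times the rate of jumping down by \<open>m + i\<close>. Splitting
  off \<open>m = 0\<close> gives
  \<open>ladder_mass i = p * mass i + p * ladder_mass (i + 1)\<close>, which for
  \<open>x = 1 / p\<close> is the formula \<open>x * \<phi> k - \<phi> (k + 1)\<close>. Comparing
  the case \<open>i = 0\<close> with the total rate yields \<open>(x - 1) * q = 0\<close>, hence
  \<open>\<gamma> * q = 0\<close>. In the converse direction the delicate point is that
  \<open>1 / x\<close> is the least root of the equation for \<open>p\<close>, not merely some
  root.\<close>

definition word_sum :: "('a \<Rightarrow> ennreal) \<Rightarrow> 'a list set \<Rightarrow> ennreal" where
  "word_sum c A = (\<integral>\<^sup>+w. prod_list (map c w) \<partial>count_space A)"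

lemma nn_integral_count_space_UNIV:
  "(\<integral>\<^sup>+x. f x \<partial>count_space A) = (\<integral>\<^sup>+x. f x * indicator A x \<partial>count_space UNIV)"
  by (cases "A = UNIV") (auto simp: nn_integral_count_space_indicator)

lemma word_sum_indicator:
  "word_sum c A = (\<integral>\<^sup>+w. prod_list (map c w) * indicator A w \<partial>count_space UNIV)"
  unfolding word_sum_def by (rule nn_integral_count_space_UNIV)

text \<open>A word with a letter of weight zero contributes nothing, so two index sets need to agree
  only on the remaining words; this is how skip-freeness enters sums over words.\<close>

lemma word_sum_cong_weight:
  assumes "\<And>w. prod_list (map c w) \<noteq> 0 \<Longrightarrow> w \<in> A \<longleftrightarrow> w \<in> B"
  shows "word_sum c A = word_sum c B"
  unfolding word_sum_indicator
  by (intro nn_integral_cong) (use assms in \<open>auto split: split_indicator\<close>)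

text \<open>Weights are multiplicative under concatenation, so unique factorisation of the words of
  \<open>C\<close> turns the sum into a product.\<close>

lemma word_sum_append:
  assumes bij: "bij_betw (\<lambda>(v, w). v @ w) (A \<times> B) C"
  shows "word_sum c C = word_sum c A * word_sum c B"
proof -
  let ?p = "\<lambda>w. prod_list (map c w)"
  have "word_sum c C = (\<integral>\<^sup>+x. (case x of (v, w) \<Rightarrow> ?p v * ?p w) \<partial>count_space (A \<times> B))"
    unfolding word_sum_def nn_integral_bij_count_space[OF bij, symmetric]
    by (intro nn_integral_cong) auto
  also have "\<dots> = (\<integral>\<^sup>+x. (case x of (v, w) \<Rightarrow> (?p v * indicator A v) * (?p w * indicator B w)) \<partial>count_space UNIV)"
    unfolding nn_integral_count_space_UNIV[where A="A \<times> B"]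
    by (intro nn_integral_cong) (auto simp: indicator_times ac_simps)
  also have "\<dots> = (\<integral>\<^sup>+v. \<integral>\<^sup>+w. (?p v * indicator A v) * (?p w * indicator B w) \<partial>count_space UNIV \<partial>count_space UNIV)"
    by (subst nn_integral_fst_count_space[symmetric]) simp
  also have "\<dots> = word_sum c A * word_sum c B"
    unfolding word_sum_indicator by (simp add: nn_integral_cmult nn_integral_multc)
  finally show ?thesis .
qed

lemma nn_integral_list_Cons:
  fixes f :: "'a list \<Rightarrow> ennreal"
  shows "(\<integral>\<^sup>+w. f w \<partial>count_space UNIV)
    = f [] + (\<integral>\<^sup>+j. \<integral>\<^sup>+v. f (j # v) \<partial>count_space UNIV \<partial>count_space UNIV)"
proof -
  have "f w = f w * indicator {[]} w + f w * indicator (- {[]}) w" for w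
    by (auto split: split_indicator)
  then have "(\<integral>\<^sup>+w. f w \<partial>count_space UNIV)
    = (\<integral>\<^sup>+w. f w * indicator {[]} w \<partial>count_space UNIV) + (\<integral>\<^sup>+w. f w * indicator (- {[]}) w \<partial>count_space UNIV)"
    by (subst nn_integral_add[symmetric]) (auto intro!: nn_integral_cong)
  also have "(\<integral>\<^sup>+w. f w * indicator {[]} w \<partial>count_space UNIV) = f []"
    by (subst nn_integral_indicator_finite) auto
  also have "(\<integral>\<^sup>+w. f w * indicator (- {[]}) w \<partial>count_space UNIV) = (\<integral>\<^sup>+w. f w \<partial>count_space (- {[]}))"
    by (subst (2) nn_integral_count_space_indicator) auto
  also have "\<dots> = (\<integral>\<^sup>+x. f (case x of (j, v) \<Rightarrow> j # v) \<partial>count_space UNIV)"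
    by (rule nn_integral_bij_count_space[symmetric])
      (auto simp: bij_betw_def inj_on_def image_iff, metis list.exhaust)
  also have "\<dots> = (\<integral>\<^sup>+j. \<integral>\<^sup>+v. f (j # v) \<partial>count_space UNIV \<partial>count_space UNIV)"
    by (subst nn_integral_fst_count_space[symmetric]) simp
  finally show ?thesis .
qed

text \<open>The last letter is split off and the rest is enumerated in reversed order: an excursion
  is read backwards from its final jump, as duality requires.\<close>

lemma nn_integral_list_snoc:
  fixes f :: "'a list \<Rightarrow> ennreal"
  shows "(\<integral>\<^sup>+w. f w \<partial>count_space UNIV)
    = f [] + (\<integral>\<^sup>+j. \<integral>\<^sup>+v. f (rev v @ [j]) \<partial>count_space UNIV \<partial>count_space UNIV)"
proof -
  have "bij_betw rev (UNIV :: 'a list set) UNIV"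
    by (auto simp: bij_betw_def intro!: surjI[of rev rev])
  from nn_integral_bij_count_space[OF this]
  have "(\<integral>\<^sup>+w. f w \<partial>count_space UNIV) = (\<integral>\<^sup>+w. f (rev w) \<partial>count_space UNIV)" ..
  also have "\<dots> = f (rev []) + (\<integral>\<^sup>+j. \<integral>\<^sup>+v. f (rev (j # v)) \<partial>count_space UNIV \<partial>count_space UNIV)"
    by (rule nn_integral_list_Cons)
  finally show ?thesis by simp
qed

text \<open>Marked words play the role of regeneration epochs of a walk: what happens after a marked
  epoch is marked independently of what happened before it.\<close>

locale regenerative =
  fixes mk :: "'a list \<Rightarrow> bool"
  assumes mk_Nil: "mk []"
    and mk_append: "\<And>v w. mk v \<Longrightarrow> mk (v @ w) \<longleftrightarrow> mk w"
begin

text \<open>Only proper prefixes are counted. The empty word thus has count 0, the count is additive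
  over a marked cut, and a marked word of count \<open>i\<close> consists of \<open>i\<close>
  successive blocks.\<close>

definition cnt :: "'a list \<Rightarrow> nat" where
  "cnt w = card {k. k < length w \<and> mk (take k w)}"

definition level :: "nat \<Rightarrow> 'a list set" where
  "level i = {w. mk w \<and> cnt w = i}"

text \<open>Beyond the cut, a prefix is \<open>v\<close> followed by a prefix of \<open>w\<close>,
  and it is marked exactly when the latter is; the cut itself corresponds to the empty prefix of
  \<open>w\<close>.\<close>

lemma cnt_append:
  assumes "mk v"
  shows "cnt (v @ w) = cnt v + cnt w"
proof -
  have eq: "{k. k < length (v @ w) \<and> mk (take k (v @ w))}
      = {k. k < length v \<and> mk (take k v)} \<union> (\<lambda>k. length v + k) ` {k. k < length w \<and> mk (take k w)}"
    (is "?L = ?A \<union> ?f ` ?B")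
  proof (intro set_eqI iffI)
    fix k assume k: "k \<in> ?L"
    show "k \<in> ?A \<union> ?f ` ?B"
    proof (cases "k < length v")
      case False
      then obtain i where "k = length v + i"
        using le_Suc_ex not_less by blast
      then show ?thesis
        using k mk_append[OF assms] by auto
    next
      case True
      then have "k \<in> ?A" using k by simp
      then show ?thesis ..
    qed
  next
    fix k assume "k \<in> ?A \<union> ?f ` ?B"
    then consider "k \<in> ?A" | i where "k = length v + i" "i \<in> ?B"
      by blast
    then show "k \<in> ?L"
      by cases (simp_all add: mk_append[OF assms])
  qed
  have "card ?L = card ?A + card (?f ` ?B)"
    unfolding eq by (rule card_Un_disjoint) auto
  moreover have "card (?f ` ?B) = card ?B"
    by (rule card_image) (auto simp: inj_on_def)
  ultimately show ?thesis
    by (simp add: cnt_def)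
qed

lemma cnt_eq_0_iff: "cnt w = 0 \<longleftrightarrow> w = []"
proof
  assume "cnt w = 0"
  then have "{k. k < length w \<and> mk (take k w)} = {}"
    by (simp add: cnt_def)
  then have "\<not> 0 < length w"
    using mk_Nil by (metis (mono_tags, lifting) empty_iff mem_Collect_eq take0)
  then show "w = []" by simp
qed (simp add: cnt_def)

lemma level_0: "level 0 = {[]}"
  using mk_Nil by (auto simp: level_def cnt_eq_0_iff)

text \<open>The level-one words form a prefix code, which makes the factorisation below
  unique.\<close>

lemma level_1_prefix:
  assumes "v \<in> level 1" "v @ w \<in> level 1"
  shows "w = []"
  using assms cnt_append[of v w] by (simp add: level_def cnt_eq_0_iff)

lemma bij_betw_level_Suc: "bij_betw (\<lambda>(v, w). v @ w) (level 1 \<times> level i) (level (Suc i))"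
  unfolding bij_betw_def
proof (intro conjI set_eqI iffI)
  show "inj_on (\<lambda>(v, w). v @ w) (level 1 \<times> level i)"
  proof (rule inj_onI, clarify)
    fix v w v' w' assume *: "v \<in> level 1" "v' \<in> level 1" and eq: "v @ w = v' @ w'"
    from eq obtain us where "v = v' @ us \<and> us @ w = w' \<or> v @ us = v' \<and> w = us @ w'"
      by (auto simp: append_eq_append_conv2)
    with * level_1_prefix show "v = v' \<and> w = w'" by blast
  qed
next
  fix u assume "u \<in> (\<lambda>(v, w). v @ w) ` (level 1 \<times> level i)"
  then show "u \<in> level (Suc i)"
    by (auto simp: level_def mk_append cnt_append)
next
  fix u assume u: "u \<in> level (Suc i)"
  then have "u \<noteq> []" "mk u"
    using cnt_eq_0_iff[of u] by (auto simp: level_def)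
  \<comment> \<open>The first regeneration after the start: by minimality the empty word is the only
    marked proper prefix of \<open>take k u\<close>.\<close>
  define k where "k = (LEAST k. 0 < k \<and> mk (take k u))"
  have ex: "0 < length u \<and> mk (take (length u) u)"
    using \<open>u \<noteq> []\<close> \<open>mk u\<close> by simp
  then have k: "0 < k" "mk (take k u)"
    using LeastI[of "\<lambda>k. 0 < k \<and> mk (take k u)", OF ex] by (auto simp: k_def)
  have k_le: "k \<le> length u"
    unfolding k_def by (rule Least_le) (use ex in simp)
  have "{i. i < length (take k u) \<and> mk (take i (take k u))} = {0}"
  proof (intro set_eqI iffI)
    fix i assume i: "i \<in> {i. i < length (take k u) \<and> mk (take i (take k u))}"
    then have "i < k"
      by simp
    then have "mk (take i u)"
      using i by (simp add: min_absorb1)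
    with \<open>i < k\<close> show "i \<in> {0}"
      using not_less_Least[of i "\<lambda>k. 0 < k \<and> mk (take k u)"] by (auto simp: k_def)
  qed (use k k_le mk_Nil in auto)
  then have 1: "take k u \<in> level 1"
    using k by (simp add: level_def cnt_def)
  have "mk (drop k u)"
    using mk_append[OF k(2), of "drop k u"] \<open>mk u\<close> by simp
  moreover have "cnt (drop k u) = i"
    using cnt_append[OF k(2), of "drop k u"] u 1 by (simp add: level_def)
  ultimately have "drop k u \<in> level i"
    by (simp add: level_def)
  with 1 show "u \<in> (\<lambda>(v, w). v @ w) ` (level 1 \<times> level i)"
    by (auto intro!: image_eqI[where x="(take k u, drop k u)"])
qed

lemma word_sum_level: "word_sum c (level i) = word_sum c (level 1) ^ i"
proof (induction i)
  case 0
  show ?case by (simp add: level_0 word_sum_def nn_integral_count_space_finite)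
next
  case (Suc i)
  then show ?case
    using word_sum_append[OF bij_betw_level_Suc, of c i] by simp
qed

text \<open>Marked words are grouped by their count; each group has as its weight a power of the
  level-one weight. With \<open>F\<close> a Poisson weight the result is an exponential
  series.\<close>

lemma nn_integral_marked:
  "(\<integral>\<^sup>+w. prod_list (map c w) * F (cnt w) * indicator {w. mk w} w \<partial>count_space UNIV)
    = (\<Sum>i. word_sum c (level 1) ^ i * F i)"
proof -
  have "prod_list (map c w) * F (cnt w) * indicator {w. mk w} w
      = (\<Sum>i. prod_list (map c w) * indicator (level i) w * F i)" for w
  proof -
    have "(\<Sum>i. prod_list (map c w) * indicator (level i) w * F i)
        = (\<Sum>i\<in>{cnt w}. prod_list (map c w) * indicator (level i) w * F i)"
      by (rule suminf_finite) (auto simp: level_def)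
    also have "\<dots> = prod_list (map c w) * F (cnt w) * indicator {w. mk w} w"
      by (simp add: level_def indicator_def)
    finally show ?thesis ..
  qed
  then have "(\<integral>\<^sup>+w. prod_list (map c w) * F (cnt w) * indicator {w. mk w} w \<partial>count_space UNIV)
      = (\<integral>\<^sup>+w. (\<Sum>i. prod_list (map c w) * indicator (level i) w * F i) \<partial>count_space UNIV)"
    by (simp only:)
  also have "\<dots> = (\<Sum>i. word_sum c (level i) * F i)"
    by (subst nn_integral_suminf) (simp_all add: word_sum_indicator nn_integral_multc)
  also have "\<dots> = (\<Sum>i. word_sum c (level 1) ^ i * F i)"
    by (intro suminf_cong arg_cong2[where f="(*)"] word_sum_level refl)
  finally show ?thesis .
qed

end

section \<open>Ladder words of upwards skip-free walks\<close>

text \<open>Records are strict for maxima and weak for minima. This pairing matches the two local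
  times, and it is the one that reversal of words exchanges.\<close>

definition asc :: "int list \<Rightarrow> bool" where
  "asc w \<longleftrightarrow> (\<forall>k<length w. sum_list (take k w) < sum_list w)"

definition desc :: "int list \<Rightarrow> bool" where
  "desc w \<longleftrightarrow> (\<forall>k\<le>length w. sum_list w \<le> sum_list (take k w))"

lemma asc_sum_nonneg: "asc w \<Longrightarrow> 0 \<le> sum_list w"
  unfolding asc_def by (cases w) (auto dest!: spec[of _ 0])

lemma desc_sum_nonpos: "desc w \<Longrightarrow> sum_list w \<le> 0"
  unfolding desc_def by (auto dest!: spec[of _ 0])

interpretation asc: regenerative asc
proof
  show "asc []" by (simp add: asc_def)
next
  fix v w assume v: "asc v"
  show "asc (v @ w) \<longleftrightarrow> asc w"
  proof
    assume vw: "asc (v @ w)"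
    show "asc w"
      unfolding asc_def
    proof (intro allI impI)
      fix k assume "k < length w"
      then show "sum_list (take k w) < sum_list w"
        using vw[unfolded asc_def, rule_format, of "length v + k"] by simp
    qed
  next
    assume w: "asc w"
    show "asc (v @ w)"
      unfolding asc_def
    proof (intro allI impI)
      fix k assume k: "k < length (v @ w)"
      show "sum_list (take k (v @ w)) < sum_list (v @ w)"
      proof (cases "k < length v")
        case True
        then show ?thesis
          using v asc_sum_nonneg[OF w] by (auto simp: asc_def)
      next
        case False
        then show ?thesis
          using k w by (auto simp: asc_def)
      qed
    qed
  qed
qed

interpretation desc: regenerative desc
proof
  show "desc []" by (simp add: desc_def)
next
  fix v w assume v: "desc v"
  show "desc (v @ w) \<longleftrightarrow> desc w"
  proof
    assume vw: "desc (v @ w)"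
    show "desc w"
      unfolding desc_def
    proof (intro allI impI)
      fix k assume "k \<le> length w"
      then show "sum_list w \<le> sum_list (take k w)"
        using vw[unfolded desc_def, rule_format, of "length v + k"] by simp
    qed
  next
    assume w: "desc w"
    show "desc (v @ w)"
      unfolding desc_def
    proof (intro allI impI)
      fix k assume k: "k \<le> length (v @ w)"
      show "sum_list (v @ w) \<le> sum_list (take k (v @ w))"
      proof (cases "k < length v")
        case True
        then show ?thesis
          using v[unfolded desc_def, rule_format, of k] desc_sum_nonpos[OF w] by auto
      next
        case False
        then show ?thesis
          using k w[unfolded desc_def, rule_format, of "k - length v"] by auto
      qed
    qed
  qed
qed

text \<open>With steps at most 1 a strict record raises the running maximum by exactly one. The
  \<open>+ 1\<close> accounts for the empty prefix, a record at level 0.\<close>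

lemma card_asc_prefixes:
  assumes "\<forall>j\<in>set w. j \<le> 1"
  shows "int (card {k. k \<le> length w \<and> asc (take k w)}) = Max ((\<lambda>k. sum_list (take k w)) ` {..length w}) + 1"
  using assms
proof (induction w rule: rev_induct)
  case Nil
  show ?case by (simp add: asc.mk_Nil)
next
  case (snoc j w)
  define m where "m = Max ((\<lambda>k. sum_list (take k w)) ` {..length w})"
  let ?w = "w @ [j]"
  have IH: "int (card {k. k \<le> length w \<and> asc (take k w)}) = m + 1"
    using snoc by (simp add: m_def)
  have le_m: "sum_list (take k w) \<le> m" if "k \<le> length w" for k
    unfolding m_def using that by (intro Max_ge) auto
  obtain k0 where k0: "k0 \<le> length w" "sum_list (take k0 w) = m"
  proof -
    have "m \<in> (\<lambda>k. sum_list (take k w)) ` {..length w}"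
      unfolding m_def by (rule Max_in) auto
    then show ?thesis using that by auto
  qed
  have img: "(\<lambda>k. sum_list (take k ?w)) ` {..length ?w} = insert (sum_list ?w) ((\<lambda>k. sum_list (take k w)) ` {..length w})"
  proof -
    have "{..length ?w} = insert (length ?w) {..length w}" by auto
    then have "(\<lambda>k. sum_list (take k ?w)) ` {..length ?w}
        = insert (sum_list ?w) ((\<lambda>k. sum_list (take k ?w)) ` {..length w})" by simp
    also have "(\<lambda>k. sum_list (take k ?w)) ` {..length w} = (\<lambda>k. sum_list (take k w)) ` {..length w}"
      by (intro image_cong) auto
    finally show ?thesis .
  qed
  have Max': "Max ((\<lambda>k. sum_list (take k ?w)) ` {..length ?w}) = max (sum_list w + j) m"
    unfolding img m_def by (subst Max_insert) auto
  have asc_iff: "asc ?w \<longleftrightarrow> m < sum_list w + j"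
  proof
    assume "asc ?w"
    then show "m < sum_list w + j"
      using k0 by (auto simp: asc_def dest!: spec[of _ k0])
  next
    assume "m < sum_list w + j"
    then show "asc ?w"
      using le_m by (auto simp: asc_def less_Suc_eq_le intro: le_less_trans)
  qed
  have sets: "{k. k \<le> length ?w \<and> asc (take k ?w)}
      = {k. k \<le> length w \<and> asc (take k w)} \<union> (if asc ?w then {Suc (length w)} else {})"
    by (auto simp: le_Suc_eq)
  have card: "int (card {k. k \<le> length ?w \<and> asc (take k ?w)}) = m + 1 + of_bool (asc ?w)"
    unfolding sets using IH by (subst card_Un_disjoint) auto
  \<comment> \<open>Together these bound a new record by \<open>m + 1\<close>, so the maximum cannot
    skip a level.\<close>
  have "j \<le> 1" "sum_list w \<le> m"
    using snoc.prems le_m[of "length w"] by auto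
  then show ?case
    unfolding Max' card by (auto simp: asc_iff)
qed

lemma asc_cnt_eq_sum:
  assumes w: "asc w" and le: "\<forall>j\<in>set w. j \<le> 1"
  shows "int (asc.cnt w) = sum_list w"
proof -
  have "sum_list (take k w) \<le> sum_list w" if "k \<le> length w" for k
    using w that by (cases "k = length w") (auto simp: asc_def less_imp_le)
  then have "Max ((\<lambda>k. sum_list (take k w)) ` {..length w}) = sum_list w"
    by (intro Max_eqI) (auto intro!: image_eqI[where x="length w"])
  moreover have "{k. k \<le> length w \<and> asc (take k w)} = insert (length w) {k. k < length w \<and> asc (take k w)}"
    using w by (auto simp: le_less)
  ultimately show ?thesis
    using card_asc_prefixes[OF le] by (simp add: asc.cnt_def)
qed

text \<open>The partial sums of \<open>rev v\<close> are the total of \<open>v\<close> minus partial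
  sums of \<open>v\<close>. Hence \<open>asc v\<close> says that the reversed path stays strictly
  positive after its start, and the final jump \<open>j\<close> produces the first return to or
  below 0.\<close>

lemma desc_level_1_snoc: "rev v @ [j] \<in> desc.level 1 \<longleftrightarrow> asc v \<and> sum_list v + j \<le> 0"
proof -
  let ?w = "rev v @ [j]"
  have asc_iff: "asc v \<longleftrightarrow> (\<forall>k. 0 < k \<longrightarrow> k \<le> length v \<longrightarrow> 0 < sum_list (take k ?w))"
  proof -
    have eq: "sum_list (take k ?w) = sum_list v - sum_list (take (length v - k) v)" if "k \<le> length v" for k
    proof -
      have "sum_list (take (length v - k) v @ drop (length v - k) v) = sum_list v"
        by (simp only: append_take_drop_id)
      then show ?thesis
        using that by (simp add: take_rev sum_list_rev del: append_take_drop_id)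
    qed
    show ?thesis
    proof
      assume "asc v"
      then show "\<forall>k. 0 < k \<longrightarrow> k \<le> length v \<longrightarrow> 0 < sum_list (take k ?w)"
        by (auto simp: eq asc_def simp del: take_append)
    next
      assume *: "\<forall>k. 0 < k \<longrightarrow> k \<le> length v \<longrightarrow> 0 < sum_list (take k ?w)"
      show "asc v"
        unfolding asc_def
      proof (intro allI impI)
        fix k assume "k < length v"
        then show "sum_list (take k v) < sum_list v"
          using *[rule_format, of "length v - k"] eq[of "length v - k"] by simp
      qed
    qed
  qed
  show ?thesis
  proof
    assume L: "?w \<in> desc.level 1"
    then have card: "card {k. k < length ?w \<and> desc (take k ?w)} = 1" and "desc ?w"
      unfolding desc.level_def desc.cnt_def by blast+
    from card obtain a where a: "{k. k < length ?w \<and> desc (take k ?w)} = {a}"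
      by (rule card_1_singletonE)
    have "0 \<in> {k. k < length ?w \<and> desc (take k ?w)}"
      using desc.mk_Nil by simp
    then have *: "{k. k < length ?w \<and> desc (take k ?w)} = {0}"
      unfolding a by simp
    \<comment> \<open>Strong induction: the first non-positive partial sum would be a weak minimum
      at a non-empty proper prefix, whereas only the empty prefix is marked.\<close>
    have pos: "0 < sum_list (take k ?w)" if "0 < k" "k \<le> length v" for k
      using that
    proof (induction k rule: less_induct)
      case (less k)
      show ?case
      proof (rule ccontr)
        assume neg: "\<not> 0 < sum_list (take k ?w)"
        have "desc (take k ?w)"
          unfolding desc_def
        proof (intro allI impI)
          fix i assume "i \<le> length (take k ?w)"
          then have i: "i \<le> k" by simp
          have "take i (take k ?w) = take i ?w"
            by (subst take_take) (simp only: min_absorb1[OF i])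
          moreover have "sum_list (take k ?w) \<le> sum_list (take i ?w)"
          proof (cases "i = 0 \<or> i = k")
            case True
            then show ?thesis using neg by (elim disjE) (simp_all only: take0 sum_list.Nil not_less order_refl)
          next
            case False
            then have "0 < sum_list (take i ?w)"
              using i less.prems by (intro less.IH) auto
            then show ?thesis using neg by linarith
          qed
          ultimately show "sum_list (take k ?w) \<le> sum_list (take i (take k ?w))"
            by (simp only:)
        qed
        then have "k \<in> {k. k < length ?w \<and> desc (take k ?w)}"
          using less.prems by simp
        then show False using less.prems(1) unfolding * by simp
      qed
    qed
    then have "asc v"
      using asc_iff by blast
    moreover have "sum_list v + j \<le> 0"
      using desc_sum_nonpos[OF \<open>desc ?w\<close>] by (simp add: sum_list_rev)
    ultimately show "asc v \<and> sum_list v + j \<le> 0" ..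
  next
    assume *: "asc v \<and> sum_list v + j \<le> 0"
    then have pos: "0 < sum_list (take k ?w)" if "0 < k" "k \<le> length v" for k
      using asc_iff that by blast
    have nn: "0 \<le> sum_list (take k ?w)" if "k \<le> length v" for k
      using pos[of k] that by (cases "k = 0") auto
    have "desc ?w"
      unfolding desc_def
    proof (intro allI impI)
      fix k assume k: "k \<le> length ?w"
      show "sum_list ?w \<le> sum_list (take k ?w)"
      proof (cases "k = length ?w")
        case False
        then have "k \<le> length v" using k by simp
        then show ?thesis using nn[of k] * by (simp add: sum_list_rev)
      qed simp
    qed
    moreover have "{k. k < length ?w \<and> desc (take k ?w)} = {0}"
    proof (intro set_eqI iffI)
      fix k assume k: "k \<in> {k. k < length ?w \<and> desc (take k ?w)}"
      show "k \<in> {0}"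
      proof (rule ccontr)
        assume "k \<notin> {0}"
        then have "0 < sum_list (take k ?w)" using k by (intro pos) auto
        moreover have "sum_list (take k ?w) \<le> 0"
          using k by (intro desc_sum_nonpos) blast
        ultimately show False by linarith
      qed
    qed (use desc.mk_Nil in auto)
    ultimately show "?w \<in> desc.level 1"
      by (simp add: desc.level_def desc.cnt_def)
  qed
qed

section \<open>First-passage weights of skip-free walks\<close>

definition asc_to :: "int \<Rightarrow> int list set" where
  "asc_to i = {w. asc w \<and> sum_list w = i}"

text \<open>For a positive target the condition on the empty prefix is automatic, so only the tail
  is constrained.\<close>

lemma Cons_in_asc_to:
  assumes "0 < i"
  shows "j # v \<in> asc_to i \<longleftrightarrow> v \<in> asc_to (i - j)"
  using assms by (auto simp: asc_to_def asc_def less_Suc_eq_0_disj)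

locale skip_free_weights =
  fixes c :: "int \<Rightarrow> ennreal"
  assumes skip_free: "\<And>j. 1 < j \<Longrightarrow> c j = 0"
begin

text \<open>For probability weights this is the probability of ever reaching level 1: the words of
  positive weight in the sum are the histories up to the first passage.\<close>

definition rho :: ennreal where
  "rho = word_sum c (asc.level 1)"

lemma weight_nonzero: "prod_list (map c w) \<noteq> 0 \<Longrightarrow> \<forall>j\<in>set w. j \<le> 1"
proof (induction w)
  case (Cons j w)
  then have "c j \<noteq> 0" by auto
  then have "j \<le> 1" using skip_free[of j] by linarith
  with Cons show ?case by auto
qed simp

lemma word_sum_asc_to: "word_sum c (asc_to (int i)) = rho ^ i"
proof -
  have "word_sum c (asc_to (int i)) = word_sum c (asc.level i)"
  proof (rule word_sum_cong_weight)
    fix w :: "int list" assume "prod_list (map c w) \<noteq> 0"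
    then have "\<forall>j\<in>set w. j \<le> 1" by (rule weight_nonzero)
    then show "w \<in> asc_to (int i) \<longleftrightarrow> w \<in> asc.level i"
      using asc_cnt_eq_sum[of w] by (auto simp: asc_to_def asc.level_def)
  qed
  also have "\<dots> = rho ^ i"
    unfolding rho_def by (rule asc.word_sum_level)
  finally show ?thesis .
qed

text \<open>Condition on the first step \<open>j\<close>: the target is then \<open>1 - j\<close>
  levels away, and each level costs a factor \<open>rho\<close>. For \<open>j = 1\<close> the
  exponent is 0.\<close>

lemma rho_fixed_point:
  "rho = (\<integral>\<^sup>+j. c j * rho ^ nat (1 - j) \<partial>count_space UNIV)"
proof -
  have "rho = word_sum c (asc_to 1)"
    using word_sum_asc_to[of 1] by simp
  also have "\<dots> = (\<integral>\<^sup>+j. \<integral>\<^sup>+v. c j * (prod_list (map c v) * indicator (asc_to (1 - j)) v) \<partial>count_space UNIV \<partial>count_space UNIV)"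
    unfolding word_sum_indicator
    by (subst nn_integral_list_Cons)
      (auto simp: asc_to_def[of 1] Cons_in_asc_to[of 1, unfolded asc_to_def[of 1], simplified]
        intro!: nn_integral_cong split: split_indicator)
  also have "\<dots> = (\<integral>\<^sup>+j. c j * word_sum c (asc_to (1 - j)) \<partial>count_space UNIV)"
    by (simp add: nn_integral_cmult word_sum_indicator)
  also have "\<dots> = (\<integral>\<^sup>+j. c j * rho ^ nat (1 - j) \<partial>count_space UNIV)"
  proof (intro nn_integral_cong)
    fix j :: int
    show "c j * word_sum c (asc_to (1 - j)) = c j * rho ^ nat (1 - j)"
      using skip_free[of j] word_sum_asc_to[of "nat (1 - j)"] by (cases "1 < j") auto
  qed
  finally show ?thesis .
qed

text \<open>The total weight of the paths of length at most \<open>n\<close> is bounded by a power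
  of \<open>s\<close>, by induction on \<open>n\<close> through the first step; monotone convergence
  removes the bound on the length.\<close>

lemma rho_least:
  assumes s: "(\<integral>\<^sup>+j. c j * s ^ nat (1 - j) \<partial>count_space UNIV) \<le> s"
  shows "rho \<le> s"
proof -
  define R where "R n i = (\<integral>\<^sup>+w. prod_list (map c w) * indicator {w \<in> asc_to i. length w \<le> n} w \<partial>count_space UNIV)" for n i
  have R: "R n i \<le> s ^ nat i" if "0 \<le> i" for n i
    using that
  proof (induction n arbitrary: i)
    case 0
    have "R 0 i = (\<integral>\<^sup>+(w :: int list). of_bool (i = 0) * indicator {[]} w \<partial>count_space UNIV)"
      unfolding R_def by (intro nn_integral_cong) (auto simp: asc_to_def asc.mk_Nil split: split_indicator)
    then show ?case
      by (auto simp: nn_integral_cmult)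
  next
    case (Suc n)
    show ?case
    proof (cases "i = 0")
      case True
      have "asc_to 0 = {[]}"
      proof -
        have "w = []" if "asc w" "sum_list w = 0" for w
          using that by (cases w) (auto simp: asc_def dest!: spec[of _ 0])
        then show ?thesis by (auto simp: asc_to_def asc.mk_Nil)
      qed
      then have "R (Suc n) i = (\<integral>\<^sup>+(w :: int list). indicator {[]} w \<partial>count_space UNIV)"
        unfolding R_def True by (intro nn_integral_cong) (auto split: split_indicator)
      then show ?thesis using True by simp
    next
      case False
      then have i: "0 < i" using Suc.prems by simp
      have "R (Suc n) i = (\<integral>\<^sup>+j. \<integral>\<^sup>+v. c j * (prod_list (map c v) * indicator {w \<in> asc_to (i - j). length w \<le> n} v) \<partial>count_space UNIV \<partial>count_space UNIV)"
      proof -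
        have "[] \<notin> asc_to i" using i by (simp add: asc_to_def)
        then show ?thesis
          unfolding R_def by (subst nn_integral_list_Cons) (simp add: Cons_in_asc_to[OF i] indicator_def mult.assoc)
      qed
      also have "\<dots> = (\<integral>\<^sup>+j. c j * R n (i - j) \<partial>count_space UNIV)"
        by (simp add: nn_integral_cmult R_def)
      \<comment> \<open>Of the \<open>i - j\<close> levels left, \<open>i - 1\<close> are common to
        all \<open>j\<close>; their factor comes out and the hypothesis on \<open>s\<close> handles
        the other \<open>1 - j\<close>.\<close>
      also have "\<dots> \<le> (\<integral>\<^sup>+j. c j * s ^ nat (1 - j) * s ^ nat (i - 1) \<partial>count_space UNIV)"
      proof (intro nn_integral_mono)
        fix j :: int
        show "c j * R n (i - j) \<le> c j * s ^ nat (1 - j) * s ^ nat (i - 1)"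
        proof (cases "1 < j")
          case False
          then have "nat (i - j) = nat (1 - j) + nat (i - 1)" using i by simp
          moreover have "R n (i - j) \<le> s ^ nat (i - j)" using False i by (intro Suc.IH) simp
          ultimately show ?thesis by (simp add: mult.assoc power_add[symmetric] mult_left_mono)
        qed (simp add: skip_free)
      qed
      also have "\<dots> = (\<integral>\<^sup>+j. c j * s ^ nat (1 - j) \<partial>count_space UNIV) * s ^ nat (i - 1)"
        by (rule nn_integral_multc) auto
      also have "\<dots> \<le> s * s ^ nat (i - 1)"
        by (intro mult_right_mono s) simp
      also have "\<dots> = s ^ nat i"
        using i by (simp flip: power_Suc add: Suc_nat_eq_nat_zadd1)
      finally show ?thesis .
    qed
  qed
  have "rho = word_sum c (asc_to 1)"
    using word_sum_asc_to[of 1] by simp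
  also have "\<dots> = (\<integral>\<^sup>+w. (SUP n. prod_list (map c w) * indicator {w \<in> asc_to 1. length w \<le> n} w) \<partial>count_space UNIV)"
    unfolding word_sum_indicator
  proof (intro nn_integral_cong)
    fix w
    show "prod_list (map c w) * indicator (asc_to 1) w = (SUP n. prod_list (map c w) * indicator {w \<in> asc_to 1. length w \<le> n} w)"
      by (intro antisym SUP_upper2[of "length w"] SUP_least) (auto split: split_indicator)
  qed
  also have "\<dots> = (SUP n. R n 1)"
    unfolding R_def
    by (rule nn_integral_monotone_convergence_SUP)
      (auto simp: incseq_def le_fun_def split: split_indicator)
  also have "\<dots> \<le> s"
    using R[of 1] by (intro SUP_least) auto
  finally show ?thesis .
qed

text \<open>Duality: reversing the steps turns an excursion above a weak minimum into a path to a
  strict maximum.\<close>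

lemma word_sum_desc_level_1:
  assumes z: "0 < z"
  shows "word_sum (\<lambda>j. c j * ennreal (z powi (- j))) (desc.level 1)
    = (\<integral>\<^sup>+j. \<integral>\<^sup>+m. c j * rho ^ m * ennreal (z powi (- (int m + j))) * indicator {m. int m + j \<le> 0} m
        \<partial>count_space UNIV \<partial>count_space UNIV)"
proof -
  \<comment> \<open>The tilting factor is multiplicative in the letters, hence depends on a word
    only through its total.\<close>
  define c' where "c' j = c j * ennreal (z powi (- j))" for j
  have c': "prod_list (map c' w) = prod_list (map c w) * ennreal (z powi (- sum_list w))" for w
  proof (induction w)
    case (Cons j w)
    have "z powi (- j) * z powi (- sum_list w) = z powi (- (j + sum_list w))"
      using z by (simp add: power_int_add[symmetric])
    then show ?case using Cons z
      by (simp add: c'_def ac_simps ennreal_mult[symmetric])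
  qed simp
  have nil: "[] \<notin> desc.level 1"
    by (simp add: desc.level_def desc.cnt_eq_0_iff desc.cnt_def)
  have "word_sum c' (desc.level 1)
      = (\<integral>\<^sup>+j. \<integral>\<^sup>+v. prod_list (map c' (rev v @ [j])) * indicator (desc.level 1) (rev v @ [j])
          \<partial>count_space UNIV \<partial>count_space UNIV)"
    unfolding word_sum_indicator by (subst nn_integral_list_snoc) (use nil in auto)
  \<comment> \<open>The end level \<open>m\<close> of the reversed path is introduced as a summation
    variable, so that the weights of \<open>asc_to\<close> appear; only
    \<open>m = nat (sum_list v)\<close> contributes.\<close>
  also have "\<dots> = (\<integral>\<^sup>+j. \<integral>\<^sup>+v. \<integral>\<^sup>+m. c j * ennreal (z powi (- (int m + j))) * indicator {m. int m + j \<le> 0} m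
        * (prod_list (map c v) * indicator (asc_to (int m)) v)
      \<partial>count_space UNIV \<partial>count_space UNIV \<partial>count_space UNIV)"
  proof (intro nn_integral_cong)
    fix j v
    show "prod_list (map c' (rev v @ [j])) * indicator (desc.level 1) (rev v @ [j])
      = (\<integral>\<^sup>+m. c j * ennreal (z powi (- (int m + j))) * indicator {m. int m + j \<le> 0} m
        * (prod_list (map c v) * indicator (asc_to (int m)) v) \<partial>count_space UNIV)" (is "?l = ?r")
    proof -
      have "?r = (\<integral>\<^sup>+m. ?l * indicator {nat (sum_list v)} m \<partial>count_space UNIV)"
      proof (intro nn_integral_cong)
        fix m :: nat
        have *: "int m = sum_list v \<longleftrightarrow> m = nat (sum_list v)" if "asc v"
          using asc_sum_nonneg[OF that] by auto
        have pl: "prod_list (map c' (rev v @ [j])) = c j * prod_list (map c v) * ennreal (z powi (- (sum_list v + j)))"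
          unfolding c' by (simp add: sum_list_rev rev_map[symmetric] prod_list.rev ac_simps)
        show "c j * ennreal (z powi (- (int m + j))) * indicator {m. int m + j \<le> 0} m
          * (prod_list (map c v) * indicator (asc_to (int m)) v) = ?l * indicator {nat (sum_list v)} m"
          unfolding pl desc_level_1_snoc indicator_def
          using * asc_sum_nonneg[of v] by (auto simp: asc_to_def ac_simps)
      qed
      also have "\<dots> = ?l" by (simp add: nn_integral_cmult)
      finally show ?thesis ..
    qed
  qed
  also have "\<dots> = (\<integral>\<^sup>+j. \<integral>\<^sup>+m. \<integral>\<^sup>+v. c j * ennreal (z powi (- (int m + j))) * indicator {m. int m + j \<le> 0} m
        * (prod_list (map c v) * indicator (asc_to (int m)) v)
      \<partial>count_space UNIV \<partial>count_space UNIV \<partial>count_space UNIV)"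
    by (intro nn_integral_cong nn_integral_count_space_nn_integral) auto
  also have "\<dots> = (\<integral>\<^sup>+j. \<integral>\<^sup>+m. c j * rho ^ m * ennreal (z powi (- (int m + j))) * indicator {m. int m + j \<le> 0} m
        \<partial>count_space UNIV \<partial>count_space UNIV)"
  proof (intro nn_integral_cong)
    fix j m
    let ?C = "c j * ennreal (z powi (- (int m + j))) * indicator {m. int m + j \<le> 0} m"
    have "(\<integral>\<^sup>+v. ?C * (prod_list (map c v) * indicator (asc_to (int m)) v) \<partial>count_space UNIV)
        = ?C * word_sum c (asc_to (int m))"
      unfolding word_sum_indicator by (rule nn_integral_cmult) auto
    then show "(\<integral>\<^sup>+v. ?C * (prod_list (map c v) * indicator (asc_to (int m)) v) \<partial>count_space UNIV)
        = c j * rho ^ m * ennreal (z powi (- (int m + j))) * indicator {m. int m + j \<le> 0} m"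
      by (simp add: word_sum_asc_to ac_simps)
  qed
  finally show ?thesis
    by (simp add: c'_def[abs_def])
qed

end

section \<open>Streams of holding times and jumps\<close>

definition holding_jump_law :: "real \<Rightarrow> int pmf \<Rightarrow> (real \<times> int) measure" where
  "holding_jump_law lam P = density lborel (exponential_density lam) \<Otimes>\<^sub>M measure_pmf P"

definition jump_stream_law :: "real \<Rightarrow> int pmf \<Rightarrow> (real \<times> int) stream measure" where
  "jump_stream_law lam P = stream_space (holding_jump_law lam P)"

abbreviation "jump_stream \<equiv> stream_space (borel \<Otimes>\<^sub>M count_space UNIV) :: (real \<times> int) stream measure"

definition jumps :: "nat \<Rightarrow> (real \<times> int) stream \<Rightarrow> int list" where
  "jumps n s = map snd (stake n s)"

definition clock :: "(nat \<Rightarrow> bool) \<Rightarrow> nat \<Rightarrow> (real \<times> int) stream \<Rightarrow> real" where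
  "clock m n s = (\<Sum>i<n. if m i then fst (s !! i) else 0)"

abbreviation arrival :: "nat \<Rightarrow> (real \<times> int) stream \<Rightarrow> real" where
  "arrival \<equiv> clock (\<lambda>_. True)"

definition in_epoch :: "nat \<Rightarrow> real \<Rightarrow> (real \<times> int) stream \<Rightarrow> bool" where
  "in_epoch n t s \<longleftrightarrow> arrival n s \<le> t \<and> t < arrival (Suc n) s"

text \<open>The stream seen from a time \<open>t\<close> in the \<open>n\<close>-th epoch.\<close>

definition shift_stream :: "nat \<Rightarrow> real \<Rightarrow> (real \<times> int) stream \<Rightarrow> (real \<times> int) stream" where
  "shift_stream n t s = (arrival (Suc n) s - t, snd (s !! n)) ## sdrop (Suc n) s"

text \<open>The value 0 for negative \<open>x\<close> lets the convolution with an exponential time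
  run over all holding times, including those that overshoot the level.\<close>

definition poisson_weight :: "nat \<Rightarrow> real \<Rightarrow> real" where
  "poisson_weight k x = (if x < 0 then 0 else exp (- x) * x ^ k / fact k)"

lemma jumps_0 [simp]: "jumps 0 s = []"
  and jumps_Suc_Stream [simp]: "jumps (Suc n) (x ## s) = snd x # jumps n s"
  and length_jumps [simp]: "length (jumps n s) = n"
  by (simp_all add: jumps_def)

lemma jumps_Suc: "jumps (Suc n) s = jumps n s @ [snd (s !! n)]"
  by (simp add: jumps_def stake_Suc del: stake.simps)

lemma jumps_eq_iff: "jumps n s = w \<longleftrightarrow> length w = n \<and> (\<forall>i<n. snd (s !! i) = w ! i)"
  by (auto simp: jumps_def list_eq_iff_nth_eq stake_nth)

lemma clock_0 [simp]: "clock m 0 s = 0"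
  and clock_Suc: "clock m (Suc n) s = clock m n s + (if m n then fst (s !! n) else 0)"
  by (simp_all add: clock_def)

lemma clock_Suc_Stream:
  "clock m (Suc n) (x ## s) = (if m 0 then fst x else 0) + clock (\<lambda>i. m (Suc i)) n s"
  unfolding clock_def sum.lessThan_Suc_shift by (auto intro!: sum.cong)

lemma sets_holding_jump_law [measurable_cong]:
  "sets (holding_jump_law lam P) = sets (borel \<Otimes>\<^sub>M count_space UNIV)"
  unfolding holding_jump_law_def by (intro sets_pair_measure_cong) auto

lemma sets_jump_stream_law [measurable_cong]:
  "sets (jump_stream_law lam P) = sets jump_stream"
  unfolding jump_stream_law_def by (intro sets_stream_space_cong sets_holding_jump_law)

lemma space_jump_stream [simp]: "space jump_stream = UNIV"
  by (simp add: space_stream_space space_pair_measure)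

lemma space_jump_stream_law [simp]: "space (jump_stream_law lam P) = UNIV"
  using sets_eq_imp_space_eq[OF sets_jump_stream_law, of lam P] by simp

lemma sets_jump_stream_law_Collect:
  assumes "Measurable.pred jump_stream A"
  shows "{s. A s} \<in> sets (jump_stream_law lam P)"
  using assms by (simp add: sets_jump_stream_law pred_def)

lemma measurable_jumps [measurable]: "jumps n \<in> jump_stream \<rightarrow>\<^sub>M count_space UNIV"
proof (rule iffD2[OF measurable_count_space_eq2_countable], intro conjI ballI)
  fix w :: "int list"
  have "jumps n -` {w} \<inter> space jump_stream
      = {s \<in> space jump_stream. length w = n \<and> (\<forall>i<n. snd (s !! i) = w ! i)}"
    unfolding jumps_eq_iff[symmetric] by auto
  also have "\<dots> \<in> sets jump_stream" by measurable
  finally show "jumps n -` {w} \<inter> space jump_stream \<in> sets jump_stream" .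
qed auto

lemma measurable_clock [measurable]: "clock m n \<in> borel_measurable jump_stream"
  unfolding clock_def by measurable

lemma pred_in_epoch [measurable]:
  "Measurable.pred (borel \<Otimes>\<^sub>M jump_stream) (\<lambda>(t, s). in_epoch n t s)"
  unfolding in_epoch_def by measurable

lemma measurable_shift_stream [measurable]:
  "(\<lambda>(t, s). shift_stream n t s) \<in> borel \<Otimes>\<^sub>M jump_stream \<rightarrow>\<^sub>M jump_stream"
  unfolding shift_stream_def by measurable

lemma in_epoch_0_Stream: "in_epoch 0 t (x ## s) \<longleftrightarrow> 0 \<le> t \<and> t < fst x"
  and in_epoch_Suc_Stream: "in_epoch (Suc n) t (x ## s) \<longleftrightarrow> in_epoch n (t - fst x) s"
  by (auto simp: in_epoch_def clock_Suc_Stream)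

lemma shift_stream_0_Stream: "shift_stream 0 t (x ## s) = (fst x - t, snd x) ## s"
  and shift_stream_Suc_Stream: "shift_stream (Suc n) t (x ## s) = shift_stream n (t - fst x) s"
  by (auto simp: shift_stream_def clock_Suc_Stream algebra_simps)

text \<open>The renewal recursion of the Poisson process: the first holding time uses up
  \<open>e\<close> of the level, after which \<open>k\<close> further points are needed. The two
  exponentials combine to a constant, leaving a polynomial in \<open>e\<close>.\<close>

lemma nn_integral_exponential_poisson_weight:
  assumes "0 < lam"
  shows "(\<integral>\<^sup>+e. ennreal (exponential_density lam e) * ennreal (poisson_weight k (lam * (a - e))) \<partial>lborel)
    = ennreal (poisson_weight (Suc k) (lam * a))"
proof (cases "0 \<le> a")
  case False
  have "(\<integral>\<^sup>+e. ennreal (exponential_density lam e) * ennreal (poisson_weight k (lam * (a - e))) \<partial>lborel)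
      = (\<integral>\<^sup>+(e :: real). 0 \<partial>lborel)"
    using False assms
    by (intro nn_integral_cong) (auto simp: exponential_density_def poisson_weight_def not_less mult_less_0_iff)
  then show ?thesis
    using False assms by (simp add: poisson_weight_def mult_less_0_iff)
next
  case True
  let ?f = "\<lambda>e. lam * exp (- lam * a) * (lam * (a - e)) ^ k / fact k"
  \<comment> \<open>An antiderivative of \<open>?f\<close> that vanishes at \<open>e = a\<close>;
    minus its value at 0 is the next Poisson weight.\<close>
  let ?F = "\<lambda>e. - exp (- lam * a) * (lam * (a - e)) ^ Suc k / fact (Suc k)"
  have "ennreal (exponential_density lam e) * ennreal (poisson_weight k (lam * (a - e)))
      = ennreal (?f e) * indicator {0..a} e" for e
  proof (cases "e \<in> {0..a}")
    case True
    have "lam * exp (- e * lam) * (exp (- (lam * (a - e))) * (lam * (a - e)) ^ k / fact k) = ?f e"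
      by (simp add: exp_add[symmetric] exp_diff exp_minus field_simps)
    then show ?thesis
      using True assms
      by (simp add: exponential_density_def poisson_weight_def not_less mult_less_0_iff ennreal_mult[symmetric])
  next
    case False
    then show ?thesis
      using assms by (auto simp: exponential_density_def poisson_weight_def mult_less_0_iff)
  qed
  then have "(\<integral>\<^sup>+e. ennreal (exponential_density lam e) * ennreal (poisson_weight k (lam * (a - e))) \<partial>lborel)
      = (\<integral>\<^sup>+e. ennreal (?f e) * indicator {0..a} e \<partial>lborel)"
    by simp
  also have "\<dots> = ennreal (?F a - ?F 0)"
  proof (rule nn_integral_FTC_Icc)
    fix e assume e: "e \<in> {0..a}"
    show "(?F has_real_derivative ?f e) (at e)"
    proof -
      have "((\<lambda>e. - exp (- lam * a) / fact (Suc k) * (lam * (a - e)) ^ Suc k) has_real_derivative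
          - exp (- lam * a) / fact (Suc k) * ((1 + real k) * ((- lam) * (lam * (a - e)) ^ k))) (at e)"
        by (intro DERIV_cmult DERIV_power_Suc) (auto intro!: derivative_eq_intros)
      moreover have "- exp (- lam * a) / fact (Suc k) * ((1 + real k) * ((- lam) * (lam * (a - e)) ^ k)) = ?f e"
        by (simp add: divide_simps) (simp add: algebra_simps)?
      ultimately show ?thesis by (simp add: mult.commute del: fact_Suc power_Suc)
    qed
    show "0 \<le> ?f e" using assms e by simp
  qed (use True in auto)
  also have "?F a - ?F 0 = poisson_weight (Suc k) (lam * a)"
    using True assms by (simp add: poisson_weight_def mult_less_0_iff)
  finally show ?thesis .
qed

locale jump_chain =
  fixes lam :: real and P :: "int pmf"
  assumes lam_pos: "0 < lam"
begin

abbreviation "Q \<equiv> jump_stream_law lam P"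

lemma prob_space_holding_jump_law: "prob_space (holding_jump_law lam P)"
proof -
  interpret E: prob_space "density lborel (exponential_density lam)"
    by (rule prob_space_exponential_density[OF lam_pos])
  interpret EP: pair_prob_space "density lborel (exponential_density lam)" "measure_pmf P" ..
  show ?thesis unfolding holding_jump_law_def by (rule EP.P.prob_space_axioms)
qed

lemma prob_space_Q: "prob_space Q"
  unfolding jump_stream_law_def
  by (rule prob_space.prob_space_stream_space[OF prob_space_holding_jump_law])

sublocale Q: prob_space Q by (rule prob_space_Q)

text \<open>Removing the first holding time and jump leaves an independent copy of the stream; the
  inductions over epochs rest on this.\<close>

lemma nn_integral_jump_stream:
  assumes [measurable]: "f \<in> borel_measurable jump_stream"
  shows "(\<integral>\<^sup>+s. f s \<partial>Q) = (\<integral>\<^sup>+e. ennreal (exponential_density lam e) *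
    (\<integral>\<^sup>+j. \<integral>\<^sup>+s. f ((e, j) ## s) \<partial>Q \<partial>measure_pmf P) \<partial>lborel)"
proof -
  interpret P: prob_space "holding_jump_law lam P" by (rule prob_space_holding_jump_law)
  have [measurable]: "f \<in> borel_measurable Q" by measurable
  have *[measurable]: "(\<lambda>x. \<integral>\<^sup>+s. f (x ## s) \<partial>Q) \<in> borel_measurable (borel \<Otimes>\<^sub>M count_space UNIV)"
    by measurable
  have "(\<integral>\<^sup>+s. f s \<partial>Q) = (\<integral>\<^sup>+x. \<integral>\<^sup>+s. f (x ## s) \<partial>Q \<partial>holding_jump_law lam P)"
    unfolding jump_stream_law_def
    by (rule P.nn_integral_stream_space) (simp add: jump_stream_law_def[symmetric])
  also have "\<dots> = (\<integral>\<^sup>+e. \<integral>\<^sup>+j. \<integral>\<^sup>+s. f ((e, j) ## s) \<partial>Q \<partial>measure_pmf P \<partial>density lborel (exponential_density lam))"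
    unfolding holding_jump_law_def
    by (subst measure_pmf.nn_integral_fst[symmetric]) simp_all
  also have "\<dots> = (\<integral>\<^sup>+e. ennreal (exponential_density lam e) *
    (\<integral>\<^sup>+j. \<integral>\<^sup>+s. f ((e, j) ## s) \<partial>Q \<partial>measure_pmf P) \<partial>lborel)"
    by (subst nn_integral_density) simp_all
  finally show ?thesis .
qed

lemma nn_integral_exponential_gt:
  "(\<integral>\<^sup>+e. ennreal (exponential_density lam e) * indicator {t<..} e \<partial>lborel)
    = ennreal (if t < 0 then 1 else exp (- (lam * t)))"
proof -
  interpret E: prob_space "density lborel (exponential_density lam)"
    by (rule prob_space_exponential_density[OF lam_pos])
  have "(\<integral>\<^sup>+e. ennreal (exponential_density lam e) * indicator {t<..} e \<partial>lborel)
      = emeasure (density lborel (exponential_density lam)) {t<..}"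
    by (subst emeasure_density) auto
  also have "\<dots> = E.prob (space (density lborel (exponential_density lam)) - {..t})"
    by (auto simp: E.emeasure_eq_measure intro!: arg_cong[where f=E.prob])
  also have "\<dots> = 1 - E.prob {..t}"
    by (subst E.prob_compl) auto
  also have "ennreal (E.prob {..t}) = ennreal (erlang_CDF 0 lam t)"
    using emeasure_erlang_density[OF lam_pos, of 0 t] E.emeasure_eq_measure[of "{..t}"] by simp
  then have "E.prob {..t} = erlang_CDF 0 lam t"
    using lam_pos by (simp add: erlang_CDF_0 mult_less_0_iff)
  finally show ?thesis
    by (simp add: erlang_CDF_0 not_less)
qed

text \<open>A clock that runs in the marked epochs passes level \<open>a\<close> as a Poisson process does.\<close>

lemma emeasure_clock_crossing:
  assumes "m (length w)"
  shows "emeasure Q {s. jumps (length w) s = w \<and> clock m (length w) s \<le> a \<and> a < clock m (Suc (length w)) s}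
    = prod_list (map (\<lambda>j. ennreal (pmf P j)) w) * ennreal (poisson_weight (card {i. i < length w \<and> m i}) (lam * a))"
  using assms
proof (induction w arbitrary: m a)
  case Nil
  have [measurable]: "{s. 0 \<le> a \<and> a < arrival (Suc 0) s} \<in> sets jump_stream"
    unfolding sets_jump_stream_law[of lam P, symmetric] by (rule sets_jump_stream_law_Collect) measurable
  have "emeasure Q {s. 0 \<le> a \<and> a < arrival (Suc 0) s} = (\<integral>\<^sup>+s. indicator {s. 0 \<le> a \<and> a < arrival (Suc 0) s} s \<partial>Q)"
    by (subst nn_integral_indicator) (simp_all add: sets_jump_stream_law)
  also have "\<dots> = (\<integral>\<^sup>+e. ennreal (exponential_density lam e) *
    (\<integral>\<^sup>+j. \<integral>\<^sup>+s. of_bool (0 \<le> a \<and> a < e) \<partial>Q \<partial>measure_pmf P) \<partial>lborel)"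
    by (subst nn_integral_jump_stream) (simp_all add: indicator_def clock_Suc_Stream)
  also have "\<dots> = of_bool (0 \<le> a) * (\<integral>\<^sup>+e. ennreal (exponential_density lam e) * indicator {a<..} e \<partial>lborel)"
    using Q.emeasure_space_1 by (cases "0 \<le> a") (simp_all add: indicator_def)
  also have "\<dots> = ennreal (poisson_weight 0 (lam * a))"
    unfolding nn_integral_exponential_gt using lam_pos
    by (auto simp: poisson_weight_def mult_less_0_iff)
  finally show ?case
    using Nil by (simp add: clock_Suc)
next
  case (Cons j w)
  let ?m = "\<lambda>i. m (Suc i)"
  let ?wt = "prod_list (map (\<lambda>j. ennreal (pmf P j)) w)"
  let ?S = "\<lambda>a. {s. jumps (length w) s = w \<and> clock ?m (length w) s \<le> a \<and> a < clock ?m (Suc (length w)) s}"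
  let ?c = "card {i. i < length w \<and> ?m i}"
  have IH: "emeasure Q (?S a) = ?wt * ennreal (poisson_weight ?c (lam * a))" for a
    using Cons by simp
  have card: "card {i. i < length (j # w) \<and> m i} = of_bool (m 0) + ?c"
  proof -
    have "{i. i < length (j # w) \<and> m i} = (if m 0 then {0} else {}) \<union> Suc ` {i. i < length w \<and> ?m i}"
      by (auto simp: less_Suc_eq_0_disj)
    then show ?thesis
      by (auto simp: card_image card_insert_if)
  qed
  let ?T = "{s. jumps (length (j # w)) s = j # w \<and> clock m (length (j # w)) s \<le> a \<and> a < clock m (Suc (length (j # w))) s}"
  \<comment> \<open>After the first pair is removed the marks shift by one, and the level drops by
    the first holding time exactly when epoch 0 is marked.\<close>
  have ind: "indicator ?T ((e, j') ## s) = (of_bool (j' = j) * indicator (?S (a - (if m 0 then e else 0))) s :: ennreal)" for e j' s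
    by (auto simp: indicator_def clock_Suc_Stream[of m] algebra_simps)
  have [measurable]: "?S b \<in> sets jump_stream" for b
    unfolding sets_jump_stream_law[of lam P, symmetric] by (rule sets_jump_stream_law_Collect) measurable
  have [measurable]: "?T \<in> sets jump_stream"
    unfolding sets_jump_stream_law[of lam P, symmetric] by (rule sets_jump_stream_law_Collect) measurable
  have "emeasure Q ?T = (\<integral>\<^sup>+s. indicator ?T s \<partial>Q)"
    by (subst nn_integral_indicator) (simp_all only: sets_jump_stream_law, measurable)
  also have "\<dots> = (\<integral>\<^sup>+e. ennreal (exponential_density lam e) *
    (\<integral>\<^sup>+j'. \<integral>\<^sup>+s. of_bool (j' = j) * indicator (?S (a - (if m 0 then e else 0))) s \<partial>Q \<partial>measure_pmf P) \<partial>lborel)"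
    by (subst nn_integral_jump_stream) (simp_all only: ind, measurable)
  also have "\<dots> = (\<integral>\<^sup>+e. ennreal (exponential_density lam e) *
    (ennreal (pmf P j) * emeasure Q (?S (a - (if m 0 then e else 0)))) \<partial>lborel)"
  proof (intro nn_integral_cong arg_cong2[where f="(*)"] refl)
    fix e
    let ?E = "emeasure Q (?S (a - (if m 0 then e else 0)))"
    have D: "(\<integral>\<^sup>+j'. \<integral>\<^sup>+s. of_bool (j' = j) * indicator D s \<partial>Q \<partial>measure_pmf P) = ennreal (pmf P j) * emeasure Q D"
      if [measurable]: "D \<in> sets jump_stream" for D
    proof -
      have "(\<integral>\<^sup>+j'. \<integral>\<^sup>+s. of_bool (j' = j) * indicator D s \<partial>Q \<partial>measure_pmf P)
          = (\<integral>\<^sup>+j'. emeasure Q D * indicator {j} j' \<partial>measure_pmf P)"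
      proof (intro nn_integral_cong)
        fix j' :: int
        show "(\<integral>\<^sup>+s. of_bool (j' = j) * indicator D s \<partial>Q) = emeasure Q D * indicator {j} j'"
          by (cases "j' = j") (simp_all add: sets_jump_stream_law)
      qed
      also have "\<dots> = emeasure Q D * emeasure (measure_pmf P) {j}"
        by (rule nn_integral_cmult_indicator) simp
      finally show ?thesis
        by (simp add: emeasure_pmf_single mult.commute)
    qed
    show "(\<integral>\<^sup>+j'. \<integral>\<^sup>+s. of_bool (j' = j) * indicator (?S (a - (if m 0 then e else 0))) s \<partial>Q \<partial>measure_pmf P)
        = ennreal (pmf P j) * ?E"
      by (rule D) measurable
  qed
  also have "\<dots> = (\<integral>\<^sup>+e. (ennreal (pmf P j) * ?wt) * (ennreal (exponential_density lam e) *
     ennreal (poisson_weight ?c (lam * (a - (if m 0 then e else 0))))) \<partial>lborel)"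
    by (intro nn_integral_cong) (simp only: IH ac_simps)
  also have "\<dots> = (ennreal (pmf P j) * ?wt) * (\<integral>\<^sup>+e. ennreal (exponential_density lam e) *
     ennreal (poisson_weight ?c (lam * (a - (if m 0 then e else 0)))) \<partial>lborel)"
    by (rule nn_integral_cmult) (simp add: poisson_weight_def)
  also have "(\<integral>\<^sup>+e. ennreal (exponential_density lam e) *
     ennreal (poisson_weight ?c (lam * (a - (if m 0 then e else 0)))) \<partial>lborel)
    = ennreal (poisson_weight (of_bool (m 0) + ?c) (lam * a))"
  proof (cases "m 0")
    case True
    then show ?thesis
      using nn_integral_exponential_poisson_weight[OF lam_pos, of ?c a] by simp
  next
    \<comment> \<open>An unmarked first epoch leaves the level alone, so its holding time integrates
      to total mass 1.\<close>
    case False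
    interpret E: prob_space "density lborel (exponential_density lam)"
      by (rule prob_space_exponential_density[OF lam_pos])
    have "(\<integral>\<^sup>+e. ennreal (exponential_density lam e) \<partial>lborel) = 1"
      using E.emeasure_space_1 by (simp add: emeasure_density)
    then show ?thesis
      using False by (simp add: nn_integral_multc)
  qed
  finally show ?case
    unfolding card by simp
qed

text \<open>The lack of memory of the exponential law makes the shifted stream a fresh copy.\<close>

lemma nn_integral_shift_stream:
  fixes f :: "int list \<Rightarrow> ennreal"
  assumes F[measurable]: "F \<in> borel_measurable jump_stream"
  shows "(\<integral>\<^sup>+s. of_bool (in_epoch n t s) * f (jumps n s) * F (shift_stream n t s) \<partial>Q)
    = (\<integral>\<^sup>+s. of_bool (in_epoch n t s) * f (jumps n s) \<partial>Q) * (\<integral>\<^sup>+s. F s \<partial>Q)"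
proof (induction n arbitrary: t f)
  case 0
  define H where "H e = (\<integral>\<^sup>+j. \<integral>\<^sup>+s. F ((e, j) ## s) \<partial>Q \<partial>measure_pmf P)" for e
  have [measurable]: "H \<in> borel_measurable borel"
    unfolding H_def by measurable
  have [measurable]: "(\<lambda>s. in_epoch 0 t s) \<in> jump_stream \<rightarrow>\<^sub>M count_space UNIV"
    by measurable
  have lhs: "(\<integral>\<^sup>+s. of_bool (in_epoch 0 t s) * f (jumps 0 s) * G (shift_stream 0 t s) \<partial>Q)
     = f [] * (\<integral>\<^sup>+e. ennreal (exponential_density lam e) *
         (of_bool (0 \<le> t \<and> t < e) * (\<integral>\<^sup>+j. \<integral>\<^sup>+s. G ((e - t, j) ## s) \<partial>Q \<partial>measure_pmf P)) \<partial>lborel)"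
    if [measurable]: "G \<in> borel_measurable jump_stream" for G
  proof -
    have "(\<integral>\<^sup>+s. of_bool (in_epoch 0 t s) * f (jumps 0 s) * G (shift_stream 0 t s) \<partial>Q)
      = (\<integral>\<^sup>+e. ennreal (exponential_density lam e) * (\<integral>\<^sup>+j. \<integral>\<^sup>+s. (of_bool (0 \<le> t \<and> t < e) * f [])
          * G ((e - t, j) ## s) \<partial>Q \<partial>measure_pmf P) \<partial>lborel)"
      by (subst nn_integral_jump_stream) (simp_all add: in_epoch_0_Stream shift_stream_0_Stream)
    also have "\<dots> = (\<integral>\<^sup>+e. f [] * (ennreal (exponential_density lam e) *
         (of_bool (0 \<le> t \<and> t < e) * (\<integral>\<^sup>+j. \<integral>\<^sup>+s. G ((e - t, j) ## s) \<partial>Q \<partial>measure_pmf P))) \<partial>lborel)"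
      by (intro nn_integral_cong) (simp add: nn_integral_cmult, simp add: ac_simps)
    also have "\<dots> = f [] * (\<integral>\<^sup>+e. ennreal (exponential_density lam e) *
         (of_bool (0 \<le> t \<and> t < e) * (\<integral>\<^sup>+j. \<integral>\<^sup>+s. G ((e - t, j) ## s) \<partial>Q \<partial>measure_pmf P)) \<partial>lborel)"
      by (rule nn_integral_cmult) measurable
    finally show ?thesis .
  qed
  have lhs1: "(\<integral>\<^sup>+s. of_bool (in_epoch 0 t s) * f (jumps 0 s) \<partial>Q)
     = f [] * (\<integral>\<^sup>+e. ennreal (exponential_density lam e) * of_bool (0 \<le> t \<and> t < e) \<partial>lborel)"
    using lhs[of "\<lambda>_. 1"] Q.emeasure_space_1 by simp
  show ?case
  proof (cases "0 \<le> t")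
    case False
    then show ?thesis by (simp add: in_epoch_def)
  next
    case True
    \<comment> \<open>Beyond \<open>t\<close> the exponential density is the original one times the
      probability of surviving \<open>t\<close>.\<close>
    have dens: "ennreal (exponential_density lam (t + u)) * of_bool (0 < u) = ennreal (exp (- (lam * t))) * (ennreal (exponential_density lam u) * of_bool (0 < u))" for u
      using True lam_pos
      by (auto simp: exponential_density_def ennreal_mult[symmetric] exp_add[symmetric] algebra_simps)
    have "(\<integral>\<^sup>+e. ennreal (exponential_density lam e) * (of_bool (0 \<le> t \<and> t < e) * H (e - t)) \<partial>lborel)
        = (\<integral>\<^sup>+u. ennreal (exponential_density lam (t + u)) * (of_bool (0 < u) * H u) \<partial>lborel)"
      by (subst nn_integral_real_affine[where c=1 and t=t]) (use True in simp_all)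
    also have "\<dots> = (\<integral>\<^sup>+u. ennreal (exp (- (lam * t))) * (ennreal (exponential_density lam u) * of_bool (0 < u) * H u) \<partial>lborel)"
      by (intro nn_integral_cong) (simp add: dens mult.assoc[symmetric])
    also have "\<dots> = ennreal (exp (- (lam * t))) * (\<integral>\<^sup>+u. ennreal (exponential_density lam u) * of_bool (0 < u) * H u \<partial>lborel)"
      by (rule nn_integral_cmult) measurable
    also have "(\<integral>\<^sup>+u. ennreal (exponential_density lam u) * of_bool (0 < u) * H u \<partial>lborel)
        = (\<integral>\<^sup>+u. ennreal (exponential_density lam u) * H u \<partial>lborel)"
      by (intro nn_integral_cong_AE, use AE_lborel_singleton[of "0::real"] in eventually_elim)
        (auto simp: exponential_density_def)
    also have "\<dots> = (\<integral>\<^sup>+s. F s \<partial>Q)"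
      unfolding H_def by (rule nn_integral_jump_stream[symmetric]) fact
    finally have 1: "(\<integral>\<^sup>+e. ennreal (exponential_density lam e) * (of_bool (0 \<le> t \<and> t < e) * H (e - t)) \<partial>lborel)
        = ennreal (exp (- (lam * t))) * (\<integral>\<^sup>+s. F s \<partial>Q)" .
    have 2: "(\<integral>\<^sup>+e. ennreal (exponential_density lam e) * of_bool (0 \<le> t \<and> t < e) \<partial>lborel) = ennreal (exp (- (lam * t)))"
      using nn_integral_exponential_gt[of t] True by (simp add: indicator_def)
    show ?thesis
      unfolding lhs[OF F] lhs1 using 1 2 by (simp add: H_def mult.assoc)
  qed
next
  case (Suc n)
  have [measurable]: "Measurable.pred jump_stream (in_epoch n t)" for n t
    by measurable
  have [measurable]: "shift_stream n t \<in> jump_stream \<rightarrow>\<^sub>M jump_stream" for n t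
    by measurable
  have "(\<integral>\<^sup>+s. of_bool (in_epoch (Suc n) t s) * f (jumps (Suc n) s) * F (shift_stream (Suc n) t s) \<partial>Q)
    = (\<integral>\<^sup>+e. ennreal (exponential_density lam e) * (\<integral>\<^sup>+j. \<integral>\<^sup>+s. of_bool (in_epoch n (t - e) s) * f (j # jumps n s)
        * F (shift_stream n (t - e) s) \<partial>Q \<partial>measure_pmf P) \<partial>lborel)"
    by (subst nn_integral_jump_stream) (simp_all add: in_epoch_Suc_Stream shift_stream_Suc_Stream)
  also have "\<dots> = (\<integral>\<^sup>+e. ennreal (exponential_density lam e) * (\<integral>\<^sup>+j. \<integral>\<^sup>+s. of_bool (in_epoch n (t - e) s) * f (j # jumps n s)
        \<partial>Q \<partial>measure_pmf P) * (\<integral>\<^sup>+s. F s \<partial>Q) \<partial>lborel)"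
  proof (intro nn_integral_cong)
    fix e
    have "(\<integral>\<^sup>+j. \<integral>\<^sup>+s. of_bool (in_epoch n (t - e) s) * f (j # jumps n s) * F (shift_stream n (t - e) s) \<partial>Q \<partial>measure_pmf P)
        = (\<integral>\<^sup>+j. (\<integral>\<^sup>+s. of_bool (in_epoch n (t - e) s) * f (j # jumps n s) \<partial>Q) * (\<integral>\<^sup>+s. F s \<partial>Q) \<partial>measure_pmf P)"
      by (intro nn_integral_cong Suc.IH[of "t - e" "\<lambda>w. f (_ # w)"])
    then show "ennreal (exponential_density lam e) * (\<integral>\<^sup>+j. \<integral>\<^sup>+s. of_bool (in_epoch n (t - e) s) * f (j # jumps n s)
        * F (shift_stream n (t - e) s) \<partial>Q \<partial>measure_pmf P)
      = ennreal (exponential_density lam e) * (\<integral>\<^sup>+j. \<integral>\<^sup>+s. of_bool (in_epoch n (t - e) s) * f (j # jumps n s)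
        \<partial>Q \<partial>measure_pmf P) * (\<integral>\<^sup>+s. F s \<partial>Q)"
      by (simp add: nn_integral_multc mult.assoc)
  qed
  also have "\<dots> = (\<integral>\<^sup>+e. ennreal (exponential_density lam e) * (\<integral>\<^sup>+j. \<integral>\<^sup>+s. of_bool (in_epoch n (t - e) s) * f (j # jumps n s)
        \<partial>Q \<partial>measure_pmf P) \<partial>lborel) * (\<integral>\<^sup>+s. F s \<partial>Q)"
    by (rule nn_integral_multc) measurable
  also have "(\<integral>\<^sup>+e. ennreal (exponential_density lam e) * (\<integral>\<^sup>+j. \<integral>\<^sup>+s. of_bool (in_epoch n (t - e) s) * f (j # jumps n s)
        \<partial>Q \<partial>measure_pmf P) \<partial>lborel) = (\<integral>\<^sup>+s. of_bool (in_epoch (Suc n) t s) * f (jumps (Suc n) s) \<partial>Q)"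
    by (subst nn_integral_jump_stream) (simp_all add: in_epoch_Suc_Stream)
  finally show ?case .
qed

end

section \<open>The compound Poisson walk\<close>

text \<open>Positivity of the holding times and non-explosion together make the epochs non-empty
  intervals that partition the times \<open>t \<ge> 0\<close>.\<close>

definition good_stream :: "(real \<times> int) stream \<Rightarrow> bool" where
  "good_stream s \<longleftrightarrow> (\<forall>n. 0 < fst (s !! n)) \<and> (\<forall>t. \<exists>n. t < arrival n s)"

definition epoch :: "real \<Rightarrow> (real \<times> int) stream \<Rightarrow> nat" where
  "epoch t s = (LEAST n. t < arrival (Suc n) s)"

definition walk :: "real \<Rightarrow> (real \<times> int) stream \<Rightarrow> int" where
  "walk t s = sum_list (jumps (epoch t s) s)"

definition shifted :: "real \<Rightarrow> (real \<times> int) stream \<Rightarrow> (real \<times> int) stream" where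
  "shifted t s = shift_stream (epoch t s) t s"

lemma arrival_strict_mono: "\<forall>n. 0 < fst (s !! n) \<Longrightarrow> strict_mono (\<lambda>n. arrival n s)"
  by (rule strict_monoI_Suc) (simp add: clock_Suc)

lemma in_epoch_unique:
  assumes "\<forall>n. 0 < fst (s !! n)" "in_epoch n t s" "in_epoch k t s"
  shows "n = k"
proof (rule ccontr)
  have mono: "mono (\<lambda>n. arrival n s)"
    using arrival_strict_mono[OF assms(1)] by (rule strict_mono_mono)
  assume "n \<noteq> k"
  then consider "Suc n \<le> k" | "Suc k \<le> n" by linarith
  then show False
    by cases (use assms(2,3) monoD[OF mono, of "Suc n" k] monoD[OF mono, of "Suc k" n] in \<open>auto simp: in_epoch_def\<close>)
qed

lemma in_epoch_epoch:
  assumes s: "good_stream s" and t: "0 \<le> t"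
  shows "in_epoch (epoch t s) t s"
proof -
  obtain n where "t < arrival n s" using s by (auto simp: good_stream_def)
  moreover have "arrival n s \<le> arrival (Suc n) s"
    using s by (simp add: clock_Suc good_stream_def less_imp_le)
  ultimately have "t < arrival (Suc n) s" by linarith
  then have "t < arrival (Suc (epoch t s)) s"
    unfolding epoch_def by (rule LeastI)
  moreover have "arrival (epoch t s) s \<le> t"
  proof (cases "epoch t s")
    case (Suc k)
    then show ?thesis
      using not_less_Least[of k "\<lambda>n. t < arrival (Suc n) s"] by (simp add: epoch_def not_less)
  qed (use t in simp)
  ultimately show ?thesis by (simp add: in_epoch_def)
qed

lemma epoch_eqI:
  assumes "good_stream s" "in_epoch n t s" "0 \<le> t"
  shows "epoch t s = n"
  using in_epoch_unique[OF _ in_epoch_epoch[OF assms(1,3)] assms(2)] assms(1)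
  by (simp add: good_stream_def)

lemma in_epoch_0I: "good_stream s \<Longrightarrow> in_epoch 0 0 s"
  by (simp add: in_epoch_def clock_Suc good_stream_def del: snth.simps)

lemma walk_0: "good_stream s \<Longrightarrow> walk 0 s = 0"
  using epoch_eqI[OF _ in_epoch_0I] by (simp add: walk_def)

lemma snd_snth_shift_stream: "snd (shift_stream n t s !! i) = snd (s !! (n + i))"
  by (cases i) (simp_all add: shift_stream_def sdrop_snth)

lemma fst_snth_shift_stream: "fst (shift_stream n t s !! Suc k) = fst (s !! Suc (n + k))"
  by (simp add: shift_stream_def sdrop_snth)

lemma jumps_add: "jumps (n + k) s = jumps n s @ jumps k (shift_stream n t s)"
  by (auto simp: list_eq_iff_nth_eq nth_append jumps_def stake_nth snd_snth_shift_stream simp del: stake_add)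

lemma arrival_shift_stream: "arrival (Suc k) (shift_stream n t s) = arrival (Suc (n + k)) s - t"
proof (induction k)
  case (Suc k)
  then show ?case
    by (simp add: clock_Suc[of _ "Suc k"] clock_Suc[of _ "Suc (n + k)"] fst_snth_shift_stream del: snth.simps)
qed (simp add: clock_Suc shift_stream_def)

lemma good_stream_shift_stream:
  assumes "good_stream s" "in_epoch n t s"
  shows "good_stream (shift_stream n t s)"
  unfolding good_stream_def
proof (intro conjI allI)
  fix i
  show "0 < fst (shift_stream n t s !! i)"
  proof (cases i)
    case 0
    then show ?thesis using assms by (simp add: shift_stream_def in_epoch_def)
  next
    case (Suc k)
    then show ?thesis
      using assms(1) unfolding good_stream_def by (simp add: fst_snth_shift_stream del: snth.simps)
  qed
next
  fix u
  have mono: "mono (\<lambda>n. arrival n s)"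
    using arrival_strict_mono[of s] assms(1) strict_mono_mono by (auto simp: good_stream_def)
  obtain k where "t + u < arrival k s" using assms(1) by (auto simp: good_stream_def)
  also have "\<dots> \<le> arrival (Suc (n + k)) s" by (rule monoD[OF mono]) simp
  finally have "u < arrival (Suc k) (shift_stream n t s)"
    by (simp add: arrival_shift_stream)
  then show "\<exists>k. u < arrival k (shift_stream n t s)" ..
qed

lemma good_stream_shifted: "good_stream s \<Longrightarrow> 0 \<le> t \<Longrightarrow> good_stream (shifted t s)"
  unfolding shifted_def by (intro good_stream_shift_stream in_epoch_epoch)

text \<open>The epoch containing \<open>t + u\<close> is found by counting epochs of the shifted
  stream, whose epoch 0 is what remains of the one interrupted at \<open>t\<close>.\<close>

lemma walk_shifted:
  assumes s: "good_stream s" and "0 \<le> t" "0 \<le> u"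
  shows "walk (t + u) s = walk t s + walk u (shifted t s)"
proof -
  define n k where "n = epoch t s" and "k = epoch u (shifted t s)"
  have n: "in_epoch n t s"
    unfolding n_def using assms by (intro in_epoch_epoch)
  have k: "in_epoch k u (shift_stream n t s)"
    unfolding k_def using in_epoch_epoch[OF good_stream_shifted[OF s \<open>0 \<le> t\<close>] \<open>0 \<le> u\<close>]
    by (simp add: shifted_def n_def)
  have "in_epoch (n + k) (t + u) s"
    using n k \<open>0 \<le> u\<close> by (cases k) (auto simp: in_epoch_def arrival_shift_stream)
  then have "epoch (t + u) s = n + k"
    using assms by (intro epoch_eqI) auto
  then show ?thesis
    using jumps_add[of n k s t] by (simp add: walk_def shifted_def n_def k_def)
qed

lemma measurable_epoch [measurable]: "epoch t \<in> jump_stream \<rightarrow>\<^sub>M count_space UNIV"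
  unfolding epoch_def by measurable

lemma measurable_walk [measurable]: "walk t \<in> jump_stream \<rightarrow>\<^sub>M count_space UNIV"
  unfolding walk_def
  by (rule measurable_compose_countable[where g="epoch t"]) measurable

lemma measurable_shifted [measurable]: "shifted t \<in> jump_stream \<rightarrow>\<^sub>M jump_stream"
  unfolding shifted_def
  by (rule measurable_compose_countable[where g="epoch t"]) measurable

lemma pmf_replicate_pmf:
  "ennreal (pmf (replicate_pmf n p) w) = of_bool (length w = n) * prod_list (map (\<lambda>j. ennreal (pmf p j)) w)"
proof (induction n arbitrary: w)
  case 0
  then show ?case by (cases w) (auto simp: pmf_return)
next
  case (Suc n)
  show ?case
  proof (cases w)
    case Nil
    then have "w \<notin> set_pmf (replicate_pmf (Suc n) p)"
      by (auto simp: set_replicate_pmf simp del: replicate_pmf.simps)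
    then show ?thesis using Nil by (simp add: set_pmf_iff del: replicate_pmf.simps)
  next
    case (Cons j v)
    have "ennreal (pmf (replicate_pmf (Suc n) p) w)
        = (\<integral>\<^sup>+x. \<integral>\<^sup>+xs. indicator {j} x * indicator {v} xs \<partial>replicate_pmf n p \<partial>measure_pmf p)"
      by (simp add: ennreal_pmf_bind Cons indicator_def pmf_return of_bool_def ennreal_mult[symmetric] if_distrib cong: if_cong)
        (auto intro!: nn_integral_cong)
    also have "\<dots> = ennreal (pmf (replicate_pmf n p) v) * ennreal (pmf p j)"
      by (simp add: nn_integral_cmult nn_integral_multc emeasure_pmf_single mult.commute)
    finally show ?thesis
      using Suc.IH[of v] Cons by (simp add: mult.commute mult.left_commute)
  qed
qed

section \<open>The Markov property and the law of the walk at fixed times\<close>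

context jump_chain
begin

lemma pred_in_epoch' [measurable]: "Measurable.pred jump_stream (in_epoch n t)"
  by measurable

lemma measurable_shift_stream' [measurable]: "shift_stream n t \<in> jump_stream \<rightarrow>\<^sub>M jump_stream"
  by measurable

text \<open>Split by the word of jumps: for a fixed word, the clock that always runs gives the
  Poisson weight, and the words of length \<open>n\<close> carry the law of \<open>n\<close>
  independent jumps.\<close>

lemma nn_integral_in_epoch:
  fixes f :: "int list \<Rightarrow> ennreal"
  shows "(\<integral>\<^sup>+s. of_bool (in_epoch n t s) * f (jumps n s) \<partial>Q)
    = ennreal (poisson_weight n (lam * t)) * (\<integral>\<^sup>+w. f w \<partial>replicate_pmf n P)"
proof -
  have "(\<integral>\<^sup>+s. of_bool (in_epoch n t s) * f (jumps n s) \<partial>Q)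
      = (\<integral>\<^sup>+s. \<integral>\<^sup>+w. f w * indicator {s. jumps n s = w \<and> in_epoch n t s} s \<partial>count_space UNIV \<partial>Q)"
  proof (intro nn_integral_cong)
    fix s
    have "(\<integral>\<^sup>+w. f w * indicator {s. jumps n s = w \<and> in_epoch n t s} s \<partial>count_space UNIV)
       = (\<integral>\<^sup>+w. (of_bool (in_epoch n t s) * f w) * indicator {jumps n s} w \<partial>count_space UNIV)"
      by (intro nn_integral_cong) (auto simp: indicator_def)
    then show "of_bool (in_epoch n t s) * f (jumps n s)
      = (\<integral>\<^sup>+w. f w * indicator {s. jumps n s = w \<and> in_epoch n t s} s \<partial>count_space UNIV)"
      by simp
  qed
  also have "\<dots> = (\<integral>\<^sup>+w. \<integral>\<^sup>+s. f w * indicator {s. jumps n s = w \<and> in_epoch n t s} s \<partial>Q \<partial>count_space UNIV)"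
    by (rule nn_integral_count_space_nn_integral) measurable
  also have "\<dots> = (\<integral>\<^sup>+w. ennreal (poisson_weight n (lam * t)) * (ennreal (pmf (replicate_pmf n P) w) * f w) \<partial>count_space UNIV)"
  proof (intro nn_integral_cong)
    fix w
    have sets: "{s. jumps n s = w \<and> in_epoch n t s} \<in> sets Q"
      by (rule sets_jump_stream_law_Collect) measurable
    have "emeasure Q {s. jumps n s = w \<and> in_epoch n t s}
        = ennreal (pmf (replicate_pmf n P) w) * ennreal (poisson_weight n (lam * t))"
    proof (cases "length w = n")
      case True
      then show ?thesis
        using emeasure_clock_crossing[of "\<lambda>_. True" w t] by (simp add: pmf_replicate_pmf in_epoch_def)
    next
      case False
      then have empty: "{s. jumps n s = w \<and> in_epoch n t s} = {}" by auto
      show ?thesis unfolding empty using False by (simp add: pmf_replicate_pmf)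
    qed
    then show "(\<integral>\<^sup>+s. f w * indicator {s. jumps n s = w \<and> in_epoch n t s} s \<partial>Q)
        = ennreal (poisson_weight n (lam * t)) * (ennreal (pmf (replicate_pmf n P) w) * f w)"
      by (subst nn_integral_cmult_indicator[OF sets]) (simp add: ac_simps)
  qed
  also have "\<dots> = ennreal (poisson_weight n (lam * t)) * (\<integral>\<^sup>+w. f w \<partial>replicate_pmf n P)"
    by (simp add: nn_integral_cmult nn_integral_measure_pmf)
  finally show ?thesis .
qed

lemma suminf_poisson_weight:
  assumes "0 \<le> x"
  shows "(\<Sum>n. ennreal (poisson_weight n x)) = 1"
proof -
  have "(\<lambda>n. exp (- x) * (x ^ n /\<^sub>R fact n)) sums (exp (- x) * exp x)"
    by (intro sums_mult exp_converges)
  then have "(\<lambda>n. poisson_weight n x) sums 1"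
    using assms by (simp add: poisson_weight_def exp_minus divide_inverse_commute mult.left_commute ac_simps)
  moreover have "0 \<le> poisson_weight n x" for n
    using assms by (simp add: poisson_weight_def)
  ultimately show ?thesis
    by (simp add: suminf_ennreal_eq sums_iff)
qed

text \<open>For each integer time \<open>k\<close>, the events that epoch \<open>n\<close> contains
  \<open>k\<close> are disjoint up to null sets and have the Poisson weights as probabilities. These
  sum to 1, so almost surely there is no explosion.\<close>

lemma AE_good_stream: "AE s in Q. good_stream s"
proof -
  interpret H: prob_space "holding_jump_law lam P" by (rule prob_space_holding_jump_law)
  interpret E: prob_space "density lborel (exponential_density lam)"
    by (rule prob_space_exponential_density[OF lam_pos])
  interpret EP: pair_prob_space "density lborel (exponential_density lam)" "measure_pmf P" ..
  have "AE e in density lborel (exponential_density lam). 0 < e"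
    by (subst AE_density) (use AE_lborel_singleton[of "0::real"] in \<open>auto simp: exponential_density_def elim!: eventually_mono\<close>)
  then have "AE x in holding_jump_law lam P. 0 < fst x"
    unfolding holding_jump_law_def by (intro EP.AE_pair_measure) auto
  then have "AE s in Q. stream_all (\<lambda>x. 0 < fst x) s"
    unfolding jump_stream_law_def by (intro H.AE_stream_all) measurable
  then have pos: "AE s in Q. \<forall>n. 0 < fst (s !! n)"
    by eventually_elim (simp add: sset_range)
  have "AE s in Q. \<exists>n. in_epoch n (real k) s" for k
  proof -
    define A where "A n = {s. in_epoch n (real k) s \<and> (\<forall>n. 0 < fst (s !! n))}" for n
    have A[measurable]: "A n \<in> sets Q" for n
      unfolding A_def by (rule sets_jump_stream_law_Collect) measurable
    have "disjoint_family A"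
      using in_epoch_unique by (fastforce simp: disjoint_family_on_def A_def)
    then have "emeasure Q (\<Union>n. A n) = (\<Sum>n. emeasure Q (A n))"
      by (intro suminf_emeasure[symmetric]) auto
    also have "\<dots> = (\<Sum>n. ennreal (poisson_weight n (lam * real k)))"
    proof (intro suminf_cong)
      fix n
      have "emeasure Q (A n) = (\<integral>\<^sup>+s. indicator (A n) s \<partial>Q)"
        by simp
      also have "\<dots> = (\<integral>\<^sup>+s. of_bool (in_epoch n (real k) s) * 1 \<partial>Q)"
        by (intro nn_integral_cong_AE, use pos in eventually_elim) (simp add: A_def indicator_def)
      also have "\<dots> = ennreal (poisson_weight n (lam * real k))"
        using nn_integral_in_epoch[of n "real k" "\<lambda>_. 1"] measure_pmf.emeasure_space_1 by simp
      finally show "emeasure Q (A n) = ennreal (poisson_weight n (lam * real k))" .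
    qed
    also have "\<dots> = 1"
      using lam_pos by (intro suminf_poisson_weight) simp
    finally have "Q.prob (\<Union>n. A n) = 1"
      by (simp add: Q.emeasure_eq_measure)
    then have "AE s in Q. s \<in> (\<Union>n. A n)"
      by (rule Q.AE_prob_1)
    then show ?thesis by eventually_elim (auto simp: A_def)
  qed
  then have "AE s in Q. \<forall>k::nat. \<exists>n. in_epoch n (real k) s"
    by (simp add: AE_all_countable)
  with pos show ?thesis
  proof eventually_elim
    case (elim s)
    have "\<exists>n. t < arrival n s" for t
    proof -
      obtain k :: nat where "t \<le> real k" using real_arch_simple by blast
      moreover obtain n where "in_epoch n (real k) s" using elim by blast
      ultimately have "t < arrival (Suc n) s" by (simp add: in_epoch_def)
      then show ?thesis ..
    qed
    with elim show ?case by (simp add: good_stream_def)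
  qed
qed

lemma suminf_in_epoch:
  assumes "good_stream s" "0 \<le> t"
  shows "(\<Sum>n. of_bool (in_epoch n t s) * (f n :: ennreal)) = f (epoch t s)"
proof -
  have "(\<Sum>n. of_bool (in_epoch n t s) * f n) = (\<Sum>n\<in>{epoch t s}. of_bool (in_epoch n t s) * f n)"
    using epoch_eqI[OF assms(1) _ assms(2)] by (intro suminf_finite) auto
  then show ?thesis using in_epoch_epoch[OF assms] by simp
qed

lemma nn_integral_walk:
  assumes t: "0 \<le> t"
  shows "(\<integral>\<^sup>+s. f (walk t s) \<partial>Q)
    = (\<Sum>n. ennreal (poisson_weight n (lam * t)) * (\<integral>\<^sup>+w. f (sum_list w) \<partial>replicate_pmf n P))"
proof -
  have "(\<integral>\<^sup>+s. f (walk t s) \<partial>Q) = (\<integral>\<^sup>+s. (\<Sum>n. of_bool (in_epoch n t s) * f (sum_list (jumps n s))) \<partial>Q)"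
    by (intro nn_integral_cong_AE, use AE_good_stream in eventually_elim) (simp add: suminf_in_epoch t walk_def)
  also have "\<dots> = (\<Sum>n. \<integral>\<^sup>+s. of_bool (in_epoch n t s) * f (sum_list (jumps n s)) \<partial>Q)"
    by (rule nn_integral_suminf) measurable
  finally show ?thesis
    by (simp add: nn_integral_in_epoch[where f="\<lambda>w. f (sum_list w)"])
qed

text \<open>Markov property at a fixed time: splitting by the current epoch makes its number
  deterministic, and the lack of memory applies to each term.\<close>

lemma nn_integral_walk_shifted:
  assumes t: "0 \<le> t" and [measurable]: "F \<in> borel_measurable jump_stream"
  shows "(\<integral>\<^sup>+s. f (walk t s) * F (shifted t s) \<partial>Q) = (\<integral>\<^sup>+s. f (walk t s) \<partial>Q) * (\<integral>\<^sup>+s. F s \<partial>Q)"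
proof -
  have eq: "(\<integral>\<^sup>+s. f (walk t s) * G (shifted t s) \<partial>Q)
      = (\<Sum>n. (\<integral>\<^sup>+s. of_bool (in_epoch n t s) * f (sum_list (jumps n s)) \<partial>Q) * (\<integral>\<^sup>+s. G s \<partial>Q))"
    if [measurable]: "G \<in> borel_measurable jump_stream" for G
  proof -
    have "(\<integral>\<^sup>+s. f (walk t s) * G (shifted t s) \<partial>Q)
      = (\<integral>\<^sup>+s. (\<Sum>n. of_bool (in_epoch n t s) * (f (sum_list (jumps n s)) * G (shift_stream n t s))) \<partial>Q)"
      by (intro nn_integral_cong_AE, use AE_good_stream in eventually_elim)
        (simp add: suminf_in_epoch t walk_def shifted_def)
    also have "\<dots> = (\<Sum>n. \<integral>\<^sup>+s. of_bool (in_epoch n t s) * f (sum_list (jumps n s)) * G (shift_stream n t s) \<partial>Q)"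
      by (subst nn_integral_suminf) (simp_all add: mult.assoc)
    also have "\<dots> = (\<Sum>n. (\<integral>\<^sup>+s. of_bool (in_epoch n t s) * f (sum_list (jumps n s)) \<partial>Q) * (\<integral>\<^sup>+s. G s \<partial>Q))"
      by (intro suminf_cong nn_integral_shift_stream[where f="\<lambda>w. f (sum_list w)"]) fact
    finally show ?thesis .
  qed
  from eq[of "\<lambda>_. 1"] Q.emeasure_space_1
  have "(\<integral>\<^sup>+s. f (walk t s) \<partial>Q) = (\<Sum>n. \<integral>\<^sup>+s. of_bool (in_epoch n t s) * f (sum_list (jumps n s)) \<partial>Q)"
    by simp
  then show ?thesis
    by (simp add: eq[OF assms(2)])
qed

lemma nn_integral_increments_shift:
  assumes "0 \<le> c" "\<And>i. i \<le> n \<Longrightarrow> c \<le> t i"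
  shows "(\<integral>\<^sup>+s. (\<Prod>i<n. g i (walk (t (Suc i)) s - walk (t i) s)) \<partial>Q)
    = (\<integral>\<^sup>+s. (\<Prod>i<n. g i (walk (t (Suc i) - c) s - walk (t i - c) s) :: ennreal) \<partial>Q)"
proof -
  have "(\<integral>\<^sup>+s. (\<Prod>i<n. g i (walk (t (Suc i)) s - walk (t i) s)) \<partial>Q)
      = (\<integral>\<^sup>+s. 1 * (\<Prod>i<n. g i (walk (t (Suc i) - c) (shifted c s) - walk (t i - c) (shifted c s))) \<partial>Q)"
  proof (intro nn_integral_cong_AE, use AE_good_stream in eventually_elim)
    case (elim s)
    have "walk (t i) s = walk c s + walk (t i - c) (shifted c s)" if "i \<le> n" for i
      using walk_shifted[OF elim assms(1), of "t i - c"] assms(2)[OF that] by simp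
    then show ?case by (auto intro!: prod.cong)
  qed
  also have "\<dots> = (\<integral>\<^sup>+s. (\<Prod>i<n. g i (walk (t (Suc i) - c) s - walk (t i - c) s)) \<partial>Q)"
    using assms(1) Q.emeasure_space_1
    by (subst nn_integral_walk_shifted[where f="\<lambda>_. 1"]) auto
  finally show ?thesis .
qed

text \<open>Time is moved so that it starts at 0; the first increment is split off by the Markov
  property at \<open>t 1 - t 0\<close>, and the others are increments of the shifted walk.\<close>

lemma nn_integral_increments:
  fixes t :: "nat \<Rightarrow> real"
  assumes "0 \<le> t 0" "\<forall>i<n. t i \<le> t (Suc i)"
  shows "(\<integral>\<^sup>+s. (\<Prod>i<n. g i (walk (t (Suc i)) s - walk (t i) s)) \<partial>Q)
    = (\<Prod>i<n. \<integral>\<^sup>+s. (g i (walk (t (Suc i) - t i) s) :: ennreal) \<partial>Q)"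
  using assms
proof (induction n arbitrary: t g)
  case 0
  then show ?case using Q.emeasure_space_1 by simp
next
  case (Suc n)
  have mono: "t i \<le> t j" if "i \<le> j" "j \<le> Suc n" for i j
    using that by (induction j) (use Suc.prems(2) in \<open>auto simp: le_Suc_eq intro: order_trans\<close>)
  let ?g = "\<lambda>i. g (Suc i)" and ?u = "\<lambda>i. t (Suc i) - t 0"
  have "(\<integral>\<^sup>+s. (\<Prod>i<Suc n. g i (walk (t (Suc i)) s - walk (t i) s)) \<partial>Q)
      = (\<integral>\<^sup>+s. (\<Prod>i<Suc n. g i (walk (t (Suc i) - t 0) s - walk (t i - t 0) s)) \<partial>Q)"
    by (rule nn_integral_increments_shift) (use Suc.prems mono in auto)
  also have "\<dots> = (\<integral>\<^sup>+s. g 0 (walk (t 1 - t 0) s) *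
      (\<Prod>i<n. ?g i (walk (t (Suc (Suc i)) - t 1) (shifted (t 1 - t 0) s) - walk (t (Suc i) - t 1) (shifted (t 1 - t 0) s))) \<partial>Q)"
  proof (intro nn_integral_cong_AE, use AE_good_stream in eventually_elim)
    case (elim s)
    have eq: "walk (t i - t 0) s = walk (t 1 - t 0) s + walk (t i - t 1) (shifted (t 1 - t 0) s)"
      if "1 \<le> i" "i \<le> Suc n" for i
      using walk_shifted[OF elim, of "t 1 - t 0" "t i - t 1"] mono[of 0 1] mono[of 1 i] that by simp
    have "(\<Prod>i<n. ?g i (walk (t (Suc (Suc i)) - t 0) s - walk (t (Suc i) - t 0) s))
      = (\<Prod>i<n. ?g i (walk (t (Suc (Suc i)) - t 1) (shifted (t 1 - t 0) s) - walk (t (Suc i) - t 1) (shifted (t 1 - t 0) s)))"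
    proof (intro prod.cong refl)
      fix i assume "i \<in> {..<n}"
      then show "?g i (walk (t (Suc (Suc i)) - t 0) s - walk (t (Suc i) - t 0) s)
        = ?g i (walk (t (Suc (Suc i)) - t 1) (shifted (t 1 - t 0) s) - walk (t (Suc i) - t 1) (shifted (t 1 - t 0) s))"
        using eq[of "Suc i"] eq[of "Suc (Suc i)"] by simp
    qed
    then show ?case
      unfolding prod.lessThan_Suc_shift by (simp add: walk_0[OF elim])
  qed
  also have "\<dots> = (\<integral>\<^sup>+s. g 0 (walk (t 1 - t 0) s) \<partial>Q) *
      (\<integral>\<^sup>+s. (\<Prod>i<n. ?g i (walk (t (Suc (Suc i)) - t 1) s - walk (t (Suc i) - t 1) s)) \<partial>Q)"
    by (rule nn_integral_walk_shifted) (use mono[of 0 1] in auto)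
  also have "(\<integral>\<^sup>+s. (\<Prod>i<n. ?g i (walk (t (Suc (Suc i)) - t 1) s - walk (t (Suc i) - t 1) s)) \<partial>Q)
      = (\<Prod>i<n. \<integral>\<^sup>+s. ?g i (walk ((t (Suc (Suc i)) - t 1) - (t (Suc i) - t 1)) s) \<partial>Q)"
    by (rule Suc.IH[of "\<lambda>i. t (Suc i) - t 1"]) (use Suc.prems in auto)
  finally show ?case
    unfolding prod.lessThan_Suc_shift by simp
qed

end

section \<open>The compound Poisson chain\<close>

text \<open>The value 0 on exceptional streams makes every path cadlag, not just almost every one,
  as \<open>levy_process\<close> demands; it also keeps all values in the lattice.\<close>

definition chain :: "real \<Rightarrow> real \<Rightarrow> (real \<times> int) stream \<Rightarrow> real" where
  "chain h t s = (if good_stream s then h * of_int (walk t s) else 0)"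

definition jump_measure :: "real \<Rightarrow> real \<Rightarrow> int pmf \<Rightarrow> real measure" where
  "jump_measure h lam P = density (distr (measure_pmf P) borel (\<lambda>j. h * of_int j)) (\<lambda>_. ennreal lam)"

lemma sets_jump_measure [simp, measurable_cong]: "sets (jump_measure h lam P) = sets borel"
  by (simp add: jump_measure_def)

lemma emeasure_jump_measure:
  assumes "A \<in> sets borel"
  shows "emeasure (jump_measure h lam P) A = ennreal lam * emeasure (measure_pmf P) {j. h * of_int j \<in> A}"
  using assms by (simp add: jump_measure_def emeasure_density_const emeasure_distr vimage_def)

lemma integral_jump_measure:
  fixes f :: "real \<Rightarrow> 'b::{banach, second_countable_topology}"
  assumes [measurable]: "f \<in> borel_measurable borel" and "0 \<le> lam"
  shows "(LINT x|jump_measure h lam P. f x) = lam *\<^sub>R (\<integral>j. f (h * of_int j) \<partial>measure_pmf P)"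
  using assms(2) by (simp add: jump_measure_def integral_density integral_distr)

text \<open>Boundedness gives integrability throughout, and real and imaginary parts reduce the
  claim to real integrands.\<close>

lemma integral_bind_pmf_bounded:
  fixes f :: "'b \<Rightarrow> complex"
  assumes B: "\<And>x. norm (f x) \<le> B"
  shows "(\<integral>x. f x \<partial>bind_pmf p N) = (\<integral>x. \<integral>y. f y \<partial>N x \<partial>measure_pmf p)"
proof -
  have real: "(\<integral>x. g x \<partial>bind_pmf p N) = (\<integral>x. \<integral>y. g y \<partial>N x \<partial>measure_pmf p)"
    if "\<And>x. \<bar>g x\<bar> \<le> B" for g :: "'b \<Rightarrow> real"
    unfolding measure_pmf_bind
    by (rule integral_bind[where K="count_space UNIV" and B=B and B'=1])
      (use that measurable_measure_pmf[of N] in \<open>auto simp: measure_pmf.finite_measure_axioms measure_pmf.emeasure_space_1[simplified]\<close>)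
  have int: "integrable (measure_pmf p) f" for p
    by (rule measure_pmf.integrable_const_bound[where B=B]) (use B in auto)
  have "norm (\<integral>y. f y \<partial>measure_pmf p) \<le> B" for p
    by (rule measure_pmf.integral_le_const[THEN order_trans[OF integral_norm_bound]]) (use B int in auto)
  then have int2: "integrable (measure_pmf p) (\<lambda>x. \<integral>y. f y \<partial>N x)"
    by (intro measure_pmf.integrable_const_bound[where B=B]) auto
  show ?thesis
  proof (rule complex_eqI)
    show "Re (\<integral>x. f x \<partial>bind_pmf p N) = Re (\<integral>x. \<integral>y. f y \<partial>N x \<partial>measure_pmf p)"
    proof -
      have "\<bar>Re (f x)\<bar> \<le> B" for x
        using abs_Re_le_cmod B by (rule order_trans)
      from real[of "\<lambda>x. Re (f x)", OF this] show ?thesis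
        by (simp only: integral_Re[OF int] integral_Re[OF int2])
    qed
    show "Im (\<integral>x. f x \<partial>bind_pmf p N) = Im (\<integral>x. \<integral>y. f y \<partial>N x \<partial>measure_pmf p)"
    proof -
      have "\<bar>Im (f x)\<bar> \<le> B" for x
        using abs_Im_le_cmod B by (rule order_trans)
      from real[of "\<lambda>x. Im (f x)", OF this] show ?thesis
        by (simp only: integral_Im[OF int] integral_Im[OF int2])
    qed
  qed
qed

lemma integral_iexp_replicate_pmf:
  "(\<integral>w. iexp (u * of_int (sum_list w)) \<partial>replicate_pmf n P) = (\<integral>j. iexp (u * of_int j) \<partial>measure_pmf P) ^ n"
proof (induction n)
  case (Suc n)
  have "(\<integral>w. iexp (u * of_int (sum_list w)) \<partial>replicate_pmf (Suc n) P)
    = (\<integral>j. (\<integral>w. iexp (u * of_int j) * iexp (u * of_int (sum_list w)) \<partial>replicate_pmf n P) \<partial>measure_pmf P)"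
    by (simp add: integral_bind_pmf_bounded[where B=1] exp_add[symmetric] algebra_simps)
  also have "\<dots> = (\<integral>j. iexp (u * of_int j) \<partial>measure_pmf P) * (\<integral>w. iexp (u * of_int (sum_list w)) \<partial>replicate_pmf n P)"
    by simp
  finally show ?case
    by (simp only: Suc power_Suc)
qed simp

text \<open>Independence asks for all finite subfamilies; indices outside \<open>J\<close> are given
  the whole space as their set, so the product formula for the full family suffices.\<close>

lemma (in prob_space) indep_vars_lessThanI:
  fixes n :: nat
  assumes rv: "\<And>i. i < n \<Longrightarrow> random_variable N (X i)"
    and prod: "\<And>B. (\<And>i. i < n \<Longrightarrow> B i \<in> sets N) \<Longrightarrow>
      prob {x\<in>space M. \<forall>i<n. X i x \<in> B i} = (\<Prod>i<n. prob {x\<in>space M. X i x \<in> B i})"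
  shows "indep_vars (\<lambda>_. N) X {..<n}"
  unfolding indep_vars_def2
proof (intro conjI ballI indep_setsI)
  fix i assume "i \<in> {..<n}"
  then show "random_variable N (X i)" by (simp add: rv)
  then show "{X i -` A \<inter> space M |A. A \<in> sets N} \<subseteq> events" by auto
next
  fix A J
  assume J: "J \<noteq> {}" "J \<subseteq> {..<n}" "finite J" and "\<forall>j\<in>J. A j \<in> {X j -` A \<inter> space M |A. A \<in> sets N}"
  then have "\<forall>j\<in>J. \<exists>B. B \<in> sets N \<and> A j = X j -` B \<inter> space M" by auto
  from bchoice[OF this] obtain B
    where B: "\<And>j. j \<in> J \<Longrightarrow> B j \<in> sets N" "\<And>j. j \<in> J \<Longrightarrow> A j = X j -` B j \<inter> space M"
    by auto
  define B' where "B' i = (if i \<in> J then B i else space N)" for i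
  have sp: "X i x \<in> space N" if "i < n" "x \<in> space M" for i x
    using measurable_space[OF rv[OF that(1)] that(2)] .
  have "(\<Inter>j\<in>J. A j) = {x\<in>space M. \<forall>i<n. X i x \<in> B' i}"
  proof -
    have "(\<Inter>j\<in>J. A j) = {x\<in>space M. \<forall>i\<in>J. X i x \<in> B i}"
      using B(2) J(1) by auto
    also have "\<dots> = {x\<in>space M. \<forall>i<n. X i x \<in> B' i}"
      using J(2) sp by (auto simp: B'_def)
    finally show ?thesis .
  qed
  then have "prob (\<Inter>j\<in>J. A j) = (\<Prod>i<n. prob {x\<in>space M. X i x \<in> B' i})"
    using prod[of B'] B(1) by (auto simp: B'_def)
  also have "\<dots> = (\<Prod>j\<in>J. prob {x\<in>space M. X j x \<in> B' j})"
  proof (rule prod.mono_neutral_right)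
    show "\<forall>i\<in>{..<n} - J. prob {x\<in>space M. X i x \<in> B' i} = 1"
    proof
      fix i assume i: "i \<in> {..<n} - J"
      then have "{x\<in>space M. X i x \<in> B' i} = space M" using sp by (auto simp: B'_def)
      then show "prob {x\<in>space M. X i x \<in> B' i} = 1" by (simp add: prob_space)
    qed
  qed (use J in auto)
  also have "\<dots> = (\<Prod>j\<in>J. prob (A j))"
    using B(2) by (intro prod.cong arg_cong[where f=prob]) (auto simp: B'_def)
  finally show "prob (\<Inter>j\<in>J. A j) = (\<Prod>j\<in>J. prob (A j))" .
qed

lemma walk_eq_on_epoch:
  assumes "good_stream s" "in_epoch n t s" "0 \<le> t"
  shows "walk t s = sum_list (jumps n s)"
  using epoch_eqI[OF assms] by (simp add: walk_def)

lemma cadlag_chain: "cadlag (\<lambda>t. chain h t s)"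
proof (cases "good_stream s")
  case False
  then show ?thesis by (auto simp: cadlag_def chain_def)
next
  case True
  show ?thesis
    unfolding cadlag_def
  proof (intro conjI allI impI)
    fix t :: real assume t: "0 \<le> t"
    define n where "n = epoch t s"
    have n: "in_epoch n t s" unfolding n_def by (rule in_epoch_epoch[OF True t])
    have "eventually (\<lambda>u. chain h u s = chain h t s) (at_right t)"
      unfolding eventually_at_right_field
    proof (intro exI conjI allI impI)
      show "t < arrival (Suc n) s" using n by (simp add: in_epoch_def)
      fix u assume "t < u" "u < arrival (Suc n) s"
      then have "in_epoch n u s" using n by (simp add: in_epoch_def)
      then show "chain h u s = chain h t s"
        using walk_eq_on_epoch[OF True n t] walk_eq_on_epoch[OF True, of n u] t \<open>t < u\<close>
        by (simp add: chain_def)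
    qed
    then show "continuous (at_right t) (\<lambda>t. chain h t s)"
      unfolding continuous_within by (rule tendsto_eventually)
  next
    fix t :: real assume t: "0 < t"
    obtain k where "t < arrival k s" using True by (auto simp: good_stream_def)
    \<comment> \<open>The first arrival not before \<open>t\<close>, so that \<open>t\<close> itself
      may be a jump time; the path is constant on the epoch ending there, which yields the left
      limit.\<close>
    define n where "n = (LEAST n. t \<le> arrival n s)"
    have n: "t \<le> arrival n s"
      unfolding n_def by (rule LeastI[of _ k]) (use \<open>t < arrival k s\<close> in simp)
    obtain m where m: "n = Suc m" using n t by (cases n) auto
    have "arrival m s < t"
      using not_less_Least[of m "\<lambda>n. t \<le> arrival n s"] m by (simp add: n_def not_le)
    have "eventually (\<lambda>u. chain h u s = h * of_int (sum_list (jumps m s))) (at_left t)"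
      unfolding eventually_at_left_field
    proof (intro exI conjI allI impI)
      show "max 0 (arrival m s) < t" using t \<open>arrival m s < t\<close> by simp
      fix u assume u: "max 0 (arrival m s) < u" "u < t"
      then have "in_epoch m u s" using n m by (simp add: in_epoch_def)
      then show "chain h u s = h * of_int (sum_list (jumps m s))"
        using walk_eq_on_epoch[OF True, of m u] u True by (simp add: chain_def)
    qed
    then show "\<exists>l. ((\<lambda>t. chain h t s) \<longlongrightarrow> l) (at_left t)"
      by (intro exI tendsto_eventually)
  qed
qed

lemma pred_good_stream [measurable]: "Measurable.pred jump_stream good_stream"
proof -
  have "(\<forall>t. \<exists>n. t < arrival n s) \<longleftrightarrow> (\<forall>k::nat. \<exists>n. real k < arrival n s)" for s
  proof (intro iffI allI)
    fix t assume k: "\<forall>k::nat. \<exists>n. real k < arrival n s"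
    obtain k :: nat where "t \<le> real k" using real_arch_simple by blast
    moreover obtain n where "real k < arrival n s" using k by blast
    ultimately have "t < arrival n s" by linarith
    then show "\<exists>n. t < arrival n s" ..
  qed simp
  then have "good_stream = (\<lambda>s. (\<forall>n. 0 < fst (s !! n)) \<and> (\<forall>k::nat. \<exists>n. real k < arrival n s))"
    by (intro ext) (simp add: good_stream_def)
  then show ?thesis by (subst \<open>good_stream = _\<close>) measurable
qed

lemma measurable_chain [measurable]: "chain h t \<in> borel_measurable jump_stream"
  unfolding chain_def by measurable

lemma pred_increments:
  fixes n :: nat
  assumes "\<And>i. i < n \<Longrightarrow> B i \<in> sets borel"
  shows "Measurable.pred jump_stream (\<lambda>s. \<forall>i<n. chain h (u i) s - chain h (v i) s \<in> B i)"
proof -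
  have "Measurable.pred jump_stream (\<lambda>s. \<forall>i\<in>{..<n}. chain h (u i) s - chain h (v i) s \<in> B i)"
    using assms by (intro pred_intros_finite(3) finite_lessThan pred_sets2[where N=borel]) simp_all
  then show ?thesis unfolding Ball_def lessThan_iff .
qed

context jump_chain
begin

text \<open>The value at time \<open>t\<close> is a sum of Poisson many independent jumps, so powers
  of the jump characteristic function are summed with Poisson weights to an exponential.\<close>

lemma char_chain:
  assumes t: "0 \<le> t"
  shows "(\<integral>s. iexp (u * chain h t s) \<partial>Q) = exp (of_real t * (CLINT x|jump_measure h lam P. iexp (u * x) - 1))"
proof -
  define a where "a = (\<integral>j. iexp (u * h * of_int j) \<partial>measure_pmf P)"
  have "(\<integral>j. iexp (u * (h * of_int j)) - 1 \<partial>measure_pmf P) = a - 1"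
    unfolding a_def mult.assoc
    by (subst Bochner_Integration.integral_diff)
      (auto intro!: measure_pmf.integrable_const_bound[where B=1] simp: measure_pmf.prob_space[simplified])
  then have rhs: "(CLINT x|jump_measure h lam P. iexp (u * x) - 1) = of_real lam * (a - 1)"
    using lam_pos by (subst integral_jump_measure) (simp_all add: scaleR_conv_of_real)
  have ae: "(\<integral>s. iexp (u * chain h t s) \<partial>Q) = (\<integral>s. iexp (u * h * of_int (walk t s)) \<partial>Q)"
    by (intro integral_cong_AE, measurable, use AE_good_stream in eventually_elim)
      (simp add: chain_def mult.assoc)
  show ?thesis
  \<comment> \<open>The Poisson distribution is used with a positive rate, so time 0 is treated
    apart.\<close>
  proof (cases "t = 0")
    case True
    have "(\<integral>s. iexp (u * h * of_int (walk t s)) \<partial>Q) = (\<integral>s. 1 \<partial>Q)"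
      by (intro integral_cong_AE, measurable, use AE_good_stream in eventually_elim)
        (simp add: walk_0 True)
    then have 1: "(\<integral>s. iexp (u * h * of_int (walk t s)) \<partial>Q) = 1"
      using Q.prob_space by simp
    show ?thesis
      unfolding ae 1 by (simp add: True)
  next
    case False
    then have rate: "0 < lam * t" using t lam_pos by simp
    define W where "W = bind_pmf (poisson_pmf (lam * t)) (\<lambda>n. map_pmf sum_list (replicate_pmf n P))"
    have pw: "pmf (poisson_pmf (lam * t)) n = poisson_weight n (lam * t)" for n
      using rate by (simp add: poisson_weight_def)
    have "distr Q (count_space UNIV) (walk t) = measure_pmf W"
    proof (rule measure_eqI)
      fix A :: "int set"
      have "emeasure (distr Q (count_space UNIV) (walk t)) A = (\<integral>\<^sup>+s. indicator A (walk t s) \<partial>Q)"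
        by (subst nn_integral_distr[symmetric, where f="indicator A" and M'="count_space UNIV"]) auto
      also have "\<dots> = (\<Sum>n. ennreal (poisson_weight n (lam * t)) * (\<integral>\<^sup>+w. indicator A (sum_list w) \<partial>replicate_pmf n P))"
        by (rule nn_integral_walk[OF t])
      also have "\<dots> = (\<integral>\<^sup>+n. \<integral>\<^sup>+w. indicator A (sum_list w) \<partial>replicate_pmf n P \<partial>poisson_pmf (lam * t))"
        by (subst nn_integral_measure_pmf) (simp add: pw nn_integral_count_space_nat)
      also have "\<dots> = (\<integral>\<^sup>+k. indicator A k \<partial>measure_pmf W)"
        by (simp only: W_def nn_integral_bind_pmf nn_integral_map_pmf)
      also have "\<dots> = emeasure (measure_pmf W) A"
        by simp
      finally show "emeasure (distr Q (count_space UNIV) (walk t)) A = emeasure (measure_pmf W) A" .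
    qed simp
    then have "(\<integral>s. iexp (u * h * of_int (walk t s)) \<partial>Q) = (\<integral>k. iexp (u * h * of_int k) \<partial>measure_pmf W)"
      by (subst integral_distr[of "walk t" Q "count_space UNIV" "\<lambda>k. iexp (u * h * of_int k)", symmetric]) simp_all
    also have "\<dots> = (\<integral>n. a ^ n \<partial>poisson_pmf (lam * t))"
      unfolding W_def
      by (subst integral_bind_pmf_bounded[where B=1]) (simp_all only: integral_map_pmf integral_iexp_replicate_pmf a_def, simp)
    also have "\<dots> = (\<integral>n. poisson_weight n (lam * t) *\<^sub>R a ^ n \<partial>count_space UNIV)"
      unfolding measure_pmf_eq_density by (subst integral_density) (auto simp: pw poisson_weight_def)
    also have "\<dots> = exp (of_real (- (lam * t))) * exp (of_real (lam * t) * a)"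
    proof -
      have "(\<lambda>n. exp (of_real (- (lam * t))) * ((of_real (lam * t) * a) ^ n /\<^sub>R fact n))
          sums (exp (of_real (- (lam * t))) * exp (of_real (lam * t) * a))"
        by (intro sums_mult exp_converges)
      moreover have eq: "poisson_weight n (lam * t) *\<^sub>R a ^ n
          = exp (of_real (- (lam * t))) * ((of_real (lam * t) * a) ^ n /\<^sub>R fact n)" for n
        using rate by (simp add: poisson_weight_def scaleR_conv_of_real power_mult_distrib exp_of_real[symmetric] field_simps)
      moreover have "summable (\<lambda>n. norm (exp (of_real (- (lam * t))) * ((of_real (lam * t) * a) ^ n /\<^sub>R fact n)))"
        unfolding norm_mult by (intro summable_mult summable_norm_exp)
      ultimately show ?thesis
        by (subst integral_count_space_nat) (auto simp: integrable_count_space_nat_iff sums_iff simp del: norm_scaleR norm_mult)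
    qed
    also have "\<dots> = exp (of_real t * (of_real lam * (a - 1)))"
      by (simp add: exp_add[symmetric] algebra_simps)
    finally show ?thesis
      unfolding ae rhs .
  qed
qed

lemma emeasure_increments:
  fixes t :: "nat \<Rightarrow> real"
  assumes t: "0 \<le> t 0" "\<forall>i<n. t i \<le> t (Suc i)" and B: "\<And>i. i < n \<Longrightarrow> B i \<in> sets borel"
  shows "emeasure Q {s. \<forall>i<n. chain h (t (Suc i)) s - chain h (t i) s \<in> B i}
    = (\<Prod>i<n. emeasure Q {s. chain h (t (Suc i) - t i) s \<in> B i})"
proof -
  define g :: "nat \<Rightarrow> int \<Rightarrow> ennreal" where "g i k = indicator (B i) (h * of_int k)" for i k
  have sets: "{s. \<forall>i<n. chain h (t (Suc i)) s - chain h (t i) s \<in> B i} \<in> sets Q"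
    by (rule sets_jump_stream_law_Collect, rule pred_increments, rule B)
  have "emeasure Q {s. \<forall>i<n. chain h (t (Suc i)) s - chain h (t i) s \<in> B i}
      = (\<integral>\<^sup>+s. indicator {s. \<forall>i<n. chain h (t (Suc i)) s - chain h (t i) s \<in> B i} s \<partial>Q)"
    using sets by simp
  also have "\<dots> = (\<integral>\<^sup>+s. (\<Prod>i<n. g i (walk (t (Suc i)) s - walk (t i) s)) \<partial>Q)"
  proof (intro nn_integral_cong_AE, use AE_good_stream in eventually_elim)
    case (elim s)
    have "(\<Prod>i<n. g i (walk (t (Suc i)) s - walk (t i) s)) = (\<Prod>i<n. indicator (B i) (chain h (t (Suc i)) s - chain h (t i) s))"
      using elim by (simp add: g_def chain_def algebra_simps)
    also have "\<dots> = indicator {s. \<forall>i<n. chain h (t (Suc i)) s - chain h (t i) s \<in> B i} s"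
      by (auto simp: indicator_def)
    finally show ?case ..
  qed
  also have "\<dots> = (\<Prod>i<n. \<integral>\<^sup>+s. g i (walk (t (Suc i) - t i) s) \<partial>Q)"
    by (rule nn_integral_increments[OF t])
  also have "\<dots> = (\<Prod>i<n. emeasure Q {s. chain h (t (Suc i) - t i) s \<in> B i})"
  proof (intro prod.cong refl)
    fix i assume "i \<in> {..<n}"
    then have "{s. chain h (t (Suc i) - t i) s \<in> B i} \<in> sets Q"
      using B by (intro sets_jump_stream_law_Collect pred_sets2[where N=borel]) simp_all
    moreover have "(\<integral>\<^sup>+s. g i (walk (t (Suc i) - t i) s) \<partial>Q) = (\<integral>\<^sup>+s. indicator {s. chain h (t (Suc i) - t i) s \<in> B i} s \<partial>Q)"
      by (intro nn_integral_cong_AE, use AE_good_stream in eventually_elim)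
        (simp add: g_def chain_def indicator_def)
    ultimately show "(\<integral>\<^sup>+s. g i (walk (t (Suc i) - t i) s) \<partial>Q) = emeasure Q {s. chain h (t (Suc i) - t i) s \<in> B i}"
      by simp
  qed
  finally show ?thesis .
qed

end

context jump_chain
begin

lemma emeasure_increment:
  assumes "0 \<le> u" "u \<le> v" "B \<in> sets borel"
  shows "emeasure Q {s. chain h v s - chain h u s \<in> B} = emeasure Q {s. chain h (v - u) s \<in> B}"
  using emeasure_increments[of "\<lambda>i. if i = 0 then u else v" 1 "\<lambda>_. B" h] assms by simp

text \<open>Stated for any space \<open>N\<close> with a decoding map \<open>d\<close>, so that the
  construction can be moved off the stream space. The assumption \<open>pmf P 0 = 0\<close> keeps
  the Levy measure off 0.\<close>

lemma compound_poisson_chain: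
  assumes N: "prob_space N" and d[measurable]: "d \<in> N \<rightarrow>\<^sub>M jump_stream" and distr: "distr N jump_stream d = Q"
    and P0: "pmf P 0 = 0" and h: "h \<noteq> 0"
  shows "compound_poisson N (\<lambda>t x. chain h t (d x)) (jump_measure h lam P)"
proof -
  interpret N: prob_space N by fact
  have emeasure_N: "emeasure N {x\<in>space N. A (d x)} = emeasure Q {s. A s}" if "Measurable.pred jump_stream A" for A
  proof -
    have "{s. A s} \<in> sets jump_stream"
      using sets_jump_stream_law_Collect[OF that] by (simp add: sets_jump_stream_law)
    then show ?thesis
      unfolding distr[symmetric] by (subst emeasure_distr) (auto intro!: arg_cong[where f="emeasure N"])
  qed
  have "levy_process N (\<lambda>t x. chain h t (d x))"
  proof
    show "(\<lambda>x. chain h t (d x)) \<in> borel_measurable N" for t by measurable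
    show "cadlag (\<lambda>t. chain h t (d x))" for x by (rule cadlag_chain)
    show "AE x in N. chain h 0 (d x) = 0"
      by (auto simp: chain_def walk_0)
  next
    fix n and t :: "nat \<Rightarrow> real"
    assume t: "0 \<le> t 0" "\<forall>i<n. t i \<le> t (Suc i)"
    have nn: "0 \<le> t i" if "i \<le> n" for i
      using that t by (induction i) (auto intro: order_trans)
    show "N.indep_vars (\<lambda>_. borel) (\<lambda>i x. chain h (t (Suc i)) (d x) - chain h (t i) (d x)) {..<n}"
    proof (rule N.indep_vars_lessThanI)
      show "(\<lambda>x. chain h (t (Suc i)) (d x) - chain h (t i) (d x)) \<in> borel_measurable N" for i
        by measurable
      fix B :: "nat \<Rightarrow> real set" assume B: "\<And>i. i < n \<Longrightarrow> B i \<in> sets borel"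
      have "emeasure N {x\<in>space N. \<forall>i<n. chain h (t (Suc i)) (d x) - chain h (t i) (d x) \<in> B i}
          = (\<Prod>i<n. emeasure Q {s. chain h (t (Suc i) - t i) s \<in> B i})"
        by (subst emeasure_N[OF pred_increments[OF B]]) (simp_all add: emeasure_increments[OF t B])
      also have "\<dots> = (\<Prod>i<n. emeasure N {x\<in>space N. chain h (t (Suc i)) (d x) - chain h (t i) (d x) \<in> B i})"
      proof (intro prod.cong refl)
        fix i assume i: "i \<in> {..<n}"
        have "emeasure N {x\<in>space N. chain h (t (Suc i)) (d x) - chain h (t i) (d x) \<in> B i}
            = emeasure Q {s. chain h (t (Suc i)) s - chain h (t i) s \<in> B i}"
          using B[of i] i by (intro emeasure_N pred_sets2[where N=borel]) simp_all
        then show "emeasure Q {s. chain h (t (Suc i) - t i) s \<in> B i}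
            = emeasure N {x\<in>space N. chain h (t (Suc i)) (d x) - chain h (t i) (d x) \<in> B i}"
          using emeasure_increment[of "t i" "t (Suc i)" "B i" h] B[of i] nn[of i] t(2) i by simp
      qed
      finally show "N.prob {x\<in>space N. \<forall>i<n. chain h (t (Suc i)) (d x) - chain h (t i) (d x) \<in> B i}
          = (\<Prod>i<n. N.prob {x\<in>space N. chain h (t (Suc i)) (d x) - chain h (t i) (d x) \<in> B i})"
        by (simp add: N.emeasure_eq_measure prod_ennreal measure_nonneg prod_nonneg)
    qed
  next
    fix s t :: real assume st: "0 \<le> s" "0 \<le> t"
    show "distr N borel (\<lambda>x. chain h (s + t) (d x) - chain h s (d x)) = distr N borel (\<lambda>x. chain h t (d x))"
    proof (rule measure_eqI)
      fix B assume "B \<in> sets (distr N borel (\<lambda>x. chain h (s + t) (d x) - chain h s (d x)))"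
      then have B[measurable]: "B \<in> sets borel" by simp
      have "emeasure N {x\<in>space N. chain h (s + t) (d x) - chain h s (d x) \<in> B}
          = emeasure N {x\<in>space N. chain h t (d x) \<in> B}"
        using emeasure_increment[of s "s + t" B h] st B emeasure_N[of "\<lambda>x. chain h t x \<in> B"]
          emeasure_N[of "\<lambda>x. chain h (s + t) x - chain h s x \<in> B"] by simp
      then show "emeasure (distr N borel (\<lambda>x. chain h (s + t) (d x) - chain h s (d x))) B
          = emeasure (distr N borel (\<lambda>x. chain h t (d x))) B"
        by (simp add: emeasure_distr vimage_def Int_def conj_commute)
    qed simp
  qed
  moreover have "char (distr N borel (\<lambda>x. chain h t (d x))) u
      = exp (of_real t * (CLINT x|jump_measure h lam P. iexp (u * x) - 1))" if "0 \<le> t" for t u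
  proof -
    have "char (distr N borel (\<lambda>x. chain h t (d x))) u = (\<integral>x. iexp (u * chain h t (d x)) \<partial>N)"
      by (simp add: char_def integral_distr)
    also have "\<dots> = (\<integral>s. iexp (u * chain h t s) \<partial>distr N jump_stream d)"
      by (subst integral_distr) simp_all
    finally show ?thesis
      unfolding distr using char_chain[OF that] by simp
  qed
  moreover have "{j::int. h * of_int j \<in> {0}} = {0}" using h by auto
  then have "emeasure (jump_measure h lam P) {0} = 0"
    by (simp add: emeasure_jump_measure emeasure_pmf_single P0)
  moreover have "finite_measure (jump_measure h lam P)"
    by (rule finite_measureI)
      (simp add: emeasure_jump_measure measure_pmf.emeasure_space_1[simplified] sets_eq_imp_space_eq[OF sets_jump_measure])
  ultimately show ?thesis
    unfolding compound_poisson_def by simp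
qed

lemma exists_compound_poisson_chain:
  assumes "pmf P 0 = 0" "h \<noteq> 0"
  shows "\<exists>(N :: (real \<Rightarrow> real) measure) X. compound_poisson N X (jump_measure h lam P)"
proof -
  \<comment> \<open>The witness is to live on functions from reals to reals. Holding times are
    stored at even integers and jumps at odd ones; the floor extends the code to all reals.\<close>
  define enc :: "(real \<times> int) stream \<Rightarrow> real \<Rightarrow> real" where
    "enc s r = (let n = nat \<lfloor>r\<rfloor> in if even n then fst (s !! (n div 2)) else of_int (snd (s !! (n div 2))))" for s r
  define dec :: "(real \<Rightarrow> real) \<Rightarrow> (real \<times> int) stream" where
    "dec f = to_stream (\<lambda>n. (f (real (2 * n)), \<lfloor>f (real (2 * n + 1))\<rfloor>))" for f
  have [measurable]: "enc \<in> jump_stream \<rightarrow>\<^sub>M (\<Pi>\<^sub>M r\<in>UNIV. borel)"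
    by (rule measurable_PiM_single') (auto simp: enc_def Let_def)
  have [measurable]: "dec \<in> (\<Pi>\<^sub>M r\<in>UNIV. borel) \<rightarrow>\<^sub>M jump_stream"
    by (rule measurable_stream_space2) (simp add: dec_def to_stream_def)
  have dec_enc: "dec (enc s) = s" for s
  proof -
    have "dec (enc s) = to_stream (\<lambda>n. s !! n)"
      unfolding dec_def enc_def Let_def
    proof (intro arg_cong[where f=to_stream] ext)
      fix n :: nat
      have "nat \<lfloor>real (2 * n)\<rfloor> = 2 * n" "nat \<lfloor>real (2 * n + 1)\<rfloor> = 2 * n + 1"
        by (simp_all only: floor_of_nat nat_int)
      then show "((if even (nat \<lfloor>real (2 * n)\<rfloor>) then fst (s !! (nat \<lfloor>real (2 * n)\<rfloor> div 2))
            else of_int (snd (s !! (nat \<lfloor>real (2 * n)\<rfloor> div 2)))),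
          \<lfloor>if even (nat \<lfloor>real (2 * n + 1)\<rfloor>) then fst (s !! (nat \<lfloor>real (2 * n + 1)\<rfloor> div 2))
            else of_int (snd (s !! (nat \<lfloor>real (2 * n + 1)\<rfloor> div 2)))\<rfloor>) = s !! n"
        by (simp del: of_nat_add of_nat_mult of_nat_Suc)
    qed
    then show ?thesis by (simp add: to_stream_def stream_smap_nats[symmetric])
  qed
  let ?N = "distr Q (\<Pi>\<^sub>M r\<in>UNIV. borel) enc"
  have "prob_space ?N" by (rule Q.prob_space_distr) measurable
  moreover have "distr ?N jump_stream dec = Q"
    by (subst distr_distr) (simp_all add: comp_def dec_enc distr_id2 sets_jump_stream_law)
  ultimately have "compound_poisson ?N (\<lambda>t x. chain h t (dec x)) (jump_measure h lam P)"
    by (intro compound_poisson_chain assms) measurable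
  then show ?thesis by blast
qed

end

section \<open>Uniqueness of the law of a compound Poisson process\<close>

context levy_process
begin

text \<open>Path values are partial sums of independent increments whose laws depend only on the
  time steps. As \<open>X 0 = 0\<close> holds almost surely only, the two events agree up to a null
  set.\<close>

lemma emeasure_finite_dimensional:
  fixes t :: "nat \<Rightarrow> real"
  assumes n: "0 < n" and t: "t 0 = 0" "\<forall>i<n. t i \<le> t (Suc i)" and B: "\<And>i. i < n \<Longrightarrow> B i \<in> sets borel"
  shows "emeasure M {x\<in>space M. \<forall>i<n. X (t (Suc i)) x \<in> B i}
    = emeasure (\<Pi>\<^sub>M i\<in>{..<n}. distr M borel (X (t (Suc i) - t i)))
        {d\<in>space (\<Pi>\<^sub>M i\<in>{..<n}. borel). \<forall>i\<in>{..<n}. (\<Sum>k\<le>i. d k) \<in> B i}"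
proof -
  have nn: "0 \<le> t i" if "i \<le> n" for i
    using that t by (induction i) (auto intro: order_trans)
  have meas [measurable]: "X (t i) \<in> borel_measurable M" if "i \<le> n" for i
    using nn[OF that] by (rule measurable_X)
  define D where "D i x = X (t (Suc i)) x - X (t i) x" for i x
  have D[measurable]: "D i \<in> borel_measurable M" if "i \<in> {..<n}" for i
    unfolding D_def using meas[of i] meas[of "Suc i"] that by (intro borel_measurable_diff) auto
  have "indep_vars (\<lambda>_. borel) D {..<n}"
    unfolding D_def[abs_def] using t by (intro independent_increments) auto
  then have "distr M (\<Pi>\<^sub>M i\<in>{..<n}. borel) (\<lambda>x. \<lambda>i\<in>{..<n}. D i x) = (\<Pi>\<^sub>M i\<in>{..<n}. distr M borel (D i))"
    using n D by (subst (asm) indep_vars_iff_distr_eq_PiM') auto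
  also have "\<dots> = (\<Pi>\<^sub>M i\<in>{..<n}. distr M borel (X (t (Suc i) - t i)))"
  proof (intro PiM_cong refl)
    fix i assume "i \<in> {..<n}"
    then show "distr M borel (D i) = distr M borel (X (t (Suc i) - t i))"
      using stationary_increments[of "t i" "t (Suc i) - t i"] nn[of i] t(2) by (simp add: D_def[abs_def])
  qed
  finally have law: "distr M (\<Pi>\<^sub>M i\<in>{..<n}. borel) (\<lambda>x. \<lambda>i\<in>{..<n}. D i x)
      = (\<Pi>\<^sub>M i\<in>{..<n}. distr M borel (X (t (Suc i) - t i)))" .
  let ?S = "{d\<in>space (\<Pi>\<^sub>M i\<in>{..<n}. borel :: real measure). \<forall>i\<in>{..<n}. (\<Sum>k\<le>i. d k) \<in> B i}"
  have [measurable]: "(\<lambda>d. \<Sum>k\<le>i. d k) \<in> borel_measurable (\<Pi>\<^sub>M i\<in>{..<n}. borel :: real measure)" if "i \<in> {..<n}" for i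
    using that by (intro borel_measurable_sum measurable_component_singleton) auto
  have S: "?S \<in> sets (\<Pi>\<^sub>M i\<in>{..<n}. borel)"
    using B by (intro predE pred_intros_finite(3) pred_sets2[where N=borel]) auto
  have DM: "(\<lambda>x. \<lambda>i\<in>{..<n}. D i x) \<in> M \<rightarrow>\<^sub>M (\<Pi>\<^sub>M i\<in>{..<n}. borel)"
    using D by (rule measurable_restrict)
  have "emeasure M {x\<in>space M. \<forall>i<n. X (t (Suc i)) x \<in> B i}
      = emeasure M ((\<lambda>x. \<lambda>i\<in>{..<n}. D i x) -` ?S \<inter> space M)"
  proof (rule emeasure_eq_AE)
    show "AE x in M. (x \<in> {x\<in>space M. \<forall>i<n. X (t (Suc i)) x \<in> B i})
        = (x \<in> (\<lambda>x. \<lambda>i\<in>{..<n}. D i x) -` ?S \<inter> space M)"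
      using X_0
    proof eventually_elim
      case (elim x)
      have "X (t (Suc i)) x = (\<Sum>k\<le>i. D k x)" for i
        by (induction i) (use elim t(1) in \<open>auto simp: D_def\<close>)
      moreover have "(\<Sum>k\<le>i. (\<lambda>i\<in>{..<n}. D i x) k) = (\<Sum>k\<le>i. D k x)" if "i < n" for i
        using that by (intro sum.cong) auto
      ultimately show ?case
        by (auto simp: space_PiM)
    qed
    have "{x\<in>space M. \<forall>i\<in>{..<n}. X (t (Suc i)) x \<in> B i} \<in> sets M"
      using B meas by (intro predE pred_intros_finite(3) pred_sets2[where N=borel]) auto
    then show "{x\<in>space M. \<forall>i<n. X (t (Suc i)) x \<in> B i} \<in> sets M"
      unfolding Ball_def lessThan_iff .
    show "(\<lambda>x. \<lambda>i\<in>{..<n}. D i x) -` ?S \<inter> space M \<in> sets M"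
      by (rule measurable_sets[OF DM S])
  qed
  also have "\<dots> = emeasure (\<Pi>\<^sub>M i\<in>{..<n}. distr M borel (X (t (Suc i) - t i))) ?S"
    unfolding law[symmetric] by (rule emeasure_distr[OF DM S, symmetric])
  finally show ?thesis .
qed

lemma measurable_path: "(\<lambda>x. \<lambda>t\<in>{0..}. X t x) \<in> M \<rightarrow>\<^sub>M (\<Pi>\<^sub>M t\<in>{0..}. borel)"
  using measurable_X by (intro measurable_restrict) auto

end

text \<open>Cylinder events determine a law on the product space, and independence and stationarity
  of the increments express their probabilities through the one-dimensional laws.\<close>

lemma process_law_eqI:
  assumes "levy_process M X" "levy_process M' X'"
    and marg: "\<And>t. 0 \<le> t \<Longrightarrow> distr M borel (X t) = distr M' borel (X' t)"
  shows "process_law M X = process_law M' X'"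
proof -
  interpret X: levy_process M X by fact
  interpret X': levy_process M' X' by fact
  have pre: "emeasure (distr M (\<Pi>\<^sub>M t\<in>{0..}. borel) (\<lambda>x. \<lambda>t\<in>{0..}. X t x)) (prod_emb {0..} (\<lambda>_. borel) J (Pi\<^sub>E J A))
      = emeasure M {x\<in>space M. \<forall>t\<in>J. X t x \<in> A t}"
    if "levy_process M X" "finite J" "J \<subseteq> {0..}" "\<And>t. t \<in> J \<Longrightarrow> A t \<in> sets borel" for M :: "'c measure" and X J A
  proof -
    interpret levy_process M X by fact
    have "prod_emb {0..} (\<lambda>_. borel) J (Pi\<^sub>E J A) \<in> sets (\<Pi>\<^sub>M t\<in>{0..}. borel)"
      using that by (intro sets_PiM_I) auto
    then show ?thesis
      using that(3) by (subst emeasure_distr[OF measurable_path])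
        (auto intro!: arg_cong[where f="emeasure M"] simp: prod_emb_def space_PiM PiE_iff extensional_def restrict_def subset_eq)
  qed
  show ?thesis
    unfolding process_law_def
  proof (rule measure_eqI_PiM_infinite[where I="{0..}" and M="\<lambda>_. borel"])
    fix A :: "real \<Rightarrow> real set" and J
    assume J: "finite J" "J \<subseteq> {0..}" and A: "\<And>i. i \<in> J \<Longrightarrow> A i \<in> sets borel"
    define ts where "ts = sorted_list_of_set J"
    \<comment> \<open>Time 0 is put in front of the sorted times, so that all values are sums of
      increments from the origin.\<close>
    define t where "t i = (if i = 0 then 0 else ts ! (i - 1))" for i
    have ts: "set ts = J" "sorted ts" using J by (simp_all add: ts_def)
    have "0 \<le> ts ! i" if "i < length ts" for i
      using that ts J(2) nth_mem[OF that] by auto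
    then have t: "t 0 = 0" "\<forall>i<length ts. t i \<le> t (Suc i)"
      using ts(2) by (auto simp: t_def sorted_nth_mono)
    have all: "(\<forall>s\<in>J. P s) \<longleftrightarrow> (\<forall>i<length ts. P (t (Suc i)))" for P
      unfolding ts(1)[symmetric] all_set_conv_all_nth by (simp add: t_def)
    have A': "A (t (Suc i)) \<in> sets borel" if "i < length ts" for i
      using that ts(1) A[of "ts ! i"] by (auto simp: t_def)
    have "emeasure M {x\<in>space M. \<forall>s\<in>J. X s x \<in> A s} = emeasure M' {x\<in>space M'. \<forall>s\<in>J. X' s x \<in> A s}"
    proof (cases "ts = []")
      case True
      then have "J = {}" using ts(1) by simp
      then show ?thesis by (simp add: X.emeasure_space_1 X'.emeasure_space_1)
    next
      case False
      have "(\<Pi>\<^sub>M i\<in>{..<length ts}. distr M borel (X (t (Suc i) - t i))) = (\<Pi>\<^sub>M i\<in>{..<length ts}. distr M' borel (X' (t (Suc i) - t i)))"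
        using t(2) by (intro PiM_cong refl marg) auto
      then show ?thesis
        using X.emeasure_finite_dimensional[of "length ts" t "\<lambda>i. A (t (Suc i))", OF _ t A']
          X'.emeasure_finite_dimensional[of "length ts" t "\<lambda>i. A (t (Suc i))", OF _ t A'] False
        unfolding all by simp
    qed
    then show "emeasure (distr M (\<Pi>\<^sub>M t\<in>{0..}. borel) (\<lambda>x. \<lambda>t\<in>{0..}. X t x)) (prod_emb {0..} (\<lambda>_. borel) J (Pi\<^sub>E J A))
      = emeasure (distr M' (\<Pi>\<^sub>M t\<in>{0..}. borel) (\<lambda>x. \<lambda>t\<in>{0..}. X' t x)) (prod_emb {0..} (\<lambda>_. borel) J (Pi\<^sub>E J A))"
      using pre[OF X.levy_process_axioms J A] pre[OF X'.levy_process_axioms J A] by simp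
  next
    show "finite_measure (distr M (\<Pi>\<^sub>M t\<in>{0..}. borel) (\<lambda>x. \<lambda>t\<in>{0..}. X t x))"
      using X.prob_space_distr[OF X.measurable_path] by (rule prob_space.finite_measure)
  qed simp_all
qed

lemma compound_poisson_marginal_eq:
  assumes "compound_poisson M X \<nu>" "compound_poisson M' X' \<nu>" "0 \<le> t"
  shows "distr M borel (X t) = distr M' borel (X' t)"
proof -
  interpret X: levy_process M X using assms by (simp add: compound_poisson_def)
  interpret X': levy_process M' X' using assms by (simp add: compound_poisson_def)
  show ?thesis
  proof (rule Levy_uniqueness)
    show "real_distribution (distr M borel (X t))"
      using assms(3) by (intro X.real_distribution_distr X.measurable_X)
    show "real_distribution (distr M' borel (X' t))"
      using assms(3) by (intro X'.real_distribution_distr X'.measurable_X)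
    show "char (distr M borel (X t)) = char (distr M' borel (X' t))"
      using assms by (intro ext) (simp add: compound_poisson_def)
  qed
qed

lemma compound_poisson_process_law_eq:
  assumes "compound_poisson M X \<nu>" "compound_poisson M' X' \<nu>"
  shows "process_law M X = process_law M' X'"
  using assms compound_poisson_marginal_eq[OF assms]
  by (intro process_law_eqI) (auto simp: compound_poisson_def)

section \<open>Local times and ladder heights of lattice paths\<close>

definition lattice_path :: "real \<Rightarrow> (real \<Rightarrow> real) \<Rightarrow> bool" where
  "lattice_path h f \<longleftrightarrow> cadlag f \<and> (\<forall>t\<ge>0. \<exists>k::int. f t = h * of_int k)"

definition at_min :: "(real \<Rightarrow> real) \<Rightarrow> real \<Rightarrow> bool" where
  "at_min f s \<longleftrightarrow> (\<forall>u. 0 \<le> u \<longrightarrow> u \<le> s \<longrightarrow> f s \<le> f u)"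

text \<open>A newly achieved maximum without suprema or first times: the current value is maximal,
  and since it was first reached it has never been left.\<close>

definition at_new_max :: "(real \<Rightarrow> real) \<Rightarrow> real \<Rightarrow> bool" where
  "at_new_max f s \<longleftrightarrow> (\<forall>u v. 0 \<le> u \<longrightarrow> u \<le> v \<longrightarrow> v \<le> s \<longrightarrow> f u \<le> f s \<and> (f u = f s \<longrightarrow> f v = f s))"

text \<open>The range is arbitrary because the notion serves for paths and for predicates on times
  alike.\<close>

definition right_constant :: "(real \<Rightarrow> 'b) \<Rightarrow> bool" where
  "right_constant f \<longleftrightarrow> (\<forall>t\<ge>0. \<exists>e>0. \<forall>u. t \<le> u \<longrightarrow> u < t + e \<longrightarrow> f u = f t)"

definition path_clock :: "(real \<Rightarrow> bool) \<Rightarrow> real \<Rightarrow> real" where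
  "path_clock E t = (LINT s:{0..t}|lborel. of_bool (E s))"

section \<open>Right-constancy and attained extrema of lattice paths\<close>

lemma right_constantD:
  assumes "right_constant f" "0 \<le> t"
  obtains e where "0 < e" "\<And>u. t \<le> u \<Longrightarrow> u < t + e \<Longrightarrow> f u = f t"
  using assms unfolding right_constant_def by metis

text \<open>Lattice points at distance less than \<open>h\<close> coincide, so right-continuity
  becomes constancy on a short interval to the right.\<close>

lemma lattice_path_right_constant:
  assumes h: "0 < h" and f: "lattice_path h f"
  shows "right_constant f"
  unfolding right_constant_def
proof (intro allI impI)
  fix t :: real assume t: "0 \<le> t"
  then have "(f \<longlongrightarrow> f t) (at_right t)"
    using f by (auto simp: lattice_path_def cadlag_def continuous_within)
  then have "eventually (\<lambda>u. dist (f u) (f t) < h) (at_right t)"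
    using h by (rule tendstoD)
  then obtain b where b: "b > t" "\<And>u. t < u \<Longrightarrow> u < b \<Longrightarrow> \<bar>f u - f t\<bar> < h"
    by (auto simp: eventually_at_right_field dist_real_def)
  have const: "f u = f t" if u: "t \<le> u" "u < t + (b - t)" for u
  proof (cases "u = t")
    case False
    then have "\<bar>f u - f t\<bar> < h" using b(2)[of u] u by simp
    moreover obtain k l :: int where k: "f u = h * of_int k" and l: "f t = h * of_int l"
      using f t u unfolding lattice_path_def by (meson order_trans)
    ultimately have "h * \<bar>of_int (k - l)\<bar> < h * 1"
      using h by (simp add: abs_mult[symmetric] right_diff_distrib[symmetric] flip: of_int_diff)
        (simp add: abs_mult)
    then have "k = l" using h by simp
    then show ?thesis using k l by simp
  qed simp
  show "\<exists>e>0. \<forall>u. t \<le> u \<longrightarrow> u < t + e \<longrightarrow> f u = f t"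
    by (intro exI[of _ "b - t"] conjI allI impI const) (use b(1) in simp)
qed

lemma lattice_path_uminus: "lattice_path h f \<Longrightarrow> lattice_path h (\<lambda>t. - f t)"
  unfolding lattice_path_def cadlag_def
proof (intro conjI allI impI; elim conjE)
  fix t :: real assume "0 < t" "\<forall>t>0. \<exists>l. (f \<longlongrightarrow> l) (at_left t)"
  then obtain l where "(f \<longlongrightarrow> l) (at_left t)" by blast
  then show "\<exists>l. ((\<lambda>t. - f t) \<longlongrightarrow> l) (at_left t)"
    by (intro exI[of _ "- l"] tendsto_minus)
next
  fix t :: real assume "0 \<le> t" "\<forall>t\<ge>0. \<exists>k::int. f t = h * of_int k"
  then obtain k :: int where "f t = h * of_int k" by blast
  then show "\<exists>k::int. - f t = h * of_int k" by (intro exI[of _ "- k"]) simp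
qed (auto intro: continuous_minus)

text \<open>One-sided limits bound the path near each point, and bisection turns the local bounds
  into one on the whole interval.\<close>

lemma cadlag_bounded:
  assumes f: "cadlag f" and "0 \<le> t"
  shows "\<exists>B. \<forall>s. 0 \<le> s \<and> s \<le> t \<longrightarrow> \<bar>f s\<bar> \<le> B"
proof -
  define P where "P a b \<longleftrightarrow> (\<exists>B. \<forall>s. a \<le> s \<and> s \<le> b \<and> 0 \<le> s \<longrightarrow> \<bar>f s\<bar> \<le> B)" for a b
  have "P 0 t"
    using \<open>0 \<le> t\<close>
  proof (induction rule: Bolzano)
    case (trans a b c)
    then obtain B B' where "\<forall>s. a \<le> s \<and> s \<le> b \<and> 0 \<le> s \<longrightarrow> \<bar>f s\<bar> \<le> B" "\<forall>s. b \<le> s \<and> s \<le> c \<and> 0 \<le> s \<longrightarrow> \<bar>f s\<bar> \<le> B'"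
      by (auto simp: P_def)
    then have "\<forall>s. a \<le> s \<and> s \<le> c \<and> 0 \<le> s \<longrightarrow> \<bar>f s\<bar> \<le> max B B'"
      by (metis linear max.coboundedI1 max.coboundedI2)
    then show ?case unfolding P_def ..
  next
    case (local x)
    have "(f \<longlongrightarrow> f x) (at_right x)"
      using f local by (auto simp: cadlag_def continuous_within)
    from tendstoD[OF this zero_less_one] obtain b where b: "b > x" "\<And>u. x < u \<Longrightarrow> u < b \<Longrightarrow> \<bar>f u - f x\<bar> < 1"
      by (auto simp: eventually_at_right_field dist_real_def)
    obtain a l where a: "a < x" "\<And>u. a < u \<Longrightarrow> u < x \<Longrightarrow> 0 \<le> u \<Longrightarrow> \<bar>f u - l\<bar> < 1"
    proof (cases "x = 0")
      case True
      show ?thesis by (rule that[of "-1" 0]) (use True in auto)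
    next
      case False
      then have "0 < x" using local by simp
      then obtain l where "(f \<longlongrightarrow> l) (at_left x)"
        using f unfolding cadlag_def by blast
      from tendstoD[OF this zero_less_one] show ?thesis
        using that by (auto simp: eventually_at_left_field dist_real_def)
    qed
    show ?case
    proof (intro exI conjI allI impI)
      show "0 < min (b - x) (x - a)" using a b by simp
      fix c d assume cd: "c \<le> x \<and> x \<le> d \<and> d - c < min (b - x) (x - a)"
      show "P c d"
        unfolding P_def
      proof (intro exI allI impI)
        fix s assume s: "c \<le> s \<and> s \<le> d \<and> 0 \<le> s"
        consider "s = x" | "x < s" | "s < x" by linarith
        then show "\<bar>f s\<bar> \<le> \<bar>f x\<bar> + \<bar>l\<bar> + 1"
        proof cases
          case 2
          then have "\<bar>f s - f x\<bar> < 1" using s cd by (intro b(2)) auto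
          then show ?thesis by linarith
        next
          case 3
          then have "\<bar>f s - l\<bar> < 1" using s cd by (intro a(2)) auto
          then show ?thesis by linarith
        qed simp
      qed
    qed
  qed
  then show ?thesis by (auto simp: P_def)
qed

text \<open>A bounded set of lattice points is finite, so the supremum is attained; applied to the
  negated path as well, it makes the running extrema values of the path.\<close>

lemma lattice_path_max:
  assumes h: "0 < h" and f: "lattice_path h f" and t: "0 \<le> t"
  obtains m where "0 \<le> m" "m \<le> t" "\<And>u. 0 \<le> u \<Longrightarrow> u \<le> t \<Longrightarrow> f u \<le> f m"
proof -
  obtain B where B: "\<And>s. 0 \<le> s \<Longrightarrow> s \<le> t \<Longrightarrow> \<bar>f s\<bar> \<le> B"
    using cadlag_bounded[of f t] f t by (auto simp: lattice_path_def)
  have "f ` {0..t} \<subseteq> (\<lambda>k::int. h * of_int k) ` {\<lfloor>- (B / h)\<rfloor>..\<lceil>B / h\<rceil>}"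
  proof
    fix y assume "y \<in> f ` {0..t}"
    then obtain s where s: "0 \<le> s" "s \<le> t" "y = f s" by auto
    then obtain k :: int where k: "y = h * of_int k" using f by (auto simp: lattice_path_def)
    have "\<bar>h * of_int k\<bar> \<le> B" using B s k by simp
    then have "\<bar>of_int k\<bar> \<le> B / h" using h by (simp add: abs_mult field_simps)
    then have "\<lfloor>- (B / h)\<rfloor> \<le> k" "k \<le> \<lceil>B / h\<rceil>" by linarith+
    then show "y \<in> (\<lambda>k::int. h * of_int k) ` {\<lfloor>- (B / h)\<rfloor>..\<lceil>B / h\<rceil>}" using k by auto
  qed
  then have fin: "finite (f ` {0..t})" by (rule finite_subset) simp
  have "Max (f ` {0..t}) \<in> f ` {0..t}" using t fin by (intro Max_in) auto
  then obtain m where "m \<in> {0..t}" "f m = Max (f ` {0..t})" by auto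
  then show thesis using fin by (intro that[of m]) auto
qed

lemma at_min_iff:
  assumes h: "0 < h" and f: "lattice_path h f" and s: "0 \<le> s"
  shows "f s = running_inf f s \<longleftrightarrow> at_min f s"
proof -
  obtain m where m: "0 \<le> m" "m \<le> s" "\<And>u. 0 \<le> u \<Longrightarrow> u \<le> s \<Longrightarrow> f m \<le> f u"
    using lattice_path_max[OF h lattice_path_uminus[OF f] s] by auto
  then have "running_inf f s = f m"
    unfolding running_inf_def by (intro cInf_eq_minimum) auto
  then show ?thesis
    using m s unfolding at_min_def by (metis order_antisym order_refl)
qed

text \<open>Right-constancy makes the infimum \<open>g\<close> of the times at the supremum one of
  these times, so constancy on \<open>{g..s}\<close> says that the maximum has not been left since
  it was first reached.\<close>

lemma at_new_max_iff:
  assumes h: "0 < h" and f: "lattice_path h f" and s: "0 \<le> s"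
  shows "(\<forall>u\<in>{first_time_at_sup f s..s}. f u = running_sup f s) \<longleftrightarrow> at_new_max f s"
proof -
  obtain m where m: "0 \<le> m" "m \<le> s" and le_m: "\<And>u. 0 \<le> u \<Longrightarrow> u \<le> s \<Longrightarrow> f u \<le> f m"
    by (rule lattice_path_max[OF h f s]) blast
  then have sup: "running_sup f s = f m"
    unfolding running_sup_def by (intro cSup_eq_maximum) auto
  define A where "A = {r\<in>{0..s}. f r = f m}"
  define g where "g = Inf A"
  have g: "first_time_at_sup f s = g"
    by (simp add: first_time_at_sup_def sup g_def A_def)
  have "m \<in> A" using m by (simp add: A_def)
  have bdd: "bdd_below A" by (auto simp: A_def)
  have lower: "g \<le> r" if "r \<in> A" for r
    unfolding g_def using that bdd by (rule cInf_lower)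
  have "0 \<le> g" unfolding g_def using \<open>m \<in> A\<close> by (intro cInf_greatest) (auto simp: A_def)
  have "g \<in> A"
  proof -
    obtain e where e: "0 < e" "\<And>u. g \<le> u \<Longrightarrow> u < g + e \<Longrightarrow> f u = f g"
      by (rule right_constantD[OF lattice_path_right_constant[OF h f] \<open>0 \<le> g\<close>]) blast
    obtain r where r: "r \<in> A" "r < g + e"
      using cInf_lessD[of A "g + e"] \<open>m \<in> A\<close> e(1) by (auto simp: g_def)
    then have "f g = f m" using e(2)[of r] lower[OF r(1)] by (simp add: A_def)
    then show ?thesis using lower[OF r(1)] r(1) \<open>0 \<le> g\<close> by (simp add: A_def)
  qed
  then have g_le: "g \<le> s" and fg: "f g = f m" by (auto simp: A_def)
  show ?thesis
    unfolding g sup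
  proof
    assume *: "\<forall>u\<in>{g..s}. f u = f m"
    then have fs: "f s = f m" using g_le by auto
    show "at_new_max f s"
      unfolding at_new_max_def fs
    proof (intro allI impI conjI)
      fix u v assume uv: "0 \<le> u" "u \<le> v" "v \<le> s"
      then show "f u \<le> f m" by (intro le_m) auto
      assume "f u = f m"
      then have "g \<le> u" using uv by (intro lower) (auto simp: A_def)
      then show "f v = f m" using * uv by auto
    qed
  next
    assume nm: "at_new_max f s"
    have "f m \<le> f s" using nm[unfolded at_new_max_def, rule_format, of m m] m by simp
    then have fs: "f s = f m" using le_m[of s] s by simp
    show "\<forall>u\<in>{g..s}. f u = f m"
    proof
      fix u assume "u \<in> {g..s}"
      then show "f u = f m"
        using nm[unfolded at_new_max_def, rule_format, of g u] fg fs \<open>0 \<le> g\<close> by simp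
    qed
  qed
qed

lemma local_time_new_max_eq:
  assumes "0 < h" "lattice_path h f"
  shows "local_time_new_max f t = path_clock (at_new_max f) t"
  unfolding local_time_new_max_def path_clock_def
proof (rule set_lebesgue_integral_cong)
  show "\<forall>s. s \<in> {0..t} \<longrightarrow> of_bool (\<forall>u\<in>{first_time_at_sup f s..s}. f u = running_sup f s) = (of_bool (at_new_max f s) :: real)"
    by (intro allI impI arg_cong[where f=of_bool] at_new_max_iff[OF assms]) simp
qed simp

lemma local_time_min_eq:
  assumes "0 < h" "lattice_path h f"
  shows "local_time_min c f t = c * path_clock (at_min f) t"
  unfolding local_time_min_def path_clock_def
proof (intro arg_cong2[where f="(*)"] refl set_lebesgue_integral_cong)
  show "\<forall>s. s \<in> {0..t} \<longrightarrow> of_bool (f s = running_inf f s) = (of_bool (at_min f s) :: real)"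
    by (intro allI impI arg_cong[where f=of_bool] at_min_iff[OF assms]) simp
qed simp

lemma at_min_right_constant:
  assumes f: "right_constant f"
  shows "right_constant (at_min f)"
  unfolding right_constant_def
proof (intro allI impI)
  fix t :: real assume t: "0 \<le> t"
  obtain e where e: "0 < e" "\<And>u. t \<le> u \<Longrightarrow> u < t + e \<Longrightarrow> f u = f t"
    by (rule right_constantD[OF f t]) blast
  have "at_min f u = at_min f t" if "t \<le> u" "u < t + e" for u
  proof -
    have "f v = f t" if "t \<le> v" "v \<le> u" for v using that \<open>u < t + e\<close> by (intro e(2)) auto
    then show ?thesis
      using e(2)[OF that] that unfolding at_min_def by (smt (verit))
  qed
  then show "\<exists>e>0. \<forall>u. t \<le> u \<longrightarrow> u < t + e \<longrightarrow> at_min f u = at_min f t" using e(1) by blast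
qed

lemma at_new_max_right_constant:
  assumes f: "right_constant f"
  shows "right_constant (at_new_max f)"
  unfolding right_constant_def
proof (intro allI impI)
  fix t :: real assume t: "0 \<le> t"
  obtain e where e: "0 < e" "\<And>u. t \<le> u \<Longrightarrow> u < t + e \<Longrightarrow> f u = f t"
    by (rule right_constantD[OF f t]) blast
  have "at_new_max f s = at_new_max f t" if s: "t \<le> s" "s < t + e" for s
  proof -
    have const: "f v = f t" if "t \<le> v" "v \<le> s" for v using that s by (intro e(2)) auto
    show ?thesis
    proof
      assume nm: "at_new_max f s"
      show "at_new_max f t"
        unfolding at_new_max_def
      proof (intro allI impI)
        fix u v assume "0 \<le> u" "u \<le> v" "v \<le> t"
        then show "f u \<le> f t \<and> (f u = f t \<longrightarrow> f v = f t)"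
          using nm[unfolded at_new_max_def, rule_format, of u v] s const[of s] by simp
      qed
    next
      assume nm: "at_new_max f t"
      show "at_new_max f s"
        unfolding at_new_max_def const[OF s(1) order_refl]
      proof (intro allI impI)
        fix u v assume uv: "0 \<le> u" "u \<le> v" "v \<le> s"
        consider "v \<le> t" | "u \<le> t" "t \<le> v" | "t \<le> u" by linarith
        then show "f u \<le> f t \<and> (f u = f t \<longrightarrow> f v = f t)"
        proof cases
          case 1
          then show ?thesis using nm uv unfolding at_new_max_def by blast
        next
          case 2
          then have "f u \<le> f t" using nm uv unfolding at_new_max_def by blast
          then show ?thesis using const[of v] 2 uv by simp
        next
          case 3
          then show ?thesis using const[of v] const[of u] uv by simp
        qed
      qed
    qed
  qed
  then show "\<exists>e>0. \<forall>u. t \<le> u \<longrightarrow> u < t + e \<longrightarrow> at_new_max f u = at_new_max f t" using e(1) by blast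
qed

section \<open>Clocks that run on a measurable set of times\<close>

lemma path_clock_measure:
  assumes "{s. 0 \<le> s \<and> E s} \<in> sets borel"
  shows "path_clock E t = measure lborel ({0..t} \<inter> {s. 0 \<le> s \<and> E s})"
proof -
  have "path_clock E t = (\<integral>s. indicator ({0..t} \<inter> {s. 0 \<le> s \<and> E s}) s \<partial>lborel)"
    unfolding path_clock_def set_lebesgue_integral_def
    by (intro Bochner_Integration.integral_cong) (auto simp: indicator_def)
  then show ?thesis using assms by simp
qed

lemma fmeasurable_Icc_Int:
  assumes "S \<in> sets borel"
  shows "{a..b::real} \<inter> S \<in> fmeasurable lborel" "{a<..b::real} \<inter> S \<in> fmeasurable lborel"
proof -
  have "{a..b} \<in> fmeasurable lborel"
    by (rule fmeasurable_cbox[of a b, unfolded box_real])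
  then show "{a..b} \<inter> S \<in> fmeasurable lborel" "{a<..b} \<inter> S \<in> fmeasurable lborel"
    using assms by (auto elim!: fmeasurableI2)
qed

lemma path_clock_add:
  assumes E: "{s. 0 \<le> s \<and> E s} \<in> sets borel" and "0 \<le> s" "s \<le> t"
  shows "path_clock E t = path_clock E s + measure lborel ({s<..t} \<inter> {s. 0 \<le> s \<and> E s})"
proof -
  have "{0..t} = {0..s} \<union> {s<..t}" using assms by auto
  then have "{0..t} \<inter> {s. 0 \<le> s \<and> E s} = ({0..s} \<inter> {s. 0 \<le> s \<and> E s}) \<union> ({s<..t} \<inter> {s. 0 \<le> s \<and> E s})"
    by blast
  then show ?thesis
    unfolding path_clock_measure[OF E]
    using fmeasurable_Icc_Int[OF E] by (simp only:) (intro measure_Un_AE[THEN trans]; auto)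
qed

lemma path_clock_mono:
  assumes "{s. 0 \<le> s \<and> E s} \<in> sets borel" "0 \<le> s" "s \<le> t"
  shows "path_clock E s \<le> path_clock E t"
  using path_clock_add[OF assms] by simp

lemma path_clock_0:
  assumes "{s. 0 \<le> s \<and> E s} \<in> sets borel"
  shows "path_clock E 0 = 0"
proof -
  have "path_clock E 0 \<le> measure lborel {0..0::real}"
    unfolding path_clock_measure[OF assms]
    using fmeasurable_Icc_Int[of UNIV 0 0] fmeasurable_Icc_Int(1)[OF assms, of 0 0, THEN fmeasurableD]
    by (intro measure_mono_fmeasurable) auto
  then show ?thesis using path_clock_measure[OF assms, of 0] by (simp add: antisym)
qed

lemma path_clock_const:
  assumes E: "{s. 0 \<le> s \<and> E s} \<in> sets borel" and st: "0 \<le> s" "s \<le> t"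
    and b: "\<And>u. s < u \<Longrightarrow> u < t \<Longrightarrow> E u = b"
  shows "path_clock E t = path_clock E s + of_bool b * (t - s)"
proof -
  have "measure lborel ({s<..t} \<inter> {s. 0 \<le> s \<and> E s}) = measure lborel (if b then {s<..t} else {})"
  proof (rule measure_eq_AE)
    show "AE x in lborel. (x \<in> {s<..t} \<inter> {s. 0 \<le> s \<and> E s}) = (x \<in> (if b then {s<..t} else {}))"
      using AE_lborel_singleton[of t]
    proof eventually_elim
      case (elim x)
      then show ?case using b[of x] st by (cases "s < x \<and> x < t") auto
    qed
  qed (use E in auto)
  then show ?thesis
    using path_clock_add[OF E st] st by (cases b) auto
qed

text \<open>The clock runs at rate at most one and hence cannot jump over a level; this is used to
  locate its right inverse.\<close>

lemma path_clock_le: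
  assumes E: "{s. 0 \<le> s \<and> E s} \<in> sets borel" and st: "0 \<le> s" "s \<le> t"
  shows "path_clock E t \<le> path_clock E s + (t - s)"
proof -
  have "measure lborel ({s<..t} \<inter> {s. 0 \<le> s \<and> E s}) \<le> measure lborel {s<..t}"
    using fmeasurable_Icc_Int[of UNIV s t] fmeasurable_Icc_Int(2)[OF E, of s t, THEN fmeasurableD] by (intro measure_mono_fmeasurable) auto
  then show ?thesis using path_clock_add[OF E st] st by simp
qed

lemma ex_rational_between:
  assumes "t < (u::real)"
  obtains r where "r \<in> \<rat>" "t < r" "r < u"
  using Rats_dense_in_real[OF assms] by blast

subsection \<open>Measurability with respect to the path\<close>

text \<open>A point of the grid of mesh \<open>1 / Suc n\<close> strictly above \<open>s \<ge> 0\<close>, from which right-continuous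
  paths are recovered.\<close>

definition grid :: "nat \<Rightarrow> real \<Rightarrow> real" where
  "grid n s = (real (nat \<lfloor>real (Suc n) * s\<rfloor>) + 1) / real (Suc n)"

definition eventually_on_grid :: "('c \<Rightarrow> real \<Rightarrow> bool) \<Rightarrow> 'c \<Rightarrow> real \<Rightarrow> bool" where
  "eventually_on_grid D x s \<longleftrightarrow> (\<exists>N. \<forall>n\<ge>N. D x (grid n s))"

lemma grid_nonneg: "0 \<le> grid n s"
  by (simp add: grid_def)

lemma grid_bounds:
  assumes "0 \<le> s"
  shows "s < grid n s" "grid n s \<le> s + 1 / real (Suc n)"
proof -
  have "real (nat \<lfloor>real (Suc n) * s\<rfloor>) = of_int \<lfloor>real (Suc n) * s\<rfloor>"
    using assms by (simp add: of_nat_nat)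
  then have "real (Suc n) * s < real (nat \<lfloor>real (Suc n) * s\<rfloor>) + 1"
    "real (nat \<lfloor>real (Suc n) * s\<rfloor>) \<le> real (Suc n) * s"
    by linarith+
  then show "s < grid n s" "grid n s \<le> s + 1 / real (Suc n)"
    by (simp_all add: grid_def field_simps del: of_nat_Suc)
qed

text \<open>The grid points lie strictly to the right of \<open>s\<close> and converge to it, so
  they eventually fall into the interval on which \<open>E\<close> keeps its value.\<close>

lemma eventually_on_grid_right_constant:
  assumes E: "right_constant E" and D: "\<And>q. 0 \<le> q \<Longrightarrow> D x q = E q" and s: "0 \<le> s"
  shows "eventually_on_grid D x s = E s"
proof -
  obtain e where e: "0 < e" "\<And>u. s \<le> u \<Longrightarrow> u < s + e \<Longrightarrow> E u = E s"
    by (rule right_constantD[OF E s]) blast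
  obtain N where N: "1 / real (Suc N) < e" using nat_approx_posE[OF e(1)] by auto
  have "D x (grid n s) = E s" if "N \<le> n" for n
  proof -
    have "1 / real (Suc n) \<le> 1 / real (Suc N)" using that by (simp add: frac_le)
    then have "grid n s < s + e" using grid_bounds(2)[OF s, of n] N by linarith
    then have "E (grid n s) = E s" using grid_bounds(1)[OF s, of n] by (intro e(2)) auto
    then show ?thesis using D[OF grid_nonneg] by simp
  qed
  then show ?thesis unfolding eventually_on_grid_def by (metis nle_le)
qed

text \<open>Measurability in the path is given for each fixed time only. Grid points take countably
  many values, which yields joint measurability in path and time, as required for integrating over
  time.\<close>

lemma measurable_eventually_on_grid:
  assumes D: "\<And>q. 0 \<le> q \<Longrightarrow> Measurable.pred N (\<lambda>x. D x q)"
  shows "Measurable.pred (N \<Otimes>\<^sub>M borel) (\<lambda>(x, s). eventually_on_grid D x s)"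
proof -
  have "Measurable.pred (N \<Otimes>\<^sub>M borel) (\<lambda>y. D (fst y) (grid n (snd y)))" for n
    unfolding grid_def
  proof (rule measurable_compose_countable[where g="\<lambda>y. nat \<lfloor>real (Suc n) * snd y\<rfloor>"
      and f="\<lambda>k y. D (fst y) ((real k + 1) / real (Suc n))"])
    show "Measurable.pred (N \<Otimes>\<^sub>M borel) (\<lambda>y. D (fst y) ((real k + 1) / real (Suc n)))" for k :: nat
      by (rule measurable_compose[OF measurable_fst D]) simp
  qed measurable
  then have [measurable]: "Measurable.pred (N \<Otimes>\<^sub>M borel) (\<lambda>y. D (fst y) (grid n (snd y)))" for n .
  show ?thesis unfolding eventually_on_grid_def case_prod_beta by measurable
qed

lemma measurable_path_clock_grid:
  assumes "\<And>q. 0 \<le> q \<Longrightarrow> Measurable.pred N (\<lambda>x. D x q)"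
  shows "(\<lambda>x. path_clock (eventually_on_grid D x) t) \<in> borel_measurable N"
proof -
  have [measurable]: "Measurable.pred (N \<Otimes>\<^sub>M borel) (\<lambda>(x, s). eventually_on_grid D x s)"
    by (rule measurable_eventually_on_grid) fact
  show ?thesis
    unfolding path_clock_def set_lebesgue_integral_def
    by (intro lborel.borel_measurable_lebesgue_integral) measurable
qed

lemma sets_eventually_on_grid:
  assumes D: "\<And>q. 0 \<le> q \<Longrightarrow> Measurable.pred N (\<lambda>x. D x q)" and x: "x \<in> space N"
  shows "{s. 0 \<le> s \<and> eventually_on_grid D x s} \<in> sets borel"
proof -
  have [measurable]: "Measurable.pred (N \<Otimes>\<^sub>M borel) (\<lambda>(x, s). eventually_on_grid D x s)"
    by (rule measurable_eventually_on_grid) fact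
  have "Measurable.pred borel (\<lambda>s. eventually_on_grid D x s)"
    using measurable_compose[OF measurable_Pair1'[OF x] \<open>Measurable.pred (N \<Otimes>\<^sub>M borel) _\<close>] by simp
  then have [measurable]: "Measurable.pred borel (\<lambda>s. eventually_on_grid D x s)" .
  have "{s\<in>space borel. 0 \<le> s \<and> eventually_on_grid D x s} \<in> sets borel" by measurable
  then show ?thesis by simp
qed

abbreviation path_space :: "(real \<Rightarrow> real) measure" where
  "path_space \<equiv> \<Pi>\<^sub>M t\<in>{0..}. borel"

text \<open>Here and in the next definition countably many coordinates of the path decide the
  condition, as for every event of the product space; for right-constant paths the conditions over
  all real times are recovered.\<close>

definition at_min_rat :: "(real \<Rightarrow> real) \<Rightarrow> real \<Rightarrow> bool" where
  "at_min_rat x q \<longleftrightarrow> (\<forall>u\<in>\<rat> \<inter> {0..q}. x q \<le> x u)"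

definition at_new_max_rat :: "(real \<Rightarrow> real) \<Rightarrow> real \<Rightarrow> bool" where
  "at_new_max_rat x q \<longleftrightarrow> (\<forall>u\<in>\<rat> \<inter> {0..q}. \<forall>v\<in>\<rat> \<inter> {u..q}. x u \<le> x q \<and> (x u = x q \<longrightarrow> x v = x q))"

lemma countable_Rats_Int: "countable (\<rat> \<inter> A :: real set)"
  using countable_rat by (rule countable_subset[rotated]) auto

lemma pred_path_space_component:
  "0 \<le> t \<Longrightarrow> (\<lambda>x. x t) \<in> borel_measurable path_space"
  by (rule measurable_component_singleton) simp

lemma pred_Ball_countable:
  assumes "countable A" "\<And>i. i \<in> A \<Longrightarrow> Measurable.pred N (\<lambda>x. R i x)"
  shows "Measurable.pred N (\<lambda>x. \<forall>i\<in>A. R i x)" "Measurable.pred N (\<lambda>x. \<exists>i\<in>A. R i x)"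
  using assms unfolding pred_def
  by (auto intro!: sets.sets_Collect_countable_Ball sets.sets_Collect_countable_Bex)

lemma pred_compare_borel:
  fixes f g :: "'a \<Rightarrow> real"
  assumes [measurable]: "f \<in> borel_measurable N" "g \<in> borel_measurable N"
  shows "Measurable.pred N (\<lambda>x. f x \<le> g x)" "Measurable.pred N (\<lambda>x. f x < g x)" "Measurable.pred N (\<lambda>x. f x = g x)"
  by measurable

lemma pred_at_min_rat: "0 \<le> q \<Longrightarrow> Measurable.pred path_space (\<lambda>x. at_min_rat x q)"
  unfolding at_min_rat_def
  by (intro pred_Ball_countable countable_Rats_Int pred_compare_borel pred_path_space_component) auto

lemma pred_at_new_max_rat: "0 \<le> q \<Longrightarrow> Measurable.pred path_space (\<lambda>x. at_new_max_rat x q)"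
  unfolding at_new_max_rat_def
  by (intro pred_Ball_countable countable_Rats_Int pred_intros_logic pred_compare_borel pred_path_space_component) auto

text \<open>A time \<open>u < q\<close> can be moved slightly to the right to a rational without
  changing the path value; at \<open>u = q\<close> there is no room, so \<open>q\<close> itself must
  be allowed.\<close>

lemma right_constant_rational:
  assumes f: "right_constant f" and u: "0 \<le> u" "u \<le> q"
  obtains r where "r \<in> \<rat> \<or> r = q" "u \<le> r" "r \<le> q" "f r = f u" "\<And>v. u \<le> v \<Longrightarrow> v \<le> r \<Longrightarrow> f v = f u"
proof (cases "u = q")
  case True
  show ?thesis
  proof (rule that[of q])
    fix v assume "u \<le> v" "v \<le> q"
    then have "v = u" using True by simp
    then show "f v = f u" by simp
  qed (use True in simp_all)
next
  case False
  obtain e where e: "0 < e" "\<And>v. u \<le> v \<Longrightarrow> v < u + e \<Longrightarrow> f v = f u"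
    by (rule right_constantD[OF f u(1)]) blast
  obtain r where r: "r \<in> \<rat>" "u < r" "r < min q (u + e)"
    by (rule ex_rational_between[of u "min q (u + e)"]) (use e(1) False u in auto)
  show ?thesis
  proof (rule that[of r])
    show "f r = f u" using r by (intro e(2)) auto
    fix v assume "u \<le> v" "v \<le> r"
    then show "f v = f u" using r by (intro e(2)) auto
  qed (use r in auto)
qed

lemma at_min_rat_iff:
  assumes f: "right_constant f" and q: "0 \<le> q"
  shows "at_min_rat (\<lambda>t\<in>{0..}. f t) q \<longleftrightarrow> at_min f q"
proof
  assume *: "at_min_rat (\<lambda>t\<in>{0..}. f t) q"
  show "at_min f q"
    unfolding at_min_def
  proof (intro allI impI)
    fix u assume u: "0 \<le> u" "u \<le> q"
    obtain r where "r \<in> \<rat> \<or> r = q" "u \<le> r" "r \<le> q" "f r = f u"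
      by (rule right_constant_rational[OF f u]) blast
    then show "f q \<le> f u"
      using *[unfolded at_min_rat_def, rule_format, of r] u q by auto
  qed
qed (use q in \<open>auto simp: at_min_rat_def at_min_def\<close>)

lemma at_new_max_rat_iff:
  assumes f: "right_constant f" and q: "0 \<le> q"
  shows "at_new_max_rat (\<lambda>t\<in>{0..}. f t) q \<longleftrightarrow> at_new_max f q"
proof
  assume *: "at_new_max_rat (\<lambda>t\<in>{0..}. f t) q"
  have rat: "f r \<le> f q \<and> (f r = f q \<longrightarrow> f w = f q)"
    if "r \<in> \<rat>" "0 \<le> r" "r \<le> w" "w \<le> q" "w \<in> \<rat>" for r w
    using *[unfolded at_new_max_rat_def, rule_format, of r w] that q by auto
  show "at_new_max f q"
    unfolding at_new_max_def
  proof (intro allI impI)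
    fix u v assume uv: "0 \<le> u" "u \<le> v" "v \<le> q"
    have uq: "u \<le> q" using uv by simp
    obtain r where r: "r \<in> \<rat> \<or> r = q" "u \<le> r" "r \<le> q" "f r = f u" "\<And>v. u \<le> v \<Longrightarrow> v \<le> r \<Longrightarrow> f v = f u"
      by (rule right_constant_rational[OF f uv(1) uq]) blast
    have le: "f u \<le> f q"
      using r(1-4) rat[of r r] uv by (cases "r = q") auto
    \<comment> \<open>If \<open>v\<close> does not exceed the substitute \<open>r\<close> for
      \<open>u\<close>, the path has not moved yet; otherwise \<open>v\<close> gets a substitute
      \<open>w\<close> of its own, and the order of the two is preserved.\<close>
    moreover have "f v = f q" if fu: "f u = f q"
    proof (cases "v \<le> r")
      case True
      then show ?thesis using r(5)[of v] uv fu by simp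
    next
      case False
      have "0 \<le> v" using uv by simp
      obtain w where w: "w \<in> \<rat> \<or> w = q" "v \<le> w" "w \<le> q" "f w = f v"
        by (rule right_constant_rational[OF f \<open>0 \<le> v\<close> uv(3)]) blast
      have "r \<in> \<rat>" using r(1) False uv by auto
      then show ?thesis
        using rat[of r w] w r(2-4) uv fu False by (cases "w = q") auto
    qed
    ultimately show "f u \<le> f q \<and> (f u = f q \<longrightarrow> f v = f q)" by blast
  qed
next
  assume *: "at_new_max f q"
  show "at_new_max_rat (\<lambda>t\<in>{0..}. f t) q"
    unfolding at_new_max_rat_def
  proof (intro ballI)
    fix u v assume "u \<in> \<rat> \<inter> {0..q}" "v \<in> \<rat> \<inter> {u..q}"
    then show "(\<lambda>t\<in>{0..}. f t) u \<le> (\<lambda>t\<in>{0..}. f t) q \<and>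
        ((\<lambda>t\<in>{0..}. f t) u = (\<lambda>t\<in>{0..}. f t) q \<longrightarrow> (\<lambda>t\<in>{0..}. f t) v = (\<lambda>t\<in>{0..}. f t) q)"
      using *[unfolded at_new_max_def, rule_format, of u v] q by auto
  qed
qed

lemma path_clock_grid:
  assumes E: "right_constant E" and D: "\<And>q. 0 \<le> q \<Longrightarrow> D x q = E q"
  shows "path_clock (eventually_on_grid D x) t = path_clock E t"
    and "{s. 0 \<le> s \<and> eventually_on_grid D x s} = {s. 0 \<le> s \<and> E s}"
proof -
  have eq: "eventually_on_grid D x s = E s" if "0 \<le> s" for s
    by (rule eventually_on_grid_right_constant[where D=D and x=x, OF E D that])
  show "path_clock (eventually_on_grid D x) t = path_clock E t"
    unfolding path_clock_def
  proof (rule set_lebesgue_integral_cong)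
    show "\<forall>s. s \<in> {0..t} \<longrightarrow> of_bool (eventually_on_grid D x s) = (of_bool (E s) :: real)"
      using eq by simp
  qed simp
  show "{s. 0 \<le> s \<and> eventually_on_grid D x s} = {s. 0 \<le> s \<and> E s}"
    using eq by blast
qed

lemma restrict_in_path_space: "(\<lambda>t\<in>{0..}. f t) \<in> space path_space"
  by (simp add: space_PiM)

text \<open>A single path is regarded as a point of the path space; the section at this point of a
  jointly measurable set is a Borel set of times.\<close>

lemma right_constant_sets:
  assumes "right_constant f"
  shows "{s. 0 \<le> s \<and> at_min f s} \<in> sets borel" "{s. 0 \<le> s \<and> at_new_max f s} \<in> sets borel"
  using sets_eventually_on_grid[where D=at_min_rat, OF pred_at_min_rat restrict_in_path_space[of f]]
    path_clock_grid(2)[where D=at_min_rat and x="\<lambda>t\<in>{0..}. f t", OF at_min_right_constant[OF assms] at_min_rat_iff[OF assms]]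
    sets_eventually_on_grid[where D=at_new_max_rat, OF pred_at_new_max_rat restrict_in_path_space[of f]]
    path_clock_grid(2)[where D=at_new_max_rat and x="\<lambda>t\<in>{0..}. f t", OF at_new_max_right_constant[OF assms] at_new_max_rat_iff[OF assms]]
  by simp_all

text \<open>For lattice paths this is finiteness of the ascending ladder height at \<open>a\<close>.
  Rational times suffice since the clock is monotone.\<close>

definition new_max_event :: "real \<Rightarrow> (real \<Rightarrow> real) set" where
  "new_max_event a = {x\<in>space path_space. \<exists>t\<in>\<rat> \<inter> {0..}. a < path_clock (eventually_on_grid at_new_max_rat x) t}"

text \<open>The clock at the minimum passes \<open>a\<close> before the path falls below
  \<open>- b\<close>. For lattice paths, with \<open>a\<close> the local time level divided by the
  normalising constant, the descending ladder height is then at most \<open>b\<close>.\<close>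

definition min_event :: "real \<Rightarrow> real \<Rightarrow> (real \<Rightarrow> real) set" where
  "min_event a b = {x\<in>space path_space. \<exists>t\<in>\<rat> \<inter> {0..}.
     a < path_clock (eventually_on_grid at_min_rat x) t \<and> (\<forall>u\<in>\<rat> \<inter> {0..t}. - b \<le> x u)}"

lemma sets_new_max_event: "new_max_event a \<in> sets path_space"
  unfolding new_max_event_def
  by (intro predE pred_Ball_countable countable_Rats_Int pred_compare_borel
      measurable_path_clock_grid pred_at_new_max_rat measurable_const) auto

lemma sets_min_event: "min_event a b \<in> sets path_space"
  unfolding min_event_def
  by (intro predE pred_Ball_countable countable_Rats_Int pred_compare_borel
      pred_intros_logic measurable_path_clock_grid pred_at_min_rat measurable_const pred_path_space_component) auto


lemma new_max_event_iff:
  assumes f: "right_constant f"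
  shows "(\<lambda>t\<in>{0..}. f t) \<in> new_max_event a \<longleftrightarrow> (\<exists>t\<ge>0. a < path_clock (at_new_max f) t)"
proof -
  have eq: "path_clock (eventually_on_grid at_new_max_rat (\<lambda>t\<in>{0..}. f t)) t = path_clock (at_new_max f) t" for t
    by (rule path_clock_grid(1)[where D=at_new_max_rat and x="\<lambda>t\<in>{0..}. f t", OF at_new_max_right_constant[OF f] at_new_max_rat_iff[OF f]])
  show ?thesis
  proof
    assume "\<exists>t\<ge>0. a < path_clock (at_new_max f) t"
    then obtain t where t: "0 \<le> t" "a < path_clock (at_new_max f) t" by blast
    obtain r where r: "r \<in> \<rat>" "t < r" "r < t + 1" by (rule ex_rational_between[of t "t + 1"]) auto
    then have "path_clock (at_new_max f) t \<le> path_clock (at_new_max f) r"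
      using t by (intro path_clock_mono right_constant_sets[OF f]) auto
    then show "(\<lambda>t\<in>{0..}. f t) \<in> new_max_event a"
      unfolding new_max_event_def mem_Collect_eq eq using restrict_in_path_space[of f] r t
      by (intro conjI bexI[of _ r]) auto
  qed (auto simp: new_max_event_def eq)
qed

lemma min_event_iff:
  assumes f: "right_constant f"
  shows "(\<lambda>t\<in>{0..}. f t) \<in> min_event a b
    \<longleftrightarrow> (\<exists>t\<ge>0. a < path_clock (at_min f) t \<and> (\<forall>u. 0 \<le> u \<longrightarrow> u \<le> t \<longrightarrow> - b \<le> f u))"
proof -
  have eq: "path_clock (eventually_on_grid at_min_rat (\<lambda>t\<in>{0..}. f t)) t = path_clock (at_min f) t" for t
    by (rule path_clock_grid(1)[where D=at_min_rat and x="\<lambda>t\<in>{0..}. f t", OF at_min_right_constant[OF f] at_min_rat_iff[OF f]])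
  show ?thesis
  proof
    assume "(\<lambda>t\<in>{0..}. f t) \<in> min_event a b"
    then obtain t where t: "t \<in> \<rat>" "0 \<le> t" "a < path_clock (at_min f) t"
      and b: "\<forall>u\<in>\<rat> \<inter> {0..t}. - b \<le> (\<lambda>t\<in>{0..}. f t) u"
      by (auto simp: min_event_def eq)
    have "- b \<le> f u" if u: "0 \<le> u" "u \<le> t" for u
    proof -
      obtain r where r: "r \<in> \<rat> \<or> r = t" "u \<le> r" "r \<le> t" "f r = f u"
        by (rule right_constant_rational[OF f u]) blast
      then have "- b \<le> f r" using b t u by (auto dest!: bspec[of _ _ r])
      then show ?thesis using r by simp
    qed
    then show "\<exists>t\<ge>0. a < path_clock (at_min f) t \<and> (\<forall>u. 0 \<le> u \<longrightarrow> u \<le> t \<longrightarrow> - b \<le> f u)"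
      using t by blast
  next
    assume "\<exists>t\<ge>0. a < path_clock (at_min f) t \<and> (\<forall>u. 0 \<le> u \<longrightarrow> u \<le> t \<longrightarrow> - b \<le> f u)"
    then obtain t where t: "0 \<le> t" "a < path_clock (at_min f) t" and b: "\<And>u. 0 \<le> u \<Longrightarrow> u \<le> t \<Longrightarrow> - b \<le> f u"
      by blast
    obtain e where e: "0 < e" "\<And>u. t \<le> u \<Longrightarrow> u < t + e \<Longrightarrow> f u = f t"
      by (rule right_constantD[OF f t(1)]) blast
    obtain r where r: "r \<in> \<rat>" "t < r" "r < t + e" by (rule ex_rational_between[of t "t + e"]) (use e in auto)
    have "path_clock (at_min f) t \<le> path_clock (at_min f) r"
      using t r by (intro path_clock_mono right_constant_sets[OF f]) auto
    moreover have "- b \<le> f u" if "0 \<le> u" "u \<le> r" for u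
      using b[of u] b[of t] e(2)[of u] that r t by (cases "u \<le> t") auto
    ultimately show "(\<lambda>t\<in>{0..}. f t) \<in> min_event a b"
      unfolding min_event_def mem_Collect_eq eq using restrict_in_path_space[of f] r t
      by (intro conjI bexI[of _ r]) auto
  qed
qed

section \<open>Ladder heights as path events\<close>

lemma right_inverse_less_infinity:
  "right_inverse A t < \<infinity> \<longleftrightarrow> (\<exists>s\<ge>0. t < A s)"
  unfolding right_inverse_def INF_less_iff by auto

lemma strict_ascending_ladder_height_less_infinity:
  assumes "0 < h" "lattice_path h f"
  shows "strict_ascending_ladder_height f a < \<infinity> \<longleftrightarrow> (\<lambda>t\<in>{0..}. f t) \<in> new_max_event a"
proof -
  have "strict_ascending_ladder_height f a < \<infinity> \<longleftrightarrow> right_inverse (local_time_new_max f) a < \<infinity>"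
    by (simp add: strict_ascending_ladder_height_def Let_def)
  then show ?thesis
    unfolding new_max_event_iff[OF lattice_path_right_constant[OF assms]] right_inverse_less_infinity
      local_time_new_max_eq[OF assms] .
qed

lemma descending_ladder_height_finite:
  assumes h: "0 < h" and f: "lattice_path h f" and c: "0 < c" and fin: "descending_ladder_height c f a < \<infinity>"
  obtains \<tau> where "0 \<le> \<tau>" "descending_ladder_height c f a = ereal (- f \<tau>)" "at_min f \<tau>"
    "\<And>t. \<tau> < t \<Longrightarrow> a / c < path_clock (at_min f) t"
    "\<And>t. 0 \<le> t \<Longrightarrow> a / c < path_clock (at_min f) t \<Longrightarrow> \<tau> \<le> t"
proof -
  have rc: "right_constant f" using lattice_path_right_constant[OF h f] .
  note sets = right_constant_sets(1)[OF rc]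
  let ?A = "path_clock (at_min f)"
  define S where "S = {s. 0 \<le> s \<and> a / c < ?A s}"
  have S_eq: "{s. 0 \<le> s \<and> a < local_time_min c f s} = S"
    using c by (simp add: S_def local_time_min_eq[OF h f] pos_divide_less_eq mult.commute)
  have inf: "right_inverse (local_time_min c f) a = (INF s\<in>S. ereal s)"
    by (simp add: right_inverse_def S_eq)
  have "S \<noteq> {}"
    using fin inf by (auto simp: descending_ladder_height_def Let_def top_ereal_def split: if_splits)
  have bdd: "bdd_below S" by (auto simp: S_def)
  define \<tau> where "\<tau> = Inf S"
  have tau: "right_inverse (local_time_min c f) a = ereal \<tau>"
    unfolding inf \<tau>_def using bdd \<open>S \<noteq> {}\<close> by (rule ereal_Inf'[symmetric])
  have "0 \<le> \<tau>" unfolding \<tau>_def using \<open>S \<noteq> {}\<close> by (intro cInf_greatest) (auto simp: S_def)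
  have after: "a / c < ?A t" if t: "\<tau> < t" for t
  proof -
    obtain s where "s \<in> S" "s < t" using cInf_lessD[OF \<open>S \<noteq> {}\<close>, of t] t by (auto simp: \<tau>_def)
    then have "a / c < ?A s" "?A s \<le> ?A t"
      using path_clock_mono[OF sets, of s t] by (auto simp: S_def)
    then show ?thesis by linarith
  qed
  have before: "\<tau> \<le> t" if "0 \<le> t" "a / c < ?A t" for t
    unfolding \<tau>_def using that bdd by (intro cInf_lower) (auto simp: S_def)
  \<comment> \<open>At a positive \<open>\<tau>\<close> the clock cannot already exceed the level:
    running at rate at most one, it would have exceeded it a little earlier.\<close>
  have at_tau: "\<tau> = 0 \<or> ?A \<tau> \<le> a / c"
  proof (rule disjCI)
    assume not: "\<not> ?A \<tau> \<le> a / c"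
    show "\<tau> = 0"
    proof (rule ccontr)
      assume "\<tau> \<noteq> 0"
      then have pos: "0 < \<tau>" using \<open>0 \<le> \<tau>\<close> by simp
      define d where "d = min \<tau> ((?A \<tau> - a / c) / 2)"
      have d: "0 < d" "d \<le> \<tau>" "d \<le> (?A \<tau> - a / c) / 2"
        using pos not unfolding d_def by (simp, simp_all only: min.cobounded1 min.cobounded2)
      have "?A \<tau> \<le> ?A (\<tau> - d) + d"
        using path_clock_le[OF sets, of "\<tau> - d" \<tau>] d by simp
      then have "a / c < ?A (\<tau> - d)" using d not by (simp add: not_le)
      then have "\<tau> \<le> \<tau> - d" using d by (intro before) auto
      then show False using d by simp
    qed
  qed
  \<comment> \<open>Away from the minimum the clock would pause just after \<open>\<tau>\<close>,
    whereas it exceeds the level at every later time.\<close>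
  have "at_min f \<tau>"
  proof (cases "\<tau> = 0")
    case True
    then show ?thesis by (simp add: at_min_def)
  next
    case False
    show ?thesis
    proof (rule ccontr)
      assume not: "\<not> at_min f \<tau>"
      obtain e where e: "0 < e" "\<And>u. \<tau> \<le> u \<Longrightarrow> u < \<tau> + e \<Longrightarrow> at_min f u = at_min f \<tau>"
        by (rule right_constantD[OF at_min_right_constant[OF rc] \<open>0 \<le> \<tau>\<close>]) blast
      have "?A (\<tau> + e / 2) = ?A \<tau> + of_bool False * (\<tau> + e / 2 - \<tau>)"
        using e not \<open>0 \<le> \<tau>\<close> by (intro path_clock_const[OF sets]) auto
      then show False using after[of "\<tau> + e / 2"] at_tau False e(1) by simp
    qed
  qed
  moreover have "descending_ladder_height c f a = ereal (- f \<tau>)"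
    by (simp add: descending_ladder_height_def Let_def tau)
  ultimately show thesis
    using that[of \<tau>] \<open>0 \<le> \<tau>\<close> after before by blast
qed

text \<open>The clock is guaranteed to exceed the level only strictly after \<open>\<tau>\<close>,
  so one looks slightly further; right-constancy keeps the path at its value at
  \<open>\<tau>\<close> meanwhile.\<close>

lemma descending_ladder_height_le:
  assumes h: "0 < h" and f: "lattice_path h f" and c: "0 < c"
  shows "descending_ladder_height c f a \<le> ereal b \<longleftrightarrow> (\<lambda>t\<in>{0..}. f t) \<in> min_event (a / c) b"
proof -
  have rc: "right_constant f" using lattice_path_right_constant[OF h f] .
  let ?A = "path_clock (at_min f)"
  show ?thesis
    unfolding min_event_iff[OF rc]
  proof
    assume le: "descending_ladder_height c f a \<le> ereal b"
    then have "descending_ladder_height c f a < \<infinity>" by (rule le_less_trans) simp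
    then obtain \<tau> where tau: "0 \<le> \<tau>" "descending_ladder_height c f a = ereal (- f \<tau>)" "at_min f \<tau>"
      "\<And>t. \<tau> < t \<Longrightarrow> a / c < ?A t"
      by (rule descending_ladder_height_finite[OF h f c]) blast
    obtain e where e: "0 < e" "\<And>u. \<tau> \<le> u \<Longrightarrow> u < \<tau> + e \<Longrightarrow> f u = f \<tau>"
      by (rule right_constantD[OF rc tau(1)]) blast
    have "- b \<le> f u" if "0 \<le> u" "u \<le> \<tau> + e / 2" for u
    proof (cases "u \<le> \<tau>")
      case True
      then have "f \<tau> \<le> f u" using tau(3) that unfolding at_min_def by blast
      then show ?thesis using le tau(2) by simp
    next
      case False
      then have "f u = f \<tau>" using that e by (intro e(2)) auto
      then show ?thesis using le tau(2) by simp
    qed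
    then show "\<exists>t\<ge>0. a / c < ?A t \<and> (\<forall>u. 0 \<le> u \<longrightarrow> u \<le> t \<longrightarrow> - b \<le> f u)"
      using tau(4)[of "\<tau> + e / 2"] tau(1) e(1) by (intro exI[of _ "\<tau> + e / 2"]) auto
  next
    assume "\<exists>t\<ge>0. a / c < ?A t \<and> (\<forall>u. 0 \<le> u \<longrightarrow> u \<le> t \<longrightarrow> - b \<le> f u)"
    then obtain t where t: "0 \<le> t" "a / c < ?A t" and b: "\<And>u. 0 \<le> u \<Longrightarrow> u \<le> t \<Longrightarrow> - b \<le> f u" by blast
    have "a < local_time_min c f t"
      using t(2) c by (simp add: local_time_min_eq[OF h f] pos_divide_less_eq mult.commute)
    then have "right_inverse (local_time_min c f) a < \<infinity>"
      unfolding right_inverse_less_infinity using t(1) by blast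
    then have "descending_ladder_height c f a < \<infinity>"
      by (simp add: descending_ladder_height_def Let_def)
    then obtain \<tau> where tau: "0 \<le> \<tau>" "descending_ladder_height c f a = ereal (- f \<tau>)"
      "\<And>t. 0 \<le> t \<Longrightarrow> a / c < ?A t \<Longrightarrow> \<tau> \<le> t"
      by (rule descending_ladder_height_finite[OF h f c]) blast
    have "- b \<le> f \<tau>" using tau(1) tau(3)[OF t] by (intro b) auto
    then show "descending_ladder_height c f a \<le> ereal b" using tau(2) by simp
  qed
qed

lemma descending_ladder_height_lattice:
  assumes h: "0 < h" and f: "lattice_path h f" and c: "0 < c" and f0: "f 0 = 0"
    and fin: "descending_ladder_height c f a < \<infinity>"
  obtains k :: nat where "descending_ladder_height c f a = ereal (real k * h)"
proof -
  obtain \<tau> where tau: "0 \<le> \<tau>" "descending_ladder_height c f a = ereal (- f \<tau>)" "at_min f \<tau>"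
    by (rule descending_ladder_height_finite[OF h f c fin]) blast
  obtain k :: int where k: "f \<tau> = h * of_int k" using f tau(1) by (auto simp: lattice_path_def)
  have "f \<tau> \<le> f 0" using tau(1,3) unfolding at_min_def by blast
  then have "h * of_int k \<le> 0" using k f0 by simp
  then have "k \<le> 0" using h by (simp add: mult_le_0_iff)
  then have "- f \<tau> = real (nat (- k)) * h" using k by simp
  then show thesis using tau(2) by (intro that[of "nat (- k)"]) simp
qed

text \<open>Since the ladder heights lie in the lattice, equality is a difference of two half-line events.\<close>

definition height_event :: "real \<Rightarrow> real \<Rightarrow> nat \<Rightarrow> (real \<Rightarrow> real) set" where
  "height_event h a k = min_event a (real k * h) - min_event a ((real k - 1) * h)"

lemma sets_height_event: "height_event h a k \<in> sets path_space"
  unfolding height_event_def by (intro sets.Diff sets_min_event)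

lemma descending_ladder_height_eq:
  assumes h: "0 < h" and f: "lattice_path h f" and c: "0 < c" and f0: "f 0 = 0"
  shows "descending_ladder_height c f a = ereal (real k * h) \<longleftrightarrow> (\<lambda>t\<in>{0..}. f t) \<in> height_event h (a / c) k"
proof -
  let ?H = "descending_ladder_height c f a"
  have "(\<lambda>t\<in>{0..}. f t) \<in> height_event h (a / c) k \<longleftrightarrow> ?H \<le> ereal (real k * h) \<and> \<not> ?H \<le> ereal ((real k - 1) * h)"
    by (simp add: height_event_def descending_ladder_height_le[OF h f c])
  also have "\<dots> \<longleftrightarrow> ?H = ereal (real k * h)"
  proof
    assume *: "?H \<le> ereal (real k * h) \<and> \<not> ?H \<le> ereal ((real k - 1) * h)"
    then have "?H < \<infinity>" by (auto intro: le_less_trans)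
    then obtain j :: nat where j: "?H = ereal (real j * h)"
      by (rule descending_ladder_height_lattice[OF h f c f0])
    have "real j \<le> real k" "real k - 1 < real j" using * h by (auto simp: j not_le)
    then have "j = k" by linarith
    then show "?H = ereal (real k * h)" using j by simp
  qed (use h in simp)
  finally show ?thesis ..
qed

text \<open>A set that differs from an event by a null set is an event of the completion. Ladder
  sets are of this kind, since almost every path is a lattice path.\<close>

lemma completion_AE_eq:
  assumes "AE x in M. x \<in> S \<longleftrightarrow> x \<in> T" "T \<in> sets M" "S \<subseteq> space M"
  shows "S \<in> sets (completion M)" "emeasure (completion M) S = emeasure M T"
proof -
  have "Measurable.pred (completion M) (\<lambda>x. x \<in> S - T)" "Measurable.pred (completion M) (\<lambda>x. x \<in> T - S)"
    by (rule sets_completion_AE, use assms(1) in eventually_elim, blast)+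
  moreover have "{x\<in>space M. x \<in> S - T} = S - T" "{x\<in>space M. x \<in> T - S} = T - S"
    using assms sets.sets_into_space by blast+
  ultimately have "S - T \<in> sets (completion M)" "T - S \<in> sets (completion M)"
    by (simp_all add: pred_def)
  moreover have "S = (T - (T - S)) \<union> (S - T)" by blast
  ultimately show S: "S \<in> sets (completion M)"
    using assms(2) by (metis sets.Diff sets.Un sets_completionI_sets)
  have "emeasure (completion M) S = emeasure (completion M) T"
    by (rule emeasure_eq_AE) (use assms S in \<open>auto simp: AE_completion_iff\<close>)
  then show "emeasure (completion M) S = emeasure M T" using assms(2) by simp
qed

lemma completion_borel_measurable_AE:
  fixes F g :: "'a \<Rightarrow> real"
  assumes "AE x in M. F x = g x" and [measurable]: "g \<in> borel_measurable M"
  shows "F \<in> borel_measurable (completion M)"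
proof (rule measurableI)
  fix B :: "real set" assume [measurable]: "B \<in> sets borel"
  have "F -` B \<inter> space M \<in> sets (completion M)"
    by (rule completion_AE_eq(1)[where T="g -` B \<inter> space M"]) (use assms(1) in \<open>auto elim!: eventually_mono\<close>)
  then show "F -` B \<inter> space (completion M) \<in> sets (completion M)" by simp
qed simp

section \<open>Ladder epochs of the compound Poisson chain\<close>

lemma lattice_path_chain: "lattice_path h (\<lambda>t. chain h t s)"
proof -
  have "\<exists>k::int. chain h t s = h * of_int k" for t
    by (cases "good_stream s") (auto simp: chain_def intro: exI[of _ 0])
  then show ?thesis by (simp add: lattice_path_def cadlag_chain)
qed

lemma chain_in_epoch:
  "good_stream s \<Longrightarrow> in_epoch n t s \<Longrightarrow> 0 \<le> t \<Longrightarrow> chain h t s = h * of_int (sum_list (jumps n s))"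
  by (simp add: chain_def walk_eq_on_epoch)

lemma arrival_mono: "good_stream s \<Longrightarrow> k \<le> n \<Longrightarrow> arrival k s \<le> arrival n s"
  using strict_mono_less_eq[OF arrival_strict_mono[of s]] by (simp add: good_stream_def)

lemma arrival_nonneg: "good_stream s \<Longrightarrow> 0 \<le> arrival n s"
  using arrival_mono[of s 0 n] by simp

lemma in_epoch_arrival: "good_stream s \<Longrightarrow> in_epoch n (arrival n s) s"
  by (simp add: in_epoch_def clock_Suc good_stream_def del: snth.simps)

lemma in_epoch_le:
  assumes "good_stream s" "in_epoch n t s" "in_epoch k u s" "u \<le> t"
  shows "k \<le> n"
proof (rule ccontr)
  assume "\<not> k \<le> n"
  then have "arrival (Suc n) s \<le> arrival k s" using assms(1) by (intro arrival_mono) auto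
  then show False using assms(2-4) by (simp add: in_epoch_def)
qed

lemma take_jumps: "k \<le> n \<Longrightarrow> take k (jumps n s) = jumps k s"
  by (simp add: jumps_def take_map take_stake min_absorb1 del: stake.simps)

text \<open>Every value up to time \<open>t\<close> is taken at the arrival of an epoch up to the
  current one, so conditions on real times become conditions on prefixes of the jump word.\<close>

lemma all_chain_values:
  assumes s: "good_stream s" and t: "in_epoch n t s" "0 \<le> t"
  shows "(\<forall>u. 0 \<le> u \<longrightarrow> u \<le> t \<longrightarrow> R (chain h u s)) \<longleftrightarrow> (\<forall>k\<le>n. R (h * of_int (sum_list (jumps k s))))"
proof
  assume *: "\<forall>u. 0 \<le> u \<longrightarrow> u \<le> t \<longrightarrow> R (chain h u s)"
  show "\<forall>k\<le>n. R (h * of_int (sum_list (jumps k s)))"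
  proof (intro allI impI)
    fix k assume "k \<le> n"
    then have "arrival k s \<le> t" using arrival_mono[OF s] t(1) by (force simp: in_epoch_def)
    then have "R (chain h (arrival k s) s)" using * arrival_nonneg[OF s] by blast
    then show "R (h * of_int (sum_list (jumps k s)))"
      using chain_in_epoch[OF s in_epoch_arrival[OF s] arrival_nonneg[OF s]] by simp
  qed
next
  assume *: "\<forall>k\<le>n. R (h * of_int (sum_list (jumps k s)))"
  show "\<forall>u. 0 \<le> u \<longrightarrow> u \<le> t \<longrightarrow> R (chain h u s)"
  proof (intro allI impI)
    fix u assume u: "0 \<le> u" "u \<le> t"
    then have k: "in_epoch (epoch u s) u s" by (intro in_epoch_epoch s)
    then have "epoch u s \<le> n" using in_epoch_le[OF s t(1)] u by blast
    then show "R (chain h u s)" using * chain_in_epoch[OF s k u(1)] by simp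
  qed
qed

lemma at_min_chain:
  assumes "0 < h" and s: "good_stream s" and t: "in_epoch n t s" "0 \<le> t"
  shows "at_min (\<lambda>t. chain h t s) t \<longleftrightarrow> desc (jumps n s)"
proof -
  have "at_min (\<lambda>t. chain h t s) t \<longleftrightarrow> (\<forall>k\<le>n. chain h t s \<le> h * of_int (sum_list (jumps k s)))"
    unfolding at_min_def by (rule all_chain_values[OF s t])
  also have "\<dots> \<longleftrightarrow> (\<forall>k\<le>n. sum_list (jumps n s) \<le> sum_list (jumps k s))"
    unfolding chain_in_epoch[OF s t] using \<open>0 < h\<close> by (simp only: mult_le_cancel_left_pos of_int_le_iff)
  finally show ?thesis by (simp add: desc_def take_jumps)
qed

text \<open>Since jumps do not vanish, a maximum at the level of an earlier epoch is not a new one.\<close>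

lemma at_new_max_chain:
  assumes h: "0 < h" and s: "good_stream s" and nz: "\<And>i. snd (s !! i) \<noteq> 0" and t: "in_epoch n t s" "0 \<le> t"
  shows "at_new_max (\<lambda>t. chain h t s) t \<longleftrightarrow> asc (jumps n s)"
proof -
  have val: "chain h (arrival k s) s = h * of_int (sum_list (jumps k s))" for k
    using chain_in_epoch[OF s in_epoch_arrival[OF s] arrival_nonneg[OF s]] .
  have asc: "asc (jumps n s) \<longleftrightarrow> (\<forall>k<n. sum_list (jumps k s) < sum_list (jumps n s))"
    by (simp add: asc_def take_jumps)
  show ?thesis
  proof
    assume nm: "at_new_max (\<lambda>t. chain h t s) t"
    show "asc (jumps n s)"
      unfolding asc
    proof (intro allI impI)
      fix k assume k: "k < n"
      then obtain m where m: "n = Suc m" by (cases n) auto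
      have "arrival k s \<le> arrival m s" "arrival m s \<le> arrival n s" "arrival n s \<le> t"
        using k m t(1) arrival_mono[OF s] by (auto simp: in_epoch_def)
      then have *: "chain h (arrival k s) s \<le> chain h t s"
        "chain h (arrival k s) s = chain h t s \<Longrightarrow> chain h (arrival m s) s = chain h t s"
        using nm[unfolded at_new_max_def, rule_format, of "arrival k s" "arrival m s"] arrival_nonneg[OF s] by auto
      have "sum_list (jumps n s) = sum_list (jumps m s) + snd (s !! m)"
        by (simp add: m jumps_Suc del: snth.simps)
      then have "chain h (arrival m s) s \<noteq> chain h t s"
        using nz[of m] h by (simp add: val chain_in_epoch[OF s t])
      then show "sum_list (jumps k s) < sum_list (jumps n s)"
        using * h by (auto simp: val chain_in_epoch[OF s t] order_le_less)
    qed
  next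
    assume L: "asc (jumps n s)"
    show "at_new_max (\<lambda>t. chain h t s) t"
      unfolding at_new_max_def
    proof (intro allI impI)
      fix u v assume uv: "0 \<le> u" "u \<le> v" "v \<le> t"
      have u: "in_epoch (epoch u s) u s" and v: "in_epoch (epoch v s) v s" and "0 \<le> v"
        using uv by (auto intro!: in_epoch_epoch s)
      have le: "epoch u s \<le> epoch v s" "epoch v s \<le> n"
        using in_epoch_le[OF s v u] in_epoch_le[OF s t(1) v] uv by auto
      show "chain h u s \<le> chain h t s \<and> (chain h u s = chain h t s \<longrightarrow> chain h v s = chain h t s)"
      proof (cases "epoch u s = n")
        case True
        then have "epoch v s = n" using le by simp
        then show ?thesis
          using chain_in_epoch[OF s u uv(1)] chain_in_epoch[OF s v \<open>0 \<le> v\<close>] chain_in_epoch[OF s t] True by simp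
      next
        case False
        then have "sum_list (jumps (epoch u s) s) < sum_list (jumps n s)" using L le unfolding asc by simp
        then show ?thesis
          using chain_in_epoch[OF s u uv(1)] chain_in_epoch[OF s t] h by simp
      qed
    qed
  qed
qed

section \<open>Level crossings of marked clocks\<close>

definition crossing :: "(nat \<Rightarrow> bool) \<Rightarrow> nat \<Rightarrow> real \<Rightarrow> (real \<times> int) stream \<Rightarrow> bool" where
  "crossing m n a s \<longleftrightarrow> clock m n s \<le> a \<and> a < clock m (Suc n) s"

lemma clock_mono: "good_stream s \<Longrightarrow> k \<le> n \<Longrightarrow> clock m k s \<le> clock m n s"
  by (rule lift_Suc_mono_le[where f="\<lambda>n. clock m n s"])
    (simp_all add: clock_Suc good_stream_def less_imp_le del: snth.simps)

lemma crossing_unique: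
  assumes "good_stream s" "crossing m n a s" "crossing m k a s"
  shows "n = k"
  using assms clock_mono[OF assms(1), of "Suc n" k m] clock_mono[OF assms(1), of "Suc k" n m]
  unfolding crossing_def by (metis linorder_neqE_nat not_less order.strict_trans1 Suc_leI)

lemma crossing_marked: "crossing m n a s \<Longrightarrow> m n"
  by (cases "m n") (auto simp: crossing_def clock_Suc)

text \<open>Lets marks that depend on the stream be replaced by those of a fixed word, so that the
  set of marked epochs is deterministic.\<close>

lemma crossing_cong:
  assumes "\<And>i. i \<le> n \<Longrightarrow> m i = m' i"
  shows "crossing m n a s = crossing m' n a s"
proof -
  have "clock m k s = clock m' k s" if "k \<le> Suc n" for k
    unfolding clock_def using that assms by (intro sum.cong) auto
  then show ?thesis by (simp add: crossing_def)
qed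

lemma ex_crossing:
  assumes "0 \<le> a" "a < clock m (Suc k) s"
  obtains n where "n \<le> k" "crossing m n a s"
proof -
  define n where "n = (LEAST n. a < clock m (Suc n) s)"
  have "a < clock m (Suc n) s" "n \<le> k"
    unfolding n_def using assms(2) by (auto intro: LeastI Least_le)
  moreover have "clock m n s \<le> a"
  proof (cases n)
    case (Suc i)
    then show ?thesis using not_less_Least[of i "\<lambda>n. a < clock m (Suc n) s"] by (simp add: n_def not_less)
  qed (use assms(1) in simp)
  ultimately show thesis by (intro that[of n]) (auto simp: crossing_def)
qed

text \<open>Within an epoch the clock runs at rate one or stands still, according to the mark. The
  offset \<open>d\<close> may reach the full holding time, so the value at the next arrival is
  covered, which drives the induction.\<close>

lemma path_clock_epoch:
  assumes s: "good_stream s" and E: "{t. 0 \<le> t \<and> E t} \<in> sets borel"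
    and mk: "\<And>n t. in_epoch n t s \<Longrightarrow> 0 \<le> t \<Longrightarrow> E t = m n"
    and d: "0 \<le> d" "d \<le> fst (s !! n)"
  shows "path_clock E (arrival n s + d) = clock m n s + of_bool (m n) * d"
  using d
proof (induction n arbitrary: d)
  case 0
  have "path_clock E (0 + d) = path_clock E 0 + of_bool (m 0) * (0 + d - 0)"
    using 0 by (intro path_clock_const[OF E]) (auto intro!: mk simp: in_epoch_def clock_Suc)
  then show ?case using path_clock_0[OF E] by simp
next
  case (Suc n)
  have pos: "0 < fst (s !! n)" using s by (simp add: good_stream_def)
  have eq: "arrival (Suc n) s = arrival n s + fst (s !! n)" by (simp add: clock_Suc)
  have "path_clock E (arrival (Suc n) s + d) = path_clock E (arrival (Suc n) s) + of_bool (m (Suc n)) * (arrival (Suc n) s + d - arrival (Suc n) s)"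
  proof (intro path_clock_const[OF E] mk)
    show "0 \<le> arrival (Suc n) s" by (rule arrival_nonneg[OF s])
    fix u assume u: "arrival (Suc n) s < u" "u < arrival (Suc n) s + d"
    then show "in_epoch (Suc n) u s" using Suc.prems by (simp add: in_epoch_def clock_Suc[of _ "Suc n"] del: snth.simps)
    show "0 \<le> u" using u arrival_nonneg[OF s, of "Suc n"] by linarith
  qed (use Suc.prems in simp)
  moreover have "path_clock E (arrival (Suc n) s) = clock m (Suc n) s"
    unfolding eq using Suc.IH[of "fst (s !! n)"] pos by (simp add: clock_Suc)
  ultimately show ?case by simp
qed

text \<open>Passage in continuous time is read off at the epoch in which the clock crosses
  \<open>a\<close>. By the last assumption the condition \<open>r\<close> at a marked epoch covers
  all earlier ones, as a lower bound does at a minimum.\<close>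

lemma ex_path_clock_iff:
  assumes s: "good_stream s" and E: "{t. 0 \<le> t \<and> E t} \<in> sets borel"
    and mk: "\<And>n t. in_epoch n t s \<Longrightarrow> 0 \<le> t \<Longrightarrow> E t = m n" and a: "0 \<le> a"
    and R: "\<And>n t. in_epoch n t s \<Longrightarrow> 0 \<le> t \<Longrightarrow> R t \<longleftrightarrow> (\<forall>k\<le>n. r k)"
    and r: "\<And>n. m n \<Longrightarrow> r n \<Longrightarrow> (\<forall>k\<le>n. r k)"
  shows "(\<exists>t\<ge>0. a < path_clock E t \<and> R t) \<longleftrightarrow> (\<exists>n. crossing m n a s \<and> r n)"
proof
  assume "\<exists>t\<ge>0. a < path_clock E t \<and> R t"
  then obtain t where t: "0 \<le> t" "a < path_clock E t" "R t" by blast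
  define k where "k = epoch t s"
  have k: "in_epoch k t s" unfolding k_def by (rule in_epoch_epoch[OF s t(1)])
  have "path_clock E t \<le> path_clock E (arrival k s + fst (s !! k))"
    using k t(1) by (intro path_clock_mono[OF E]) (auto simp: in_epoch_def clock_Suc)
  also have "\<dots> = clock m (Suc k) s"
    using path_clock_epoch[where m=m and d="fst (s !! k)" and n=k, OF s E mk] s by (simp add: clock_Suc good_stream_def less_imp_le del: snth.simps)
  finally have "a < clock m (Suc k) s" using t(2) by simp
  then obtain n where n: "n \<le> k" "crossing m n a s" by (rule ex_crossing[OF a])
  moreover have "r n" using R[OF k t(1)] t(3) n(1) by blast
  ultimately show "\<exists>n. crossing m n a s \<and> r n" by blast
next
  assume "\<exists>n. crossing m n a s \<and> r n"
  then obtain n where n: "crossing m n a s" "r n" by blast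
  have m: "m n" using n(1) by (rule crossing_marked)
  \<comment> \<open>The midpoint between the remaining distance to the level and the holding time:
    long enough to exceed \<open>a\<close>, short enough to stay in the epoch.\<close>
  define d where "d = (a - clock m n s + fst (s !! n)) / 2"
  have d: "0 \<le> d" "d < fst (s !! n)" "a < clock m n s + d"
    using n(1) m by (auto simp: crossing_def clock_Suc d_def field_simps simp del: snth.simps)
  have t: "0 \<le> arrival n s + d" "in_epoch n (arrival n s + d) s"
    using d arrival_nonneg[OF s, of n] by (auto simp: in_epoch_def clock_Suc)
  have "a < path_clock E (arrival n s + d)"
    using path_clock_epoch[where m=m and d=d and n=n, OF s E mk] d m by simp
  moreover have "R (arrival n s + d)"
    using R[OF t(2,1)] r[OF m n(2)] by simp
  ultimately show "\<exists>t\<ge>0. a < path_clock E t \<and> R t" using t(1) by blast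
qed

lemma chain_new_max_event_iff:
  assumes h: "0 < h" and s: "good_stream s" and nz: "\<And>i. snd (s !! i) \<noteq> 0" and a: "0 \<le> a"
  shows "(\<lambda>t\<in>{0..}. chain h t s) \<in> new_max_event a
    \<longleftrightarrow> (\<exists>n. crossing (\<lambda>i. asc (jumps i s)) n a s)"
proof -
  have rc: "right_constant (\<lambda>t. chain h t s)" by (rule lattice_path_right_constant[OF h lattice_path_chain])
  show ?thesis
    unfolding new_max_event_iff[OF rc]
    using ex_path_clock_iff[OF s right_constant_sets(2)[OF rc] at_new_max_chain[OF h s nz] a, where R="\<lambda>_. True" and r="\<lambda>_. True"]
    by simp
qed

lemma chain_min_event_iff:
  assumes h: "0 < h" and s: "good_stream s" and a: "0 \<le> a"
  shows "(\<lambda>t\<in>{0..}. chain h t s) \<in> min_event a b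
    \<longleftrightarrow> (\<exists>n. crossing (\<lambda>i. desc (jumps i s)) n a s \<and> - b \<le> h * of_int (sum_list (jumps n s)))"
proof -
  have rc: "right_constant (\<lambda>t. chain h t s)" by (rule lattice_path_right_constant[OF h lattice_path_chain])
  show ?thesis
    unfolding min_event_iff[OF rc]
  proof (rule ex_path_clock_iff[OF s right_constant_sets(1)[OF rc] at_min_chain[OF h s] a])
    fix n t assume "in_epoch n t s" "0 \<le> t"
    then show "(\<forall>u. 0 \<le> u \<longrightarrow> u \<le> t \<longrightarrow> - b \<le> chain h u s) \<longleftrightarrow> (\<forall>k\<le>n. - b \<le> h * of_int (sum_list (jumps k s)))"
      by (rule all_chain_values[OF s])
  next
    fix n assume d: "desc (jumps n s)" and b: "- b \<le> h * of_int (sum_list (jumps n s))"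
    show "\<forall>k\<le>n. - b \<le> h * of_int (sum_list (jumps k s))"
    proof (intro allI impI)
      fix k assume "k \<le> n"
      then have "sum_list (jumps n s) \<le> sum_list (jumps k s)"
        using d by (simp add: desc_def take_jumps)
      then have "h * of_int (sum_list (jumps n s)) \<le> h * of_int (sum_list (jumps k s))"
        using h by simp
      then show "- b \<le> h * of_int (sum_list (jumps k s))" using b by linarith
    qed
  qed
qed

lemma chain_height_event_iff:
  assumes h: "0 < h" and s: "good_stream s" and a: "0 \<le> a"
  shows "(\<lambda>t\<in>{0..}. chain h t s) \<in> height_event h a k
    \<longleftrightarrow> (\<exists>n. crossing (\<lambda>i. desc (jumps i s)) n a s \<and> sum_list (jumps n s) = - int k)"
proof -
  have *: "- (real k * h) \<le> h * of_int j \<longleftrightarrow> - int k \<le> j" "- ((real k - 1) * h) \<le> h * of_int j \<longleftrightarrow> - int k < j" for j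
  proof -
    have "- (real k * h) \<le> h * of_int j \<longleftrightarrow> h * of_int (- int k) \<le> h * of_int j" by (simp add: mult.commute)
    then show "- (real k * h) \<le> h * of_int j \<longleftrightarrow> - int k \<le> j"
      using h by (simp only: mult_le_cancel_left_pos of_int_le_iff)
    have "- ((real k - 1) * h) \<le> h * of_int j \<longleftrightarrow> h * of_int (1 - int k) \<le> h * of_int j" by (simp add: algebra_simps)
    also have "\<dots> \<longleftrightarrow> - int k < j"
      using h by (simp only: mult_le_cancel_left_pos of_int_le_iff) linarith
    finally show "- ((real k - 1) * h) \<le> h * of_int j \<longleftrightarrow> - int k < j" .
  qed
  show ?thesis
    unfolding height_event_def Diff_iff chain_min_event_iff[OF h s a] *
    using crossing_unique[OF s] by (smt (verit))
qed

lemma prod_list_map_powi: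
  assumes z: "0 < z"
  shows "prod_list (map (\<lambda>j. c j * ennreal (z powi (- j))) w) = prod_list (map c w) * ennreal (z powi (- sum_list w))"
proof (induction w)
  case (Cons j w)
  have "z powi (- j) * z powi (- sum_list w) = z powi (- (j + sum_list w))"
    using z by (simp add: power_int_add[symmetric])
  then show ?case using Cons z by (simp add: ac_simps ennreal_mult[symmetric])
qed simp

text \<open>The generating function of the Poisson distribution; it turns powers of a one-level
  weight into an exponential.\<close>

lemma suminf_power_poisson_weight:
  assumes "0 \<le> y" "0 \<le> x"
  shows "(\<Sum>i. ennreal y ^ i * ennreal (poisson_weight i x)) = ennreal (exp (- (x * (1 - y))))"
proof -
  have "(\<lambda>i. exp (- x) * ((y * x) ^ i /\<^sub>R fact i)) sums (exp (- x) * exp (y * x))"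
    by (intro sums_mult exp_converges)
  moreover have "exp (- x) * ((y * x) ^ i /\<^sub>R fact i) = y ^ i * poisson_weight i x" for i
    using assms by (simp add: poisson_weight_def power_mult_distrib field_simps)
  moreover have "exp (- x) * exp (y * x) = exp (- (x * (1 - y)))"
    by (simp add: exp_add[symmetric] algebra_simps)
  ultimately have "(\<lambda>i. y ^ i * poisson_weight i x) sums exp (- (x * (1 - y)))" by simp
  moreover have "0 \<le> y ^ i * poisson_weight i x" for i
    using assms by (simp add: poisson_weight_def)
  ultimately have "(\<Sum>i. ennreal (y ^ i * poisson_weight i x)) = ennreal (exp (- (x * (1 - y))))"
    by (simp add: suminf_ennreal_eq sums_iff)
  moreover have "ennreal (y ^ i * poisson_weight i x) = ennreal y ^ i * ennreal (poisson_weight i x)" for i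
    using assms(1) by (simp add: ennreal_mult' ennreal_power)
  ultimately show ?thesis by simp
qed

context jump_chain
begin

lemma pred_crossing [measurable]: "Measurable.pred jump_stream (crossing m n a)"
  unfolding crossing_def by measurable

text \<open>The marks are functions of the jumps. Splitting by the word read up to the crossing
  fixes them, and almost surely at most one word can occur.\<close>

lemma emeasure_ex_crossing:
  assumes mk: "regenerative mk"
  shows "emeasure Q {s. \<exists>n. crossing (\<lambda>i. mk (jumps i s)) n a s \<and> G (jumps n s)}
    = (\<integral>\<^sup>+w. prod_list (map (\<lambda>j. ennreal (pmf P j)) w) * ennreal (poisson_weight (regenerative.cnt mk w) (lam * a))
        * indicator {w. mk w} w * of_bool (G w) \<partial>count_space UNIV)"
proof -
  interpret regenerative mk by fact
  define D where "D w = {s. jumps (length w) s = w \<and> crossing (\<lambda>i. mk (take i w)) (length w) a s}" for w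
  have D: "D w \<in> sets Q" for w
    unfolding D_def by (rule sets_jump_stream_law_Collect) measurable
  have iff: "s \<in> D w \<longleftrightarrow> jumps (length w) s = w \<and> crossing (\<lambda>i. mk (jumps i s)) (length w) a s" for s w
  proof -
    have "crossing (\<lambda>i. mk (take i w)) (length w) a s = crossing (\<lambda>i. mk (jumps i s)) (length w) a s"
      if "jumps (length w) s = w"
      by (rule crossing_cong) (metis take_jumps that)
    then show ?thesis by (auto simp: D_def)
  qed
  have set_eq: "{s. \<exists>n. crossing (\<lambda>i. mk (jumps i s)) n a s \<and> G (jumps n s)} = (\<Union>w\<in>{w. G w}. D w)"
  proof (intro set_eqI iffI)
    fix s assume "s \<in> {s. \<exists>n. crossing (\<lambda>i. mk (jumps i s)) n a s \<and> G (jumps n s)}"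
    then obtain n where "crossing (\<lambda>i. mk (jumps i s)) n a s" "G (jumps n s)" by blast
    then have "jumps n s \<in> {w. G w}" "s \<in> D (jumps n s)" by (simp_all add: iff)
    then show "s \<in> (\<Union>w\<in>{w. G w}. D w)" by blast
  next
    fix s assume "s \<in> (\<Union>w\<in>{w. G w}. D w)"
    then obtain w where w: "G w" "s \<in> D w" by blast
    then have "jumps (length w) s = w" "crossing (\<lambda>i. mk (jumps i s)) (length w) a s" using iff by auto
    then show "s \<in> {s. \<exists>n. crossing (\<lambda>i. mk (jumps i s)) n a s \<and> G (jumps n s)}" using w(1) by auto
  qed
  then have "{s. \<exists>n. crossing (\<lambda>i. mk (jumps i s)) n a s \<and> G (jumps n s)} \<in> sets Q"
    using D by (simp add: sets.countable_UN')
  then have "emeasure Q {s. \<exists>n. crossing (\<lambda>i. mk (jumps i s)) n a s \<and> G (jumps n s)}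
      = (\<integral>\<^sup>+s. indicator {s. \<exists>n. crossing (\<lambda>i. mk (jumps i s)) n a s \<and> G (jumps n s)} s \<partial>Q)"
    by simp
  also have "\<dots> = (\<integral>\<^sup>+s. \<integral>\<^sup>+w. of_bool (G w) * indicator (D w) s \<partial>count_space UNIV \<partial>Q)"
  proof (intro nn_integral_cong_AE, use AE_good_stream in eventually_elim)
    case (elim s)
    have "indicator {s. \<exists>n. crossing (\<lambda>i. mk (jumps i s)) n a s \<and> G (jumps n s)} s = (of_bool (\<exists>w\<in>UNIV. G w \<and> s \<in> D w) :: ennreal)"
      unfolding set_eq by (auto simp: indicator_def)
    also have "\<dots> = (\<integral>\<^sup>+w. of_bool (G w \<and> s \<in> D w) \<partial>count_space UNIV)"
      by (rule of_bool_Bex_eq_nn_integral) (use iff crossing_unique[OF elim] in metis)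
    also have "\<dots> = (\<integral>\<^sup>+w. of_bool (G w) * indicator (D w) s \<partial>count_space UNIV)"
      by (intro nn_integral_cong) (auto simp: indicator_def)
    finally show ?case .
  qed
  also have "\<dots> = (\<integral>\<^sup>+w. \<integral>\<^sup>+s. of_bool (G w) * indicator (D w) s \<partial>Q \<partial>count_space UNIV)"
    using D by (intro nn_integral_count_space_nn_integral) auto
  also have "\<dots> = (\<integral>\<^sup>+w. prod_list (map (\<lambda>j. ennreal (pmf P j)) w) * ennreal (poisson_weight (cnt w) (lam * a))
        * indicator {w. mk w} w * of_bool (G w) \<partial>count_space UNIV)"
  proof (intro nn_integral_cong)
    fix w
    have "emeasure Q (D w) = prod_list (map (\<lambda>j. ennreal (pmf P j)) w) * ennreal (poisson_weight (cnt w) (lam * a)) * indicator {w. mk w} w"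
    proof (cases "mk w")
      case True
      then show ?thesis
        using emeasure_clock_crossing[of "\<lambda>i. mk (take i w)" w a] by (simp add: D_def crossing_def cnt_def)
    next
      case False
      then have "D w = {}" using crossing_marked unfolding D_def by fastforce
      then show ?thesis using False by simp
    qed
    moreover have "(\<integral>\<^sup>+s. of_bool (G w) * indicator (D w) s \<partial>Q) = of_bool (G w) * emeasure Q (D w)"
      using D by (rule nn_integral_cmult_indicator)
    ultimately show "(\<integral>\<^sup>+s. of_bool (G w) * indicator (D w) s \<partial>Q)
        = prod_list (map (\<lambda>j. ennreal (pmf P j)) w) * ennreal (poisson_weight (cnt w) (lam * a))
        * indicator {w. mk w} w * of_bool (G w)"
      by (simp add: mult.commute)
  qed
  finally show ?thesis .
qed

end

section \<open>The passage probability and the largest root\<close>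

locale skip_free_chain = jump_chain +
  fixes h :: real
  assumes h_pos: "0 < h" and P_0: "pmf P 0 = 0" and P_1: "0 < pmf P 1"
    and P_skip_free: "\<And>j. 1 < j \<Longrightarrow> pmf P j = 0"
begin

sublocale W: skip_free_weights "\<lambda>j. ennreal (pmf P j)"
  by unfold_locales (simp add: P_skip_free)

text \<open>The probability that the walk ever reaches level \<open>1\<close>.\<close>

definition p :: real where
  "p = enn2real W.rho"

text \<open>The constant 1 solves the fixed-point equation, since the weights sum to 1.\<close>

lemma rho_le_1: "W.rho \<le> 1"
  by (rule W.rho_least) (simp add: nn_integral_pmf measure_pmf.emeasure_space_1[simplified])

lemma rho_eq: "W.rho = ennreal p"
  unfolding p_def using rho_le_1 by (intro ennreal_enn2real[symmetric]) (simp add: le_less_trans)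

lemma p_le_1: "p \<le> 1"
  unfolding p_def using enn2real_mono[OF rho_le_1] by simp

lemma p_pos: "0 < p"
proof -
  have "ennreal (pmf P 1) \<le> W.rho"
    using nn_integral_ge_point[of "1::int" UNIV "\<lambda>j. ennreal (pmf P j) * W.rho ^ nat (1 - j)"] W.rho_fixed_point
    by simp
  moreover have "0 \<le> p" by (simp add: p_def)
  ultimately have "pmf P 1 \<le> p" unfolding rho_eq by simp
  then show ?thesis using P_1 by linarith
qed

lemma P_support: "j \<in> set_pmf P \<Longrightarrow> j \<le> 1"
  using P_skip_free[of j] by (force simp: set_pmf_iff)

text \<open>For \<open>0 < s \<le> 1\<close> and steps at most 1 one has
  \<open>s powi (- j) \<le> 1 / s\<close>, whence integrability. Pulling out one factor
  \<open>s\<close> turns the fixed-point equation into an expectation being equal to 1.\<close>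

lemma nn_integral_powi:
  assumes s: "0 < s" "s \<le> 1"
  shows "(\<integral>\<^sup>+j. ennreal (pmf P j) * ennreal s ^ nat (1 - j) \<partial>count_space UNIV)
      = ennreal (s * (\<integral>j. s powi (- j) \<partial>measure_pmf P))"
    and "integrable (measure_pmf P) (\<lambda>j. s powi (- j))"
proof -
  have bound: "s powi (- j) \<le> 1 / s" if "j \<in> set_pmf P" for j
  proof -
    have "s powi (- j) * s = s powi (1 - j)" using s by (simp add: power_int_diff power_int_minus field_simps)
    also have "\<dots> = s ^ nat (1 - j)" using P_support[OF that] by (simp add: power_int_def)
    also have "\<dots> \<le> 1" using s by (intro power_le_one) auto
    finally show ?thesis using s by (simp add: field_simps)
  qed
  show int: "integrable (measure_pmf P) (\<lambda>j. s powi (- j))"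
    by (rule measure_pmf.integrable_const_bound[where B="1 / s"]) (use s bound in \<open>auto simp: AE_measure_pmf_iff\<close>)
  have "(\<integral>\<^sup>+j. ennreal (pmf P j) * ennreal s ^ nat (1 - j) \<partial>count_space UNIV)
      = (\<integral>\<^sup>+j. ennreal s ^ nat (1 - j) \<partial>measure_pmf P)"
    by (rule nn_integral_measure_pmf[symmetric])
  also have "\<dots> = (\<integral>\<^sup>+j. ennreal (s * s powi (- j)) \<partial>measure_pmf P)"
  proof (intro nn_integral_cong_AE, unfold AE_measure_pmf_iff, intro ballI)
    fix j assume "j \<in> set_pmf P"
    then have "s * s powi (- j) = s ^ nat (1 - j)"
      using s P_support power_int_add[of s 1 "- j"] by (simp add: power_int_def[of s "1 - j"])
    then show "ennreal s ^ nat (1 - j) = ennreal (s * s powi (- j))" using s by (simp add: ennreal_power)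
  qed
  also have "\<dots> = ennreal (\<integral>j. s * s powi (- j) \<partial>measure_pmf P)"
    using s int by (intro nn_integral_eq_integral) auto
  finally show "(\<integral>\<^sup>+j. ennreal (pmf P j) * ennreal s ^ nat (1 - j) \<partial>count_space UNIV)
      = ennreal (s * (\<integral>j. s powi (- j) \<partial>measure_pmf P))" by simp
qed

lemma integral_powi_nonneg: "0 < (s :: real) \<Longrightarrow> 0 \<le> (\<integral>j. s powi (- j) \<partial>measure_pmf P)"
  by (intro Bochner_Integration.integral_nonneg) simp

lemma p_root: "(\<integral>j. p powi (- j) \<partial>measure_pmf P) = 1"
proof -
  have "ennreal p = ennreal (p * (\<integral>j. p powi (- j) \<partial>measure_pmf P))"
    using W.rho_fixed_point nn_integral_powi(1)[OF p_pos p_le_1] by (simp add: rho_eq)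
  then have "p = p * (\<integral>j. p powi (- j) \<partial>measure_pmf P)"
    using p_pos integral_powi_nonneg[OF p_pos] by (subst (asm) ennreal_inj) auto
  then show ?thesis using p_pos by simp
qed

lemma p_least:
  assumes "0 < s" "s \<le> 1" "(\<integral>j. s powi (- j) \<partial>measure_pmf P) = 1"
  shows "p \<le> s"
proof -
  have "W.rho \<le> ennreal s"
    using nn_integral_powi(1)[OF assms(1,2)] assms(3) by (intro W.rho_least) simp
  then show ?thesis using assms(1) by (simp add: rho_eq)
qed

lemma exp_powi: "exp (\<beta> * (h * of_int j)) = exp (- \<beta> * h) powi (- j)"
proof -
  have "exp (- \<beta> * h) powi (- j) = exp (of_int (- j) * (- \<beta> * h))"
    by (rule exp_power_int)
  then show ?thesis by (simp add: ac_simps)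
qed

lemma levy_laplace_exponent_jump_measure:
  assumes "0 \<le> \<beta>"
  shows "levy_laplace_exponent (jump_measure h lam P) \<beta> = lam * ((\<integral>j. exp (- \<beta> * h) powi (- j) \<partial>measure_pmf P) - 1)"
proof -
  have s: "exp (- \<beta> * h) \<le> 1" using assms h_pos by simp
  have "levy_laplace_exponent (jump_measure h lam P) \<beta> = lam * (\<integral>j. exp (- \<beta> * h) powi (- j) - 1 \<partial>measure_pmf P)"
    unfolding levy_laplace_exponent_def using lam_pos
    by (subst integral_jump_measure) (simp_all only: exp_powi real_scaleR_def, simp_all)
  also have "(\<integral>j. exp (- \<beta> * h) powi (- j) - 1 \<partial>measure_pmf P) = (\<integral>j. exp (- \<beta> * h) powi (- j) \<partial>measure_pmf P) - 1"
    using nn_integral_powi(2)[OF _ s] by (subst Bochner_Integration.integral_diff) auto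
  finally show ?thesis .
qed

text \<open>The decreasing substitution \<open>s = exp (- \<beta> * h)\<close> carries the
  non-negative roots of the Laplace exponent to solutions of the fixed-point equation in
  \<open>(0, 1]\<close>, so the least solution \<open>p\<close> corresponds to the largest
  root.\<close>

lemma exp_Phi_0: "exp (Phi_0 (jump_measure h lam P) * h) = 1 / p"
proof -
  let ?b = "- ln p / h"
  have "Phi_0 (jump_measure h lam P) = ?b"
    unfolding Phi_0_def
  proof (rule Greatest_equality)
    have "ln p \<le> 0" using p_pos p_le_1 by simp
    then have nn: "0 \<le> ?b" using h_pos by (intro divide_nonneg_pos) auto
    have "exp (- ?b * h) = p" using h_pos p_pos by simp
    then show "0 \<le> ?b \<and> levy_laplace_exponent (jump_measure h lam P) ?b = 0"
      using nn levy_laplace_exponent_jump_measure[OF nn] p_root by simp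
  next
    fix \<beta> assume *: "0 \<le> \<beta> \<and> levy_laplace_exponent (jump_measure h lam P) \<beta> = 0"
    then have "(\<integral>j. exp (- \<beta> * h) powi (- j) \<partial>measure_pmf P) = 1"
      using levy_laplace_exponent_jump_measure[of \<beta>] lam_pos by simp
    then have "p \<le> exp (- \<beta> * h)"
      using * h_pos by (intro p_least) auto
    then have "ln p \<le> ln (exp (- \<beta> * h))"
      using p_pos by (subst ln_le_cancel_iff) auto
    then show "\<beta> \<le> ?b" using h_pos by (simp add: field_simps)
  qed
  then show ?thesis using h_pos p_pos by (simp add: exp_minus field_simps)
qed

lemma AE_nonzero_jumps: "AE s in Q. \<forall>n. snd (s !! n) \<noteq> 0"
proof -
  interpret H: prob_space "holding_jump_law lam P" by (rule prob_space_holding_jump_law)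
  interpret E: prob_space "density lborel (exponential_density lam)"
    by (rule prob_space_exponential_density[OF lam_pos])
  interpret EP: pair_prob_space "density lborel (exponential_density lam)" "measure_pmf P" ..
  have "AE x in holding_jump_law lam P. snd x \<noteq> 0"
    unfolding holding_jump_law_def
    by (intro EP.AE_pair_measure) (auto simp: AE_measure_pmf_iff set_pmf_iff P_0)
  then have "AE s in Q. stream_all (\<lambda>x. snd x \<noteq> 0) s"
    unfolding jump_stream_law_def by (intro H.AE_stream_all) measurable
  then show ?thesis by eventually_elim (simp add: sset_range)
qed

lemma measurable_chain_path: "(\<lambda>s. \<lambda>t\<in>{0..}. chain h t s) \<in> Q \<rightarrow>\<^sub>M path_space"
  by (rule measurable_restrict) measurable

lemma emeasure_chain_law:
  assumes "A \<in> sets path_space" "AE s in Q. (\<lambda>t\<in>{0..}. chain h t s) \<in> A \<longleftrightarrow> s \<in> B"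
    "B \<in> sets Q"
  shows "emeasure (process_law Q (chain h)) A = emeasure Q B"
proof -
  have "emeasure (process_law Q (chain h)) A = emeasure Q ((\<lambda>s. \<lambda>t\<in>{0..}. chain h t s) -` A \<inter> space Q)"
    unfolding process_law_def by (rule emeasure_distr[OF measurable_chain_path assms(1)])
  also have "\<dots> = emeasure Q B"
    using assms measurable_sets[OF measurable_chain_path assms(1)]
    by (intro emeasure_eq_AE) (auto elim!: eventually_mono)
  finally show ?thesis .
qed

lemma sets_ex_crossing:
  "{s. \<exists>n. crossing (\<lambda>i. mk (jumps i s)) n a s \<and> G (jumps n s)} \<in> sets Q"
proof (rule sets_jump_stream_law_Collect)
  have [measurable]: "Measurable.pred jump_stream (\<lambda>s. F (jumps i s))" for F :: "int list \<Rightarrow> bool" and i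
    by measurable
  have [measurable]: "(\<lambda>s. clock (\<lambda>i. mk (jumps i s)) n s) \<in> borel_measurable jump_stream" for n
    unfolding clock_def by measurable
  show "Measurable.pred jump_stream (\<lambda>s. \<exists>n. crossing (\<lambda>i. mk (jumps i s)) n a s \<and> G (jumps n s))"
    unfolding crossing_def by measurable
qed

text \<open>Record level \<open>i\<close> is reached with weight \<open>p ^ i\<close>, so the
  Poisson crossing weights sum to an exponential: epochs at a new maximum end at rate
  \<open>lam\<close>, and the next level is then missed with probability
  \<open>1 - p\<close>.\<close>

lemma new_max_event_law:
  assumes a: "0 \<le> a"
  shows "emeasure (process_law Q (chain h)) (new_max_event a) = ennreal (exp (- (lam * (1 - p) * a)))"
proof -
  have "emeasure (process_law Q (chain h)) (new_max_event a)
      = emeasure Q {s. \<exists>n. crossing (\<lambda>i. asc (jumps i s)) n a s \<and> (\<lambda>_. True) (jumps n s)}"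
    by (rule emeasure_chain_law[OF sets_new_max_event _ sets_ex_crossing], use AE_good_stream AE_nonzero_jumps in eventually_elim)
      (simp add: chain_new_max_event_iff[OF h_pos _ _ a])
  also have "\<dots> = (\<integral>\<^sup>+w. prod_list (map (\<lambda>j. ennreal (pmf P j)) w) * ennreal (poisson_weight (asc.cnt w) (lam * a))
        * indicator {w. asc w} w \<partial>count_space UNIV)"
    by (subst emeasure_ex_crossing[OF asc.regenerative_axioms]) simp
  also have "\<dots> = (\<Sum>i. W.rho ^ i * ennreal (poisson_weight i (lam * a)))"
    unfolding W.rho_def by (rule asc.nn_integral_marked)
  also have "\<dots> = ennreal (exp (- (lam * a * (1 - p))))"
    unfolding rho_eq using p_pos lam_pos a by (intro suminf_power_poisson_weight) auto
  finally show ?thesis by (simp add: ac_simps)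
qed

text \<open>The generating function of the depth by which one excursion lowers the weak minimum;
  excursions that return to the old level have depth 0.\<close>

definition excursion_transform :: "real \<Rightarrow> ennreal" where
  "excursion_transform z = word_sum (\<lambda>j. ennreal (pmf P j) * ennreal (z powi (- j))) (desc.level 1)"

text \<open>Tilting each jump by \<open>z\<close> records the height of the minimum
  multiplicatively, so the generating function over all heights is again a sum over marked
  words.\<close>

lemma height_event_law:
  assumes a: "0 < a" and z: "0 < z"
  shows "(\<Sum>k. ennreal (z ^ k) * emeasure (process_law Q (chain h)) (height_event h a k))
    = (\<Sum>i. excursion_transform z ^ i * ennreal (poisson_weight i (lam * a)))"
proof -
  let ?wt = "\<lambda>w. prod_list (map (\<lambda>j. ennreal (pmf P j)) w) * ennreal (poisson_weight (desc.cnt w) (lam * a)) * indicator {w. desc w} w"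
  have ev: "emeasure (process_law Q (chain h)) (height_event h a k) = (\<integral>\<^sup>+w. ?wt w * of_bool (sum_list w = - int k) \<partial>count_space UNIV)" for k
  proof -
    have "emeasure (process_law Q (chain h)) (height_event h a k)
        = emeasure Q {s. \<exists>n. crossing (\<lambda>i. desc (jumps i s)) n a s \<and> sum_list (jumps n s) = - int k}"
      by (rule emeasure_chain_law[OF sets_height_event _ sets_ex_crossing], use AE_good_stream in eventually_elim)
        (use a in \<open>simp add: chain_height_event_iff[OF h_pos]\<close>)
    then show ?thesis
      by (simp only: emeasure_ex_crossing[OF desc.regenerative_axioms, where G="\<lambda>w. sum_list w = - int k"])
  qed
  have "(\<Sum>k. ennreal (z ^ k) * emeasure (process_law Q (chain h)) (height_event h a k))
      = (\<Sum>k. \<integral>\<^sup>+w. ennreal (z ^ k) * (?wt w * of_bool (sum_list w = - int k)) \<partial>count_space UNIV)"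
    unfolding ev by (simp add: nn_integral_cmult)
  also have "\<dots> = (\<integral>\<^sup>+w. (\<Sum>k. ennreal (z ^ k) * (?wt w * of_bool (sum_list w = - int k))) \<partial>count_space UNIV)"
    by (rule nn_integral_suminf[symmetric]) simp
  also have "\<dots> = (\<integral>\<^sup>+w. prod_list (map (\<lambda>j. ennreal (pmf P j) * ennreal (z powi (- j))) w)
      * ennreal (poisson_weight (desc.cnt w) (lam * a)) * indicator {w. desc w} w \<partial>count_space UNIV)"
  proof (intro nn_integral_cong)
    fix w
    show "(\<Sum>k. ennreal (z ^ k) * (?wt w * of_bool (sum_list w = - int k)))
      = prod_list (map (\<lambda>j. ennreal (pmf P j) * ennreal (z powi (- j))) w) * ennreal (poisson_weight (desc.cnt w) (lam * a)) * indicator {w. desc w} w"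
    proof (cases "desc w")
      case True
      then have le: "sum_list w \<le> 0" by (rule desc_sum_nonpos)
      have "(\<Sum>k. ennreal (z ^ k) * (?wt w * of_bool (sum_list w = - int k)))
          = (\<Sum>k\<in>{nat (- sum_list w)}. ennreal (z ^ k) * (?wt w * of_bool (sum_list w = - int k)))"
        by (rule suminf_finite) auto
      also have "\<dots> = ennreal (z powi (- sum_list w)) * ?wt w"
        using le by (simp add: power_int_def)
      finally show ?thesis unfolding prod_list_map_powi[OF z] by (simp add: ac_simps)
    qed simp
  qed
  also have "\<dots> = (\<Sum>i. excursion_transform z ^ i * ennreal (poisson_weight i (lam * a)))"
    unfolding excursion_transform_def by (rule desc.nn_integral_marked)
  finally show ?thesis .
qed

end

lemma nn_integral_count_space_int_le:
  fixes g :: "int \<Rightarrow> ennreal"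
  assumes "\<And>j. b < j \<Longrightarrow> g j = 0"
  shows "(\<integral>\<^sup>+j. g j \<partial>count_space UNIV) = (\<Sum>i. g (b - int i))"
proof -
  have "(\<integral>\<^sup>+j. g j \<partial>count_space UNIV) = (\<integral>\<^sup>+j. g j \<partial>count_space {..b})"
    by (rule nn_integral_count_space_eq) (use assms in auto)
  also have "\<dots> = (\<integral>\<^sup>+i. g (b - int i) \<partial>count_space UNIV)"
  proof (rule nn_integral_bij_count_space[symmetric])
    have "j \<in> range (\<lambda>i. b - int i)" if "j \<le> b" for j
      using that by (intro image_eqI[of _ _ "nat (b - j)"]) auto
    then show "bij_betw (\<lambda>i. b - int i) UNIV {..b}"
      by (auto simp: bij_betw_def inj_on_def)
  qed
  finally show ?thesis by (simp add: nn_integral_count_space_nat)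
qed

text \<open>The lattice is closed, so membership at rational times passes to all times by
  right-continuity.\<close>

lemma cadlag_lattice_path:
  assumes h: "0 < h" and f: "cadlag f" and q: "\<And>q. q \<in> \<rat> \<Longrightarrow> 0 \<le> q \<Longrightarrow> f q \<in> range (\<lambda>k::int. h * of_int k)"
  shows "lattice_path h f"
  unfolding lattice_path_def
proof (intro conjI f allI impI)
  fix t :: real assume t: "0 \<le> t"
  let ?L = "range (\<lambda>k::int. h * of_int k)"
  have L: "?L = (\<lambda>x. h *\<^sub>R x) ` \<int>" by (auto simp: Ints_def)
  have closed: "closed ?L" unfolding L by (rule closed_scaling[OF closed_Ints])
  have "f t \<in> ?L"
  proof (rule ccontr)
    assume "f t \<notin> ?L"
    then have "open (- ?L)" "f t \<in> - ?L" using closed by auto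
    moreover have "(f \<longlongrightarrow> f t) (at_right t)"
      using f t by (auto simp: cadlag_def continuous_within)
    ultimately have "eventually (\<lambda>u. f u \<in> - ?L) (at_right t)"
      by (intro topological_tendstoD)
    then obtain b where b: "t < b" "\<And>u. t < u \<Longrightarrow> u < b \<Longrightarrow> f u \<notin> ?L"
      unfolding eventually_at_right_field by blast
    obtain r where "r \<in> \<rat>" "t < r" "r < b" by (rule ex_rational_between[OF b(1)])
    then show False using q[of r] b(2)[of r] t by simp
  qed
  then show "\<exists>k::int. f t = h * of_int k" by auto
qed

section \<open>Transfer to an arbitrary chain with the same Levy measure\<close>

context skip_free_chain
begin

abbreviation "\<nu> \<equiv> jump_measure h lam P"

lemma compound_poisson_Q: "compound_poisson Q (chain h) \<nu>"
  using compound_poisson_chain[of Q "\<lambda>s. s" h] prob_space_Q P_0 h_pos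
  by (simp add: distr_id2 sets_jump_stream_law)

context
  fixes M :: "'a measure" and X
  assumes X: "compound_poisson M X \<nu>"
begin

interpretation X: levy_process M X
  using X by (simp add: compound_poisson_def)

text \<open>The one-dimensional laws are those of the walk, hence the values at all rational times
  are simultaneously lattice points with probability 1; path regularity does the rest.\<close>

lemma AE_lattice_path: "AE x in M. lattice_path h (\<lambda>t. X t x) \<and> X 0 x = 0"
proof -
  let ?L = "range (\<lambda>k::int. h * of_int k)"
  have L[measurable]: "?L \<in> sets borel"
  proof (rule sets.countable)
    show "countable ?L" by (intro countable_image) simp
  qed simp
  have "AE x in M. X q x \<in> ?L" if q: "0 \<le> q" for q
  proof -
    note [measurable] = X.measurable_X[OF q]
    have "chain h q s \<in> ?L" for s
      using lattice_path_chain[of h s] q unfolding lattice_path_def by blast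
    then have "AE s in Q. chain h q s \<in> ?L" by (intro AE_I2)
    then have "AE y in distr Q borel (chain h q). y \<in> ?L"
      using L by (subst AE_distr_iff) simp_all
    then have "AE y in distr M borel (X q). y \<in> ?L"
      unfolding compound_poisson_marginal_eq[OF X compound_poisson_Q q] .
    then show ?thesis using L X.measurable_X[OF q] by (subst (asm) AE_distr_iff) simp_all
  qed
  then have "AE x in M. \<forall>q\<in>\<rat> \<inter> {0..}. X q x \<in> ?L"
    by (subst AE_ball_countable) (auto intro: countable_Rats_Int)
  with X.X_0 show ?thesis
    using AE_space
    by eventually_elim (auto intro!: cadlag_lattice_path h_pos X.cadlag_paths)
qed

lemma emeasure_path_event:
  assumes E: "E \<in> sets path_space"
  shows "(\<lambda>x. \<lambda>t\<in>{0..}. X t x) -` E \<inter> space M \<in> sets M"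
    and "emeasure M ((\<lambda>x. \<lambda>t\<in>{0..}. X t x) -` E \<inter> space M) = emeasure (process_law Q (chain h)) E"
proof -
  show "(\<lambda>x. \<lambda>t\<in>{0..}. X t x) -` E \<inter> space M \<in> sets M"
    by (rule measurable_sets[OF X.measurable_path E])
  show "emeasure M ((\<lambda>x. \<lambda>t\<in>{0..}. X t x) -` E \<inter> space M) = emeasure (process_law Q (chain h)) E"
    unfolding compound_poisson_process_law_eq[OF compound_poisson_Q X]
    unfolding process_law_def by (rule emeasure_distr[OF X.measurable_path E, symmetric])
qed

lemma has_killing_rate_ascending:
  "has_killing_rate M (\<lambda>t x. strict_ascending_ladder_height (\<lambda>s. X s x) t) (lam * (1 - p))"
  unfolding has_killing_rate_def
proof (intro allI impI)
  fix t :: real assume t: "0 \<le> t"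
  let ?S = "{x\<in>space M. strict_ascending_ladder_height (\<lambda>s. X s x) t < \<infinity>}"
  let ?T = "(\<lambda>x. \<lambda>t\<in>{0..}. X t x) -` new_max_event t \<inter> space M"
  have "emeasure (completion M) ?S = emeasure M ?T"
  proof (rule completion_AE_eq(2)[OF _ emeasure_path_event(1)[OF sets_new_max_event]])
    show "AE x in M. x \<in> ?S \<longleftrightarrow> x \<in> ?T"
      using AE_lattice_path
    proof eventually_elim
      case (elim x)
      then show ?case
        using strict_ascending_ladder_height_less_infinity[OF h_pos, of "\<lambda>t. X t x" t] by auto
    qed
  qed auto
  also have "\<dots> = ennreal (exp (- (lam * (1 - p) * t)))"
    unfolding emeasure_path_event(2)[OF sets_new_max_event] by (rule new_max_event_law[OF t])
  finally show "measure (completion M) ?S = exp (- (lam * (1 - p)) * t)"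
    by (simp add: measure_def)
qed

lemma killed_laplace_exponent_descending:
  assumes \<beta>: "0 \<le> \<beta>"
  obtains y where "0 \<le> y" "excursion_transform (exp (- \<beta> * h)) = ennreal y"
    "killed_laplace_exponent M (\<lambda>t x. descending_ladder_height (exp (Phi_0 \<nu> * h)) (\<lambda>s. X s x) t) \<beta> = lam * p * (1 - y)"
proof -
  define z where "z = exp (- \<beta> * h)"
  have z: "0 < z" by (simp add: z_def)
  \<comment> \<open>\<open>1 / p\<close> is the normalising constant
    \<open>exp (Phi_0 \<nu> * h)\<close>. Level 1 of the local time is therefore level
    \<open>p\<close> of the clock, hence the \<open>p\<close> in
    \<open>height_event h p k\<close>.\<close>
  let ?H = "\<lambda>x. descending_ladder_height (1 / p) (\<lambda>s. X s x) 1"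
  define F where "F x = exp (- \<beta> * real_of_ereal (?H x)) * of_bool (?H x < \<infinity>)" for x
  define A where "A k = (\<lambda>x. \<lambda>t\<in>{0..}. X t x) -` height_event h p k \<inter> space M" for k
  define G where "G x = (\<Sum>k. ennreal (z ^ k) * indicator (A k) x)" for x
  have [measurable]: "A k \<in> sets M" for k
    unfolding A_def by (rule emeasure_path_event(1)[OF sets_height_event])
  have [measurable]: "G \<in> borel_measurable M" unfolding G_def by measurable
  have FG: "AE x in M. ennreal (F x) = G x"
    using AE_lattice_path AE_space
  proof eventually_elim
    case (elim x)
    have iff: "x \<in> A k \<longleftrightarrow> ?H x = ereal (real k * h)" for k
      using descending_ladder_height_eq[OF h_pos _ _ , of "\<lambda>t. X t x" "1 / p" 1 k] elim p_pos
      by (simp add: A_def)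
    show ?case
    proof (cases "?H x < \<infinity>")
      case True
      obtain k :: nat where k: "?H x = ereal (real k * h)"
        by (rule descending_ladder_height_lattice[OF h_pos _ _ _ True]) (use elim p_pos in auto)
      have "G x = (\<Sum>j\<in>{k}. ennreal (z ^ j) * indicator (A j) x)"
        unfolding G_def by (rule suminf_finite) (use h_pos in \<open>auto simp: indicator_def iff k\<close>)
      also have "\<dots> = ennreal (z ^ k)" by (simp add: iff k)
      also have "z ^ k = F x"
        by (simp add: F_def k z_def exp_of_nat_mult[symmetric] mult.left_commute)
      finally show ?thesis ..
    next
      case False
      then have "x \<notin> A k" for k by (auto simp: iff)
      then show ?thesis using False by (simp add: F_def G_def)
    qed
  qed
  have "AE x in M. F x = enn2real (G x)"
    using FG
  proof eventually_elim
    case (elim x)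
    have "0 \<le> F x" by (simp add: F_def)
    then show ?case using elim by (metis enn2real_ennreal)
  qed
  then have F[measurable]: "F \<in> borel_measurable (completion M)"
    by (rule completion_borel_measurable_AE) measurable
  define y where "y = enn2real (excursion_transform z)"
  have int: "(\<integral>\<^sup>+x. ennreal (F x) \<partial>M) = (\<Sum>i. excursion_transform z ^ i * ennreal (poisson_weight i (lam * p)))"
  proof -
    have "(\<integral>\<^sup>+x. ennreal (F x) \<partial>M) = (\<integral>\<^sup>+x. G x \<partial>M)"
      using FG by (rule nn_integral_cong_AE)
    also have "\<dots> = (\<Sum>k. ennreal (z ^ k) * emeasure M (A k))"
      unfolding G_def by (subst nn_integral_suminf) (auto simp: nn_integral_cmult)
    also have "\<dots> = (\<Sum>k. ennreal (z ^ k) * emeasure (process_law Q (chain h)) (height_event h p k))"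
      unfolding A_def emeasure_path_event(2)[OF sets_height_event] ..
    finally show ?thesis by (simp only: height_event_law[OF p_pos z])
  qed
  \<comment> \<open>The integrand is almost surely at most 1, so each term of the series is; the
    term \<open>i = 1\<close> carries a positive Poisson weight and thus bounds the
    transform.\<close>
  have finite: "excursion_transform z < \<top>"
  proof -
    have F1: "F x \<le> 1" if lp: "lattice_path h (\<lambda>t. X t x) \<and> X 0 x = 0" for x
    proof (cases "?H x < \<infinity>")
      case True
      obtain k :: nat where k: "?H x = ereal (real k * h)"
        by (rule descending_ladder_height_lattice[OF h_pos _ _ _ True]) (use lp p_pos in auto)
      show ?thesis using \<beta> h_pos by (simp add: F_def k)
    qed (simp add: F_def)
    have "excursion_transform z * ennreal (poisson_weight 1 (lam * p)) \<le> (\<Sum>i. excursion_transform z ^ i * ennreal (poisson_weight i (lam * p)))"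
      using sum_le_suminf[of "\<lambda>i. excursion_transform z ^ i * ennreal (poisson_weight i (lam * p))" "{1}"] by simp
    also have "\<dots> \<le> (\<integral>\<^sup>+x. 1 \<partial>M)"
      unfolding int[symmetric]
      by (intro nn_integral_mono_AE, use AE_lattice_path in eventually_elim) (simp add: F1)
    also have "\<dots> = 1" by (simp add: X.emeasure_space_1)
    finally have le: "excursion_transform z * ennreal (poisson_weight 1 (lam * p)) \<le> 1" .
    have "0 < poisson_weight 1 (lam * p)"
      using lam_pos p_pos by (simp add: poisson_weight_def not_less mult_less_0_iff)
    then show ?thesis
      using le by (cases "excursion_transform z = \<top>") (auto simp: ennreal_top_mult less_top top_unique)
  qed
  have y: "excursion_transform z = ennreal y" "0 \<le> y"
    using finite by (simp_all add: y_def)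
  have "(LINT x|completion M. F x) = enn2real (\<integral>\<^sup>+x. ennreal (F x) \<partial>completion M)"
  proof (rule integral_eq_nn_integral[OF F])
    show "AE x in completion M. 0 \<le> F x" by (simp add: F_def)
  qed
  also have "\<dots> = exp (- (lam * p * (1 - y)))"
    unfolding nn_integral_completion int y(1)
    using y(2) lam_pos p_pos by (subst suminf_power_poisson_weight) auto
  finally have "killed_laplace_exponent M (\<lambda>t x. descending_ladder_height (exp (Phi_0 \<nu> * h)) (\<lambda>s. X s x) t) \<beta> = lam * p * (1 - y)"
    unfolding killed_laplace_exponent_def exp_Phi_0 F_def by simp
  then show thesis
    using y by (intro that[of y]) (simp_all add: z_def)
qed

end

section \<open>Ladder masses and jump rates\<close>

definition mass :: "nat \<Rightarrow> real" where
  "mass k = lam * pmf P (- int k)"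

text \<open>The rate, in normalised local time, of excursions of depth \<open>i\<close>: read
  backwards, an excursion climbs to height \<open>m\<close> with weight \<open>p ^ m\<close>, and
  its last jump from there goes down by \<open>m + i\<close>. The additional factor \<open>p\<close>
  is the normalisation.\<close>

definition ladder_mass :: "nat \<Rightarrow> real" where
  "ladder_mass i = (\<Sum>m. p ^ Suc m * mass (m + i))"

lemma mass_nonneg: "0 \<le> mass k"
  using lam_pos by (simp add: mass_def)

lemma mass_0: "mass 0 = 0"
  by (simp add: mass_def P_0)

lemma nn_integral_P: "(\<integral>\<^sup>+j. g j \<partial>measure_pmf P) = ennreal (pmf P 1) * g 1 + (\<Sum>k. ennreal (pmf P (- int k)) * g (- int k))"
proof -
  have "(\<integral>\<^sup>+j. g j \<partial>measure_pmf P) = (\<Sum>i. ennreal (pmf P (1 - int i)) * g (1 - int i))"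
    unfolding nn_integral_measure_pmf by (rule nn_integral_count_space_int_le) (simp add: P_skip_free)
  also have "\<dots> = (\<Sum>i. ennreal (pmf P (1 - int (i + 1))) * g (1 - int (i + 1))) + (\<Sum>i<1. ennreal (pmf P (1 - int i)) * g (1 - int i))"
    by (rule suminf_offset) (rule summableI)
  finally show ?thesis by (simp add: add.commute)
qed

lemma sums_ennrealI:
  assumes "\<And>k. 0 \<le> f k" "(\<Sum>k. ennreal (f k)) = ennreal c" "0 \<le> c"
  shows "f sums c"
proof -
  have "summable f" using assms by (intro summable_suminf_not_top) auto
  moreover have "ennreal (suminf f) = ennreal c"
    using assms calculation by (subst suminf_ennreal2[symmetric]) auto
  ultimately have "suminf f = c"
    using assms(1,3) suminf_nonneg[of f] by simp
  then show ?thesis using \<open>summable f\<close> by (simp add: sums_iff)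
qed

lemma mass_sums: "mass sums (lam * (1 - pmf P 1))"
proof -
  have "1 = ennreal (pmf P 1) + (\<Sum>k. ennreal (pmf P (- int k)))"
  proof -
    have "(\<integral>\<^sup>+j. 1 \<partial>measure_pmf P) = 1" by simp
    from trans[OF sym[OF this] nn_integral_P[of "\<lambda>_. 1"]] show ?thesis
      by (simp only: mult_1_right)
  qed
  then have "1 - ennreal (pmf P 1) = (ennreal (pmf P 1) + (\<Sum>k. ennreal (pmf P (- int k)))) - ennreal (pmf P 1)"
    by (rule arg_cong)
  then have "(\<Sum>k. ennreal (pmf P (- int k))) = 1 - ennreal (pmf P 1)"
    by simp
  also have "\<dots> = ennreal (1 - pmf P 1)" by (simp add: ennreal_minus flip: ennreal_1)
  finally have "(\<lambda>k. pmf P (- int k)) sums (1 - pmf P 1)"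
    by (intro sums_ennrealI) (auto simp: pmf_le_1)
  then show ?thesis unfolding mass_def by (rule sums_mult)
qed

text \<open>The fixed-point expression is expanded by jump size; the upward jump contributes the
  constant \<open>lam * pmf P 1\<close>.\<close>

lemma mass_power_sums:
  assumes s: "0 < s" "s \<le> 1"
  shows "(\<lambda>k. s ^ Suc k * mass k) sums (lam * s * (\<integral>j. s powi (- j) \<partial>measure_pmf P) - lam * pmf P 1)"
proof -
  define e where "e = (\<integral>j. s powi (- j) \<partial>measure_pmf P)"
  have "ennreal e = (\<integral>\<^sup>+j. ennreal (s powi (- j)) \<partial>measure_pmf P)"
    unfolding e_def using s nn_integral_powi(2)[OF s] by (intro nn_integral_eq_integral[symmetric]) auto
  also have "\<dots> = ennreal (pmf P 1 / s) + (\<Sum>k. ennreal (pmf P (- int k) * s ^ k))"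
    using s by (subst nn_integral_P) (simp add: power_int_minus divide_inverse ennreal_mult')
  finally have eq: "ennreal e = ennreal (pmf P 1 / s) + (\<Sum>k. ennreal (pmf P (- int k) * s ^ k))" .
  then have "ennreal e - ennreal (pmf P 1 / s)
      = (ennreal (pmf P 1 / s) + (\<Sum>k. ennreal (pmf P (- int k) * s ^ k))) - ennreal (pmf P 1 / s)"
    by (rule arg_cong)
  then have "(\<Sum>k. ennreal (pmf P (- int k) * s ^ k)) = ennreal e - ennreal (pmf P 1 / s)"
    by simp
  also have "\<dots> = ennreal (e - pmf P 1 / s)" using s by (subst ennreal_minus) auto
  finally have S: "(\<Sum>k. ennreal (pmf P (- int k) * s ^ k)) = ennreal (e - pmf P 1 / s)" .
  have "ennreal (pmf P 1 / s) \<le> ennreal e" unfolding eq by simp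
  then have "0 \<le> e - pmf P 1 / s" using integral_powi_nonneg[OF s(1)] by (simp add: e_def)
  then have "(\<lambda>k. pmf P (- int k) * s ^ k) sums (e - pmf P 1 / s)"
    using S s by (intro sums_ennrealI) auto
  from sums_mult[OF this, of "lam * s"]
  have "(\<lambda>k. lam * s * (pmf P (- int k) * s ^ k)) sums (lam * s * (e - pmf P 1 / s))" .
  moreover have "lam * s * (e - pmf P 1 / s) = lam * s * e - lam * pmf P 1"
    using s by (simp add: right_diff_distrib)
  moreover have "(\<lambda>k. lam * s * (pmf P (- int k) * s ^ k)) = (\<lambda>k. s ^ Suc k * mass k)"
    by (simp add: mass_def fun_eq_iff ac_simps)
  ultimately show ?thesis by (simp only: e_def)
qed

lemma root_sums: "(\<lambda>k. p ^ Suc k * mass k) sums (lam * p - lam * pmf P 1)"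
  using mass_power_sums[OF p_pos p_le_1] by (simp add: p_root)

lemma summable_ladder_mass: "summable (\<lambda>m. p ^ Suc m * mass (m + i))"
proof (rule summable_comparison_test')
  show "summable (\<lambda>m. mass (m + i))"
    using mass_sums by (subst summable_iff_shift) (rule sums_summable)
  show "norm (p ^ Suc m * mass (m + i)) \<le> mass (m + i)" for m
    using p_pos p_le_1 mass_nonneg power_le_one[of p "Suc m"]
    by (simp add: abs_mult mult_left_le_one_le del: power_Suc)
qed

lemma ladder_mass_nonneg: "0 \<le> ladder_mass i"
  unfolding ladder_mass_def using p_pos mass_nonneg by (intro suminf_nonneg summable_ladder_mass) simp

lemma ladder_mass_0: "ladder_mass 0 = lam * p - lam * pmf P 1"
  unfolding ladder_mass_def using root_sums by (simp add: sums_iff)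

text \<open>Splitting off the term \<open>m = 0\<close>. Solved for \<open>mass i\<close>, with
  \<open>1 / p\<close> as \<open>x\<close>, this is the formula for the downward masses.\<close>

lemma ladder_mass_rec: "ladder_mass i = p * mass i + p * ladder_mass (Suc i)"
proof -
  have "ladder_mass i = (\<Sum>m. p ^ Suc (Suc m) * mass (Suc m + i)) + p ^ Suc 0 * mass (0 + i)"
    unfolding ladder_mass_def using suminf_split_head[OF summable_ladder_mass[of i]] by simp
  also have "(\<Sum>m. p ^ Suc (Suc m) * mass (Suc m + i)) = p * ladder_mass (Suc i)"
    unfolding ladder_mass_def using suminf_mult[OF summable_ladder_mass[of "Suc i"], of p]
    by (simp add: mult.assoc)
  finally show ?thesis by simp
qed

text \<open>In the sum given by duality the last jump is written as \<open>- (m + i)\<close>;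
  collecting by \<open>i\<close> gathers the excursions that end \<open>i\<close> steps below the
  old minimum.\<close>

lemma excursion_transform_eq:
  assumes z: "0 < z"
  shows "ennreal (lam * p) * excursion_transform z = (\<Sum>i. ennreal (ladder_mass i * z ^ i))"
proof -
  let ?c = "\<lambda>j. ennreal (pmf P j)"
  have "excursion_transform z = (\<integral>\<^sup>+m. \<integral>\<^sup>+j. ?c j * ennreal p ^ m * ennreal (z powi (- (int m + j))) * indicator {m. int m + j \<le> 0} m
        \<partial>count_space UNIV \<partial>count_space UNIV)"
    unfolding excursion_transform_def W.word_sum_desc_level_1[OF z] rho_eq
    by (rule nn_integral_count_space_nn_integral) auto
  also have "\<dots> = (\<integral>\<^sup>+m. (\<Sum>i. ennreal (pmf P (- int (m + i)) * p ^ m * z ^ i)) \<partial>count_space UNIV)"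
  proof (intro nn_integral_cong)
    fix m :: nat
    have "(\<integral>\<^sup>+j. ?c j * ennreal p ^ m * ennreal (z powi (- (int m + j))) * indicator {m. int m + j \<le> 0} m \<partial>count_space UNIV)
      = (\<Sum>i. ?c (- int m - int i) * ennreal p ^ m * ennreal (z powi (- (int m + (- int m - int i)))) * indicator {m'. int m' + (- int m - int i) \<le> 0} m)"
      by (rule nn_integral_count_space_int_le) auto
    also have "\<dots> = (\<Sum>i. ennreal (pmf P (- int (m + i)) * p ^ m * z ^ i))"
    proof (intro suminf_cong)
      fix i
      have eq: "- int m - int i = - int (m + i)" "- (int m + - int (m + i)) = int i" "int m + - int (m + i) \<le> 0"
        by simp_all
      show "?c (- int m - int i) * ennreal p ^ m * ennreal (z powi (- (int m + (- int m - int i)))) * indicator {m'. int m' + (- int m - int i) \<le> 0} m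
        = ennreal (pmf P (- int (m + i)) * p ^ m * z ^ i)"
        using p_pos z unfolding eq by (simp add: ennreal_mult' ennreal_power)
    qed
    finally show "(\<integral>\<^sup>+j. ?c j * ennreal p ^ m * ennreal (z powi (- (int m + j))) * indicator {m. int m + j \<le> 0} m \<partial>count_space UNIV)
      = (\<Sum>i. ennreal (pmf P (- int (m + i)) * p ^ m * z ^ i))" .
  qed
  also have "\<dots> = (\<Sum>i. \<Sum>m. ennreal (pmf P (- int (m + i)) * p ^ m * z ^ i))"
    by (subst nn_integral_suminf) (auto simp: nn_integral_count_space_nat)
  finally have "ennreal (lam * p) * excursion_transform z = (\<Sum>i. \<Sum>m. ennreal (lam * p) * ennreal (pmf P (- int (m + i)) * p ^ m * z ^ i))"
    by (simp add: ennreal_suminf_cmult)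
  also have "\<dots> = (\<Sum>i. ennreal (ladder_mass i * z ^ i))"
  proof (intro suminf_cong)
    fix i
    have "(\<Sum>m. ennreal (lam * p) * ennreal (pmf P (- int (m + i)) * p ^ m * z ^ i)) = (\<Sum>m. ennreal (p ^ Suc m * mass (m + i) * z ^ i))"
      using lam_pos p_pos z by (intro suminf_cong) (simp add: mass_def ennreal_mult'[symmetric] ac_simps)
    also have "\<dots> = ennreal (\<Sum>m. p ^ Suc m * mass (m + i) * z ^ i)"
      using p_pos z mass_nonneg by (intro suminf_ennreal2 summable_mult2 summable_ladder_mass) simp
    also have "(\<Sum>m. p ^ Suc m * mass (m + i) * z ^ i) = ladder_mass i * z ^ i"
      unfolding ladder_mass_def by (rule suminf_mult2[symmetric]) (rule summable_ladder_mass)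
    finally show "(\<Sum>m. ennreal (lam * p) * ennreal (pmf P (- int (m + i)) * p ^ m * z ^ i)) = ennreal (ladder_mass i * z ^ i)" .
  qed
  finally show ?thesis .
qed

text \<open>\<open>lam * p\<close> minus the coefficient of index 0 is \<open>lam * pmf P 1\<close>,
  the rate of upward jumps, so excursions of depth 0 drop out of the exponent.\<close>

lemma killed_laplace_exponent_sums:
  assumes X: "compound_poisson M X \<nu>" and \<beta>: "0 \<le> \<beta>"
  shows "(\<lambda>i. ladder_mass (Suc i) * exp (- \<beta> * h) ^ Suc i) sums (lam * pmf P 1
    - killed_laplace_exponent M (\<lambda>t x. descending_ladder_height (exp (Phi_0 \<nu> * h)) (\<lambda>s. X s x) t) \<beta>)"
proof -
  obtain y where y: "0 \<le> y" "excursion_transform (exp (- \<beta> * h)) = ennreal y"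
    "killed_laplace_exponent M (\<lambda>t x. descending_ladder_height (exp (Phi_0 \<nu> * h)) (\<lambda>s. X s x) t) \<beta> = lam * p * (1 - y)"
    by (rule killed_laplace_exponent_descending[OF X \<beta>])
  have "(\<Sum>i. ennreal (ladder_mass i * exp (- \<beta> * h) ^ i)) = ennreal (lam * p * y)"
    using excursion_transform_eq[of "exp (- \<beta> * h)"] y lam_pos p_pos by (simp add: ennreal_mult')
  then have "(\<lambda>i. ladder_mass i * exp (- \<beta> * h) ^ i) sums (lam * p * y)"
    using y(1) lam_pos p_pos ladder_mass_nonneg by (intro sums_ennrealI) auto
  then show ?thesis
    unfolding y(3) by (subst sums_Suc_iff) (simp add: ladder_mass_0 algebra_simps)
qed

end

section \<open>The Levy measure of an upwards skip-free chain\<close>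

lemma infsum_atLeast_1:
  fixes f :: "nat \<Rightarrow> 'b::{topological_comm_monoid_add, t2_space}"
  assumes "f summable_on {1..}"
  shows "(\<lambda>k. f (Suc k)) sums (\<Sum>\<^sub>\<infinity>k\<in>{1..}. f k)"
proof -
  have "{1..} = range Suc" by (auto simp: image_iff Suc_le_eq gr0_conv_Suc)
  then have "(f has_sum (\<Sum>\<^sub>\<infinity>k\<in>{1..}. f k)) (range Suc)"
    using assms has_sum_infsum by metis
  then have "((\<lambda>k. f (Suc k)) has_sum (\<Sum>\<^sub>\<infinity>k\<in>{1..}. f k)) UNIV"
    by (subst (asm) has_sum_reindex) (simp_all add: comp_def)
  then show ?thesis by (rule has_sum_imp_sums)
qed

lemma infsum_atLeast_1I:
  fixes f :: "nat \<Rightarrow> real"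
  assumes "\<And>k. 1 \<le> k \<Longrightarrow> 0 \<le> f k" "(\<lambda>k. f (Suc k)) sums S"
  shows "(\<Sum>\<^sub>\<infinity>k\<in>{1..}. f k) = S" "f summable_on {1..}"
proof -
  have "((\<lambda>k. f (Suc k)) has_sum S) UNIV"
    by (rule sums_nonneg_imp_has_sum) (use assms in auto)
  moreover have "{1..} = range Suc" by (auto simp: image_iff Suc_le_eq gr0_conv_Suc)
  ultimately have "(f has_sum S) {1..}"
    by (simp add: has_sum_reindex comp_def)
  then show "(\<Sum>\<^sub>\<infinity>k\<in>{1..}. f k) = S" "f summable_on {1..}"
    by (auto intro: infsumI has_sum_imp_summable)
qed

text \<open>Points outside the support have null open neighbourhoods, and by the Lindelof property
  countably many of these cover the complement of \<open>C\<close>.\<close>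

lemma emeasure_Compl_measure_support:
  assumes sets: "sets \<nu> = sets borel" and C: "measure_support \<nu> \<subseteq> C" "closed C"
  shows "emeasure \<nu> (- C) = 0"
proof -
  define \<F> where "\<F> = {U. open U \<and> emeasure \<nu> U = 0}"
  obtain \<F>' where F: "\<F>' \<subseteq> \<F>" "countable \<F>'" "\<Union>\<F>' = \<Union>\<F>"
    using Lindelof[of \<F>] unfolding \<F>_def by blast
  have "- C \<subseteq> \<Union>\<F>"
  proof
    fix x assume "x \<in> - C"
    then have "x \<notin> measure_support \<nu>" using C by auto
    then show "x \<in> \<Union>\<F>" by (auto simp: measure_support_def \<F>_def)
  qed
  moreover have N: "(\<Union>U\<in>\<F>'. U) \<in> null_sets \<nu>"
    using F(1,2) sets by (intro null_sets_UN') (auto simp: \<F>_def null_sets_def)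
  ultimately have "emeasure \<nu> (- C) \<le> emeasure \<nu> (\<Union>U\<in>\<F>'. U)"
    using F(3) by (intro emeasure_mono) auto
  then show ?thesis using null_setsD1[OF N] by simp
qed

lemma emeasure_jump_measure_eq_nn_integral:
  assumes A: "A \<in> sets borel"
  shows "emeasure (jump_measure h lam P) A = ennreal lam * (\<integral>\<^sup>+j. indicator A (h * of_int j) \<partial>measure_pmf P)"
proof -
  have "(\<integral>\<^sup>+j. indicator A (h * of_int j) \<partial>measure_pmf P) = (\<integral>\<^sup>+j. indicator {j. h * of_int j \<in> A} j \<partial>measure_pmf P)"
    by (intro nn_integral_cong) (simp add: indicator_def)
  also have "\<dots> = emeasure (measure_pmf P) {j. h * of_int j \<in> A}"
    by simp
  finally show ?thesis using emeasure_jump_measure[OF A] by simp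
qed

lemma emeasure_density_positive:
  assumes sets: "sets \<nu> = sets borel" and U: "U \<in> sets borel"
  shows "emeasure (density \<nu> (indicator {0<..})) U = emeasure \<nu> (U \<inter> {0::real<..})"
proof -
  have "{0<..} \<in> sets \<nu>" "U \<in> sets \<nu>" using sets U by simp_all
  then show ?thesis
    by (simp add: emeasure_density indicator_inter_arith[symmetric] Int_commute)
qed

text \<open>The closed lattice carries all the mass, so the measure is a sum of atoms; dividing by
  its total mass gives the jump law.\<close>

lemma upwards_skip_free_jump_measure:
  assumes h: "0 < h" and usf: "upwards_skip_free_levy_chain h M X \<nu>"
  obtains lam P where "skip_free_chain lam P h" "\<nu> = jump_measure h lam P"
proof -
  let ?L = "range (\<lambda>k::int. h * of_int k)"
  have sets: "sets \<nu> = sets borel" and fin: "finite_measure \<nu>" and null: "emeasure \<nu> {0} = 0"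
    and supp: "measure_support \<nu> \<subseteq> ?L" and supp_pos: "measure_support (density \<nu> (indicator {0<..})) = {h}"
    using usf by (auto simp: upwards_skip_free_levy_chain_def compound_poisson_def)
  interpret finite_measure \<nu> by fact
  have space: "space \<nu> = UNIV" using sets_eq_imp_space_eq[OF sets] by simp
  have "?L = (\<lambda>x. h *\<^sub>R x) ` \<int>" by (auto simp: Ints_def)
  then have closed: "closed ?L" using closed_scaling[OF closed_Ints] by metis
  have L: "?L \<in> sets \<nu>" unfolding sets using closed by (rule borel_closed)
  have zero: "emeasure \<nu> (- ?L) = 0"
    by (rule emeasure_Compl_measure_support[OF sets supp closed])
  define \<mu> where "\<mu> j = emeasure \<nu> {h * of_int j}" for j :: int
  have inj: "inj_on (\<lambda>j::int. h * of_int j) A" for A using h by (auto simp: inj_on_def)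
  have sum: "emeasure \<nu> A = (\<integral>\<^sup>+j. \<mu> j \<partial>count_space {j. h * of_int j \<in> A})" if A: "A \<in> sets borel" for A
  proof -
    have "emeasure \<nu> A = emeasure \<nu> (A \<inter> ?L)"
    proof (rule emeasure_eq_AE)
      have "- ?L \<in> null_sets \<nu>" using zero L by (auto simp: null_sets_def sets)
      then have "AE x in \<nu>. x \<notin> - ?L" by (rule AE_not_in)
      then show "AE x in \<nu>. x \<in> A \<longleftrightarrow> x \<in> A \<inter> ?L" by eventually_elim auto
    qed (use A L sets in auto)
    also have "\<dots> = (\<integral>\<^sup>+x. emeasure \<nu> {x} \<partial>count_space (A \<inter> ?L))"
      by (rule emeasure_countable_singleton) (auto simp: sets)
    also have "\<dots> = (\<integral>\<^sup>+j. \<mu> j \<partial>count_space {j. h * of_int j \<in> A})"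
      unfolding \<mu>_def by (rule nn_integral_bij_count_space[symmetric]) (auto simp: bij_betw_def inj)
    finally show ?thesis .
  qed
  have pos: "0 < emeasure \<nu> (U \<inter> {0<..})" if "open U" "h \<in> U" for U
  proof -
    have "h \<in> measure_support (density \<nu> (indicator {0<..}))" using supp_pos by simp
    then have "0 < emeasure (density \<nu> (indicator {0<..})) U" using that by (simp add: measure_support_def)
    then show ?thesis using emeasure_density_positive[OF sets, of U] that by simp
  qed
  have \<mu>_1: "0 < \<mu> 1"
  proof -
    \<comment> \<open>A window around \<open>h\<close> without other lattice points: since
      \<open>h\<close> lies in the support, it must carry an atom.\<close>
    have "{j::int. h * of_int j \<in> {0<..<2 * h} \<inter> {0<..}} = {1}"
      using h by (auto simp: zero_less_mult_iff mult.commute)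
    then show ?thesis
      using pos[of "{0<..<2 * h}"] sum[of "{0<..<2 * h} \<inter> {0<..}"] h
      by (simp add: nn_integral_count_space_finite)
  qed
  have \<mu>_gt_1: "\<mu> j = 0" if j: "1 < j" for j
  proof -
    have "h * of_int j \<noteq> h" using h j by simp
    then have "h * of_int j \<notin> measure_support (density \<nu> (indicator {0<..}))" using supp_pos by simp
    then obtain U where U: "open U" "h * of_int j \<in> U" "emeasure (density \<nu> (indicator {0<..})) U = 0"
      by (auto simp: measure_support_def)
    then have "emeasure \<nu> (U \<inter> {0<..}) = 0" using emeasure_density_positive[OF sets, of U] by simp
    moreover have "\<mu> j \<le> emeasure \<nu> (U \<inter> {0<..})"
      unfolding \<mu>_def using U h j by (intro emeasure_mono) (auto simp: sets)
    ultimately show ?thesis by simp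
  qed
  define lam where "lam = measure \<nu> UNIV"
  have lam: "ennreal lam = emeasure \<nu> UNIV" by (simp add: lam_def emeasure_eq_measure)
  have "\<mu> 1 \<le> ennreal lam" unfolding \<mu>_def lam by (intro emeasure_mono) (auto simp: sets)
  from less_le_trans[OF \<mu>_1 this] have lam_pos: "0 < lam" by simp
  define f where "f j = measure \<nu> {h * of_int j} / lam" for j :: int
  have f: "ennreal lam * ennreal (f j) = \<mu> j" for j
    using lam_pos by (simp add: f_def \<mu>_def emeasure_eq_measure ennreal_mult[symmetric])
  have nn: "0 \<le> f j" for j using lam_pos by (simp add: f_def)
  have "ennreal lam * (\<integral>\<^sup>+j. ennreal (f j) \<partial>count_space UNIV) = ennreal lam * 1"
  proof -
    have "ennreal lam * (\<integral>\<^sup>+j. ennreal (f j) \<partial>count_space UNIV) = (\<integral>\<^sup>+j. ennreal lam * ennreal (f j) \<partial>count_space UNIV)"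
      by (rule nn_integral_cmult[symmetric]) simp
    also have "\<dots> = ennreal lam"
      unfolding f using sum[of UNIV] lam by simp
    finally show ?thesis by simp
  qed
  then have total: "(\<integral>\<^sup>+j. ennreal (f j) \<partial>count_space UNIV) = 1"
    using lam_pos by (subst (asm) ennreal_mult_cancel_left) auto
  define P where "P = embed_pmf f"
  have P: "pmf P j = f j" for j
    unfolding P_def by (rule pmf_embed_pmf[OF nn total])
  have "f j = 0 \<longleftrightarrow> \<mu> j = 0" for j
    using lam_pos by (simp add: f_def \<mu>_def emeasure_eq_measure)
  then have "skip_free_chain lam P h"
    using lam_pos h null \<mu>_1 \<mu>_gt_1 nn by unfold_locales (auto simp: P less_le \<mu>_def)
  moreover have "\<nu> = jump_measure h lam P"
  proof (rule measure_eqI)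
    fix A assume "A \<in> sets \<nu>"
    then have A: "A \<in> sets borel" using sets by simp
    have "emeasure (jump_measure h lam P) A = ennreal lam * (\<integral>\<^sup>+j. ennreal (f j) \<partial>count_space {j. h * of_int j \<in> A})"
      unfolding emeasure_jump_measure[OF A] nn_integral_pmf[symmetric] P ..
    also have "\<dots> = emeasure \<nu> A"
      unfolding sum[OF A] by (simp add: nn_integral_cmult[symmetric] f)
    finally show "emeasure \<nu> A = emeasure (jump_measure h lam P) A" ..
  qed (simp add: sets)
  ultimately show thesis by (rule that)
qed

context skip_free_chain
begin

lemma emeasure_jump_measure_atoms:
  assumes A: "A \<in> sets borel"
  shows "emeasure \<nu> A = (\<Sum>\<^sub>\<infinity>k\<in>{1..}. ennreal (mass k) * emeasure (return borel (- (real k * h))) A)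
    + ennreal (lam * pmf P 1) * emeasure (return borel h) A"
proof -
  let ?f = "\<lambda>k. ennreal (mass k) * emeasure (return borel (- (real k * h))) A"
  have "emeasure \<nu> A = ennreal lam * (\<integral>\<^sup>+j. indicator A (h * of_int j) \<partial>measure_pmf P)"
    by (rule emeasure_jump_measure_eq_nn_integral[OF A])
  also have "\<dots> = ennreal lam * (ennreal (pmf P 1) * indicator A h) + (\<Sum>k. ennreal lam * (ennreal (pmf P (- int k)) * indicator A (- (real k * h))))"
    by (subst nn_integral_P) (simp add: distrib_left ennreal_suminf_cmult mult.commute)
  also have "(\<Sum>k. ennreal lam * (ennreal (pmf P (- int k)) * indicator A (- (real k * h)))) = (\<Sum>k. ?f k)"
    using A lam_pos by (intro suminf_cong) (simp add: mass_def ennreal_mult' mult.assoc)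
  also have "\<dots> = (\<Sum>k. ?f (k + 1)) + (\<Sum>k<1. ?f k)"
    by (rule suminf_offset) (rule summableI)
  also have "\<dots> = (\<Sum>\<^sub>\<infinity>k\<in>{1..}. ?f k)"
  proof -
    have "?f summable_on {1..}" by (rule nonneg_summable_on_complete) simp
    from infsum_atLeast_1[OF this] show ?thesis by (simp add: sums_iff mass_0)
  qed
  finally show ?thesis using A lam_pos by (simp add: ennreal_mult' mult.assoc add.commute)
qed

lemma upwards_skip_free_levy_chainI:
  assumes X: "compound_poisson M X \<nu>"
  shows "upwards_skip_free_levy_chain h M X \<nu>"
proof -
  let ?L = "range (\<lambda>k::int. h * of_int k)"
  have "?L = (\<lambda>x. h *\<^sub>R x) ` \<int>" by (auto simp: Ints_def)
  then have "closed ?L" using closed_scaling[OF closed_Ints] by metis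
  then have open_L: "open (- ?L)" by auto
  have "measure_support \<nu> \<subseteq> ?L"
  proof
    fix x assume x: "x \<in> measure_support \<nu>"
    show "x \<in> ?L"
    proof (rule ccontr)
      assume "x \<notin> ?L"
      then have "0 < emeasure \<nu> (- ?L)" using x open_L unfolding measure_support_def by blast
      moreover have "{j. h * of_int j \<in> - ?L} = {}" by auto
      ultimately show False using open_L by (simp add: emeasure_jump_measure)
    qed
  qed
  moreover have dens: "emeasure (density \<nu> (indicator {0<..})) U = ennreal (lam * pmf P 1) * indicator U h" if "open U" for U
  proof -
    have U: "U \<inter> {0<..} \<in> sets borel" using that by auto
    have "emeasure (density \<nu> (indicator {0<..})) U = ennreal lam * (\<integral>\<^sup>+j. indicator (U \<inter> {0<..}) (h * of_int j) \<partial>measure_pmf P)"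
      unfolding emeasure_density_positive[OF sets_jump_measure borel_open[OF that]]
      by (rule emeasure_jump_measure_eq_nn_integral[OF U])
    also have "\<dots> = ennreal lam * (ennreal (pmf P 1) * indicator U h)"
    proof -
      have "\<not> h * real k < 0" for k using h_pos by (simp add: not_less)
      then show ?thesis using h_pos by (subst nn_integral_P) (simp add: indicator_def)
    qed
    finally show ?thesis using lam_pos by (simp add: ennreal_mult' mult.assoc)
  qed
  have "measure_support (density \<nu> (indicator {0<..})) = {h}"
  proof (intro set_eqI iffI)
    fix x assume x: "x \<in> measure_support (density \<nu> (indicator {0<..}))"
    show "x \<in> {h}"
    proof (rule ccontr)
      assume "x \<notin> {h}"
      then have "0 < emeasure (density \<nu> (indicator {0<..})) (- {h})"
        using x unfolding measure_support_def by blast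
      then show False using dens[OF open_Compl[OF closed_singleton], of h] by simp
    qed
  next
    fix x assume "x \<in> {h}"
    then show "x \<in> measure_support (density \<nu> (indicator {0<..}))"
      using lam_pos P_1 by (simp add: measure_support_def dens ennreal_zero_less_mult_iff)
  qed
  ultimately show ?thesis
    using X by (simp add: upwards_skip_free_levy_chain_def)
qed

end

section \<open>Chains with prescribed ladder data\<close>

text \<open>The constant term is the limit at 0 from the right; once it vanishes, a factor
  \<open>z\<close> is removed and the argument repeats. The open unit interval is the range of
  \<open>exp (- \<beta> * h)\<close> for positive \<open>\<beta>\<close>.\<close>

lemma powser_eq_0_imp_coeff_0:
  fixes a :: "nat \<Rightarrow> real"
  assumes "\<And>z. 0 < z \<Longrightarrow> z < 1 \<Longrightarrow> (\<lambda>n. a n * z ^ n) sums 0"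
  shows "a n = 0"
proof -
  have zero: "b 0 = 0" if b: "\<And>z. 0 < z \<Longrightarrow> z < 1 \<Longrightarrow> (\<lambda>n. b n * z ^ n) sums 0" for b :: "nat \<Rightarrow> real"
  proof -
    define f where "f x = (\<Sum>n. b n * x ^ n)" for x
    have "summable (\<lambda>n. b n * (1 / 2) ^ n)" using b[of "1 / 2"] by (simp add: sums_iff)
    then have sm: "summable (\<lambda>n. b n * x ^ n)" if "norm x < 1 / 2" for x
      by (rule powser_inside) (use that in simp)
    have "(\<lambda>n. b n * x ^ n) sums f x" if "norm x < 1 / 2" for x
      unfolding f_def by (rule summable_sums[OF sm[OF that]])
    then have "(f \<longlongrightarrow> b 0) (at 0)" by (rule powser_limit_0[of "1 / 2", rotated]) simp_all
    then have "(f \<longlongrightarrow> b 0) (at_right 0)" by (rule tendsto_within_subset) simp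
    moreover have "eventually (\<lambda>x. f x = 0) (at_right 0)"
      unfolding eventually_at_right_field f_def using b by (intro exI[of _ 1]) (auto simp: sums_iff)
    then have "(f \<longlongrightarrow> 0) (at_right 0)" by (rule tendsto_eventually)
    ultimately show "b 0 = 0" by (rule tendsto_unique[OF trivial_limit_at_right_real])
  qed
  have "\<forall>z. 0 < z \<longrightarrow> z < 1 \<longrightarrow> (\<lambda>i. a (i + n) * z ^ i) sums 0"
  proof (induction n)
    case (Suc n)
    then have a: "a n = 0" using zero[of "\<lambda>i. a (i + n)"] by simp
    show ?case
    proof (intro allI impI)
      fix z :: real assume z: "0 < z" "z < 1"
      then have "(\<lambda>i. a (Suc i + n) * z ^ Suc i) sums 0"
        using Suc a by (subst sums_Suc_iff) simp
      then have "(\<lambda>i. (1 / z) * (a (Suc i + n) * z ^ Suc i)) sums ((1 / z) * 0)" by (rule sums_mult)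
      then show "(\<lambda>i. a (i + Suc n) * z ^ i) sums 0" using z by simp
    qed
  qed (use assms in simp)
  then show ?thesis using zero[of "\<lambda>i. a (i + n)"] by simp
qed

section \<open>The correspondence between ladder parameters and jump rates\<close>

locale ladder_parameters =
  fixes h \<gamma> q :: real and \<phi> :: "nat \<Rightarrow> real"
  assumes h: "0 < h" and \<gamma>: "0 \<le> \<gamma>" and q: "0 \<le> q"
    and \<phi>: "\<And>k. 1 \<le> k \<Longrightarrow> 0 \<le> \<phi> k" and summable_\<phi>: "\<phi> summable_on {1..}"
    and positive: "0 < q + (\<Sum>\<^sub>\<infinity>k\<in>{1..}. \<phi> k)"
begin

definition S :: real where
  "S = (\<Sum>\<^sub>\<infinity>k\<in>{1..}. \<phi> k)"

lemma \<phi>_sums: "(\<lambda>k. \<phi> (Suc k)) sums S"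
  unfolding S_def by (rule infsum_atLeast_1[OF summable_\<phi>])

lemma \<phi>_sums_Suc: "(\<lambda>k. \<phi> (Suc (Suc k))) sums (S - \<phi> 1)"
  using \<phi>_sums by (subst sums_Suc_iff) simp

lemma S_nonneg: "0 \<le> S"
  using sums_le[OF _ sums_zero \<phi>_sums] \<phi> by simp

lemma mass_up_eq: "mass_up q \<phi> = q + S"
  by (simp add: mass_up_def S_def)

lemma summable_\<phi>_mult:
  assumes "\<And>k. 0 \<le> c k" "\<And>k. c k \<le> 1"
  shows "summable (\<lambda>k. \<phi> (Suc k) * c k)"
proof (rule summable_comparison_test')
  show "summable (\<lambda>k. \<phi> (Suc k))" using \<phi>_sums by (rule sums_summable)
  show "norm (\<phi> (Suc k) * c k) \<le> \<phi> (Suc k)" for k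
    using assms[of k] \<phi>[of "Suc k"] by (simp add: abs_mult mult_left_le)
qed

text \<open>Writes the prescribed exponent as a constant minus a power series in
  \<open>exp (- \<beta> * h)\<close>, the form in which coefficients can be compared.\<close>

lemma exponent_sums:
  assumes \<beta>: "0 \<le> \<beta>"
  shows "(\<lambda>k. \<phi> (Suc k) * exp (- \<beta> * h) ^ Suc k) sums (S - (\<Sum>\<^sub>\<infinity>k\<in>{1..}. \<phi> k * (1 - exp (- \<beta> * real k * h))))"
proof -
  let ?z = "exp (- \<beta> * h)"
  let ?f = "\<lambda>k. \<phi> k * (1 - exp (- \<beta> * real k * h))"
  have z: "0 \<le> ?z" "?z \<le> 1" using \<beta> h by simp_all
  have exp_eq: "exp (- \<beta> * real k * h) = ?z ^ k" for k
    by (simp add: exp_of_nat_mult[symmetric] ac_simps)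
  have sm: "summable (\<lambda>k. \<phi> (Suc k) * ?z ^ Suc k)"
    using z by (intro summable_\<phi>_mult power_le_one zero_le_power)
  have sums: "(\<lambda>k. ?f (Suc k)) sums (S - (\<Sum>k. \<phi> (Suc k) * ?z ^ Suc k))"
    unfolding exp_eq using sums_diff[OF \<phi>_sums summable_sums[OF sm]] by (simp add: right_diff_distrib)
  have "(\<Sum>\<^sub>\<infinity>k\<in>{1..}. ?f k) = S - (\<Sum>k. \<phi> (Suc k) * ?z ^ Suc k)"
  proof (rule infsum_atLeast_1I(1)[OF _ sums])
    fix k :: nat assume "1 \<le> k"
    then show "0 \<le> ?f k"
      unfolding exp_eq using \<phi> power_le_one[OF z] by (simp add: mult_nonneg_nonneg)
  qed
  then show ?thesis using summable_sums[OF sm] by simp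
qed

text \<open>Since \<open>\<gamma>\<close> is non-zero, \<open>q = 0\<close> and hence
  \<open>S > 0\<close>. Expanded, the right-hand side of the equation is
  \<open>\<phi> 1 + u * S - \<phi> 1 / u - S\<close>, which is strictly increasing in
  \<open>u > 1\<close>.\<close>

lemma solves_x_unique:
  assumes "\<gamma> \<noteq> 0" "\<gamma> * q = 0" "solves_x \<gamma> \<phi> x" "solves_x \<gamma> \<phi> y"
  shows "x = y"
proof -
  have "0 < S" using assms(1,2) positive by (simp add: S_def)
  have le: "\<not> a < b" if ab: "solves_x \<gamma> \<phi> a" "solves_x \<gamma> \<phi> b" for a b
  proof
    assume "a < b"
    have val: "\<gamma> = \<phi> 1 + u * S - \<phi> 1 / u - S" "1 < u" if "solves_x \<gamma> \<phi> u" for u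
    proof -
      show u: "1 < u" using that by (simp add: solves_x_def)
      have "\<gamma> = (1 - 1 / u) * (\<phi> 1 + u * S)" using that unfolding solves_x_def S_def by blast
      also have "\<dots> = \<phi> 1 + u * S - \<phi> 1 / u - (u / u) * S" by (simp add: algebra_simps)
      finally show "\<gamma> = \<phi> 1 + u * S - \<phi> 1 / u - S" using u by simp
    qed
    have "a * S < b * S" using \<open>a < b\<close> \<open>0 < S\<close> by simp
    moreover have "\<phi> 1 / b \<le> \<phi> 1 / a"
      using \<phi>[of 1] val(2)[OF ab(1)] \<open>a < b\<close> by (intro divide_left_mono) auto
    ultimately show False using val(1)[OF ab(1)] val(1)[OF ab(2)] by linarith
  qed
  show ?thesis using le[OF assms(3,4)] le[OF assms(4,3)] by linarith
qed

lemma the_x_eqI: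
  assumes "\<gamma> * q = 0" "\<gamma> = 0 \<Longrightarrow> x = 1" "\<gamma> \<noteq> 0 \<Longrightarrow> solves_x \<gamma> \<phi> x"
  shows "the_x \<gamma> \<phi> = x"
  using assms solves_x_unique by (auto simp: the_x_def intro!: the_equality)

lemma ladder_data_necessary:
  assumes L: "has_ladder_data h \<gamma> q \<phi> M X \<nu>"
  shows "admissible \<gamma> q \<phi>"
    and "A \<in> sets borel \<Longrightarrow> emeasure \<nu> A =
           (\<Sum>\<^sub>\<infinity>k\<in>{1..}. ennreal (mass_down \<gamma> \<phi> k) * emeasure (return borel (- (real k * h))) A)
             + ennreal (mass_up q \<phi>) * emeasure (return borel h) A"
    and "the_x \<gamma> \<phi> = exp (Phi_0 \<nu> * h)"
proof -
  have usf: "upwards_skip_free_levy_chain h M X \<nu>"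
    and kill: "has_killing_rate M (\<lambda>t \<omega>. strict_ascending_ladder_height (\<lambda>s. X s \<omega>) t) \<gamma>"
    and expo: "\<And>\<beta>. 0 \<le> \<beta> \<Longrightarrow> killed_laplace_exponent M
          (\<lambda>t \<omega>. descending_ladder_height (exp (Phi_0 \<nu> * h)) (\<lambda>s. X s \<omega>) t) \<beta>
        = q + (\<Sum>\<^sub>\<infinity>k\<in>{1..}. \<phi> k * (1 - exp (- \<beta> * real k * h)))"
    using L unfolding has_ladder_data_def by blast+
  obtain lam P where C: "skip_free_chain lam P h" and \<nu>: "\<nu> = jump_measure h lam P"
    by (rule upwards_skip_free_jump_measure[OF h usf])
  interpret C: skip_free_chain lam P h by fact
  have X: "compound_poisson M X (jump_measure h lam P)"
    using usf by (simp add: upwards_skip_free_levy_chain_def \<nu>)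
  define x where "x = 1 / C.p"
  have x: "1 \<le> x" "C.p * x = 1" using C.p_pos C.p_le_1 by (simp_all add: x_def)
  have "exp (- \<gamma> * 1) = exp (- (lam * (1 - C.p)) * 1)"
    using kill C.has_killing_rate_ascending[OF X] unfolding has_killing_rate_def
    by (metis zero_le_one)
  then have \<gamma>_eq: "\<gamma> = lam * (1 - C.p)" by simp
  \<comment> \<open>The coefficients of the difference of the two exponents; the constant term
    compares the upward rate with \<open>q + S\<close>.\<close>
  define a where "a n = (if n = 0 then S + q - lam * pmf P 1 else C.ladder_mass n - \<phi> n)" for n
  have "a n = 0" for n
  proof (rule powser_eq_0_imp_coeff_0)
    fix z :: real assume z: "0 < z" "z < 1"
    define \<beta> where "\<beta> = - ln z / h"
    have \<beta>: "0 \<le> \<beta>" "exp (- \<beta> * h) = z"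
      using z h by (simp_all add: \<beta>_def divide_nonneg_pos divide_nonpos_pos)
    let ?K = "q + (\<Sum>\<^sub>\<infinity>k\<in>{1..}. \<phi> k * (1 - exp (- \<beta> * real k * h)))"
    have "(\<lambda>i. C.ladder_mass (Suc i) * z ^ Suc i) sums (lam * pmf P 1 - ?K)"
      using C.killed_laplace_exponent_sums[OF X \<beta>(1)] expo[OF \<beta>(1)] unfolding \<nu> \<beta>(2) by simp
    from sums_diff[OF this exponent_sums[OF \<beta>(1)]]
    have "(\<lambda>i. a (Suc i) * z ^ Suc i) sums (lam * pmf P 1 - q - S)"
      unfolding \<beta>(2) by (simp add: a_def left_diff_distrib algebra_simps)
    then show "(\<lambda>n. a n * z ^ n) sums 0"
      by (subst (asm) sums_Suc_iff) (simp add: a_def)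
  qed
  then have "a 0 = 0" and a_Suc: "\<And>n. a (Suc n) = 0" by blast+
  then have up: "lam * pmf P 1 = q + S" and lm: "\<And>n. C.ladder_mass (Suc n) = \<phi> (Suc n)"
    by (simp_all add: a_def)
  have mass: "C.mass (Suc k) = x * \<phi> (Suc k) - \<phi> (Suc (Suc k))" for k
  proof -
    have "x * \<phi> (Suc k) = x * (C.p * C.mass (Suc k) + C.p * \<phi> (Suc (Suc k)))"
      using C.ladder_mass_rec[of "Suc k"] by (simp add: lm)
    also have "\<dots> = (C.p * x) * C.mass (Suc k) + (C.p * x) * \<phi> (Suc (Suc k))" by (simp add: algebra_simps)
    finally show ?thesis by (simp add: x(2))
  qed
  \<comment> \<open>The total downward rate is computed twice: from the jump law and from the
    formula for the masses.\<close>
  have "(\<lambda>k. C.mass (Suc k)) sums (lam - lam * pmf P 1)"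
    using C.mass_sums by (subst sums_Suc_iff) (simp add: C.mass_0 right_diff_distrib)
  moreover have "(\<lambda>k. C.mass (Suc k)) sums (x * S - (S - \<phi> 1))"
    unfolding mass by (intro sums_diff sums_mult \<phi>_sums \<phi>_sums_Suc)
  ultimately have "lam - lam * pmf P 1 = x * S - (S - \<phi> 1)" by (rule sums_unique2)
  then have lam1: "lam = q + x * S + \<phi> 1" using up by simp
  have "lam * C.p - (q + S) = C.p * \<phi> 1"
    using C.ladder_mass_0 C.ladder_mass_rec[of 0] lm[of 0] by (simp add: up C.mass_0)
  then have "x * (lam * C.p) = x * (q + S) + x * (C.p * \<phi> 1)" by (simp add: algebra_simps)
  moreover have "x * (lam * C.p) = (C.p * x) * lam" "x * (C.p * \<phi> 1) = (C.p * x) * \<phi> 1"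
    by (simp_all add: ac_simps)
  ultimately have "lam = x * (q + S) + \<phi> 1"
    unfolding x(2) by simp
  \<comment> \<open>The total rate obtained from all masses and the one from the recursion at index
    0 differ by exactly this product; it is the origin of the condition
    \<open>\<gamma> * q = 0\<close>.\<close>
  then have "(x - 1) * q = 0" using lam1 by (simp add: algebra_simps)
  then have xq: "x = 1 \<or> q = 0" by simp
  have \<gamma>_0: "\<gamma> = 0 \<longleftrightarrow> x = 1"
    using \<gamma>_eq C.lam_pos x by (auto simp: x_def)
  have \<gamma>q: "\<gamma> * q = 0" using xq \<gamma>_0 by auto
  have p: "C.p = 1 / x" by (simp add: x_def)
  have solves: "solves_x \<gamma> \<phi> x" if "\<gamma> \<noteq> 0"
  proof -
    have "x \<noteq> 1" "q = 0" using that \<gamma>_0 xq by auto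
    then show ?thesis
      using x \<gamma>_eq lam1 p by (simp add: solves_x_def S_def mult.commute)
  qed
  have the_x: "the_x \<gamma> \<phi> = x"
    using \<gamma>q \<gamma>_0 solves by (intro the_x_eqI) auto
  have down: "mass_down \<gamma> \<phi> k = C.mass k" if "1 \<le> k" for k
    using that mass[of "k - 1"] by (simp add: mass_down_def the_x)
  show "admissible \<gamma> q \<phi>"
    unfolding admissible_def
  proof (intro conjI allI impI \<gamma>q)
    show "\<gamma> = 0 \<or> (\<exists>!x. solves_x \<gamma> \<phi> x)" using solves solves_x_unique[OF _ \<gamma>q] by blast
  qed (use down C.mass_nonneg in simp)
  show "the_x \<gamma> \<phi> = exp (Phi_0 \<nu> * h)"
    unfolding the_x \<nu> C.exp_Phi_0 x_def ..
  assume A: "A \<in> sets borel"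
  have "(\<Sum>\<^sub>\<infinity>k\<in>{1..}. ennreal (mass_down \<gamma> \<phi> k) * emeasure (return borel (- (real k * h))) A)
      = (\<Sum>\<^sub>\<infinity>k\<in>{1..}. ennreal (C.mass k) * emeasure (return borel (- (real k * h))) A)"
    by (rule infsum_cong) (simp add: down)
  then show "emeasure \<nu> A =
           (\<Sum>\<^sub>\<infinity>k\<in>{1..}. ennreal (mass_down \<gamma> \<phi> k) * emeasure (return borel (- (real k * h))) A)
             + ennreal (mass_up q \<phi>) * emeasure (return borel h) A"
    unfolding \<nu> using C.emeasure_jump_measure_atoms[OF A] by (simp only: up mass_up_eq)
qed

text \<open>The masses in the condition define a jump law outright, whose ladder data are then
  computed. The crux is that its \<open>p\<close> equals \<open>1 / x\<close>; after that a
  telescoping sum returns the prescribed coefficients.\<close>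

lemma ladder_data_sufficient:
  assumes adm: "admissible \<gamma> q \<phi>"
  shows "\<exists>(M :: (real \<Rightarrow> real) measure) X \<nu>. has_ladder_data h \<gamma> q \<phi> M X \<nu>"
proof -
  define x where "x = the_x \<gamma> \<phi>"
  have \<gamma>q: "\<gamma> * q = 0" and down_nonneg: "\<And>k. 1 \<le> k \<Longrightarrow> 0 \<le> x * \<phi> k - \<phi> (k + 1)"
    using adm by (auto simp: admissible_def mass_down_def x_def)
  have x0: "x = 1" if "\<gamma> = 0" using that by (simp add: x_def the_x_def)
  have x1: "solves_x \<gamma> \<phi> x" if "\<gamma> \<noteq> 0"
    using adm that theI'[of "solves_x \<gamma> \<phi>"] by (simp add: admissible_def x_def the_x_def)
  have x_ge_1: "1 \<le> x" using x0 x1 by (cases "\<gamma> = 0") (auto simp: solves_x_def)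
  have xq: "x = 1 \<or> q = 0" using \<gamma>q x0 by (cases "\<gamma> = 0") auto
  \<comment> \<open>The total rate: \<open>q + S\<close> upwards plus the sum
    \<open>(x - 1) * S + \<phi> 1\<close> of the downward masses.\<close>
  define lam where "lam = q + x * S + \<phi> 1"
  have up_pos: "0 < q + S" using positive by (simp add: S_def)
  have "S \<le> x * S" using x_ge_1 S_nonneg by (simp add: mult_right_mono[of 1 x S, simplified])
  then have lam_pos: "0 < lam" using up_pos \<phi>[of 1] by (simp add: lam_def)
  define m where "m k = x * \<phi> k - \<phi> (k + 1)" for k
  have m_sums: "(\<lambda>k. m (Suc k)) sums (lam - (q + S))"
  proof -
    have "(\<lambda>k. m (Suc k)) sums (x * S - (S - \<phi> 1))"
      unfolding m_def using sums_diff[OF sums_mult[OF \<phi>_sums, of x] \<phi>_sums_Suc] by simp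
    then show ?thesis by (simp add: lam_def algebra_simps)
  qed
  define f where "f j = (if j = 1 then (q + S) / lam else if j < 0 then m (nat (- j)) / lam else 0)" for j :: int
  have f_nonneg: "0 \<le> f j" for j
    using up_pos lam_pos down_nonneg[of "nat (- j)"] by (auto simp: f_def m_def)
  have f_sums: "(\<lambda>i. f (1 - int i)) sums 1"
  proof -
    have "(\<lambda>i. m (Suc i) / lam) sums ((lam - (q + S)) / lam)" by (rule sums_divide[OF m_sums])
    moreover have "f (1 - int (Suc (Suc i))) = m (Suc i) / lam" for i
      by (simp add: f_def nat_add_distrib)
    ultimately have "(\<lambda>i. f (1 - int (Suc (Suc i)))) sums ((lam - (q + S)) / lam)" by simp
    then have "(\<lambda>i. f (1 - int (Suc i))) sums ((lam - (q + S)) / lam + f (1 - int (Suc 0)))"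
      by (subst (asm) sums_Suc_iff[of "\<lambda>i. f (1 - int (Suc i))"])
    then have "(\<lambda>i. f (1 - int i)) sums ((lam - (q + S)) / lam + f (1 - int (Suc 0)) + f (1 - int 0))"
      by (subst (asm) sums_Suc_iff[of "\<lambda>i. f (1 - int i)"])
    moreover have "(lam - (q + S)) / lam + f (1 - int (Suc 0)) + f (1 - int 0) = 1"
      using lam_pos by (simp add: f_def diff_divide_distrib)
    ultimately show ?thesis by simp
  qed
  have "(\<integral>\<^sup>+j. ennreal (f j) \<partial>count_space UNIV) = (\<Sum>i. ennreal (f (1 - int i)))"
    by (rule nn_integral_count_space_int_le) (simp add: f_def)
  also have "\<dots> = ennreal 1" by (rule suminf_ennreal_eq[OF f_nonneg f_sums])
  also have "\<dots> = 1" by simp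
  finally have total: "(\<integral>\<^sup>+j. ennreal (f j) \<partial>count_space UNIV) = 1" .
  define P where "P = embed_pmf f"
  have P: "pmf P j = f j" for j unfolding P_def by (rule pmf_embed_pmf[OF f_nonneg total])
  interpret C: skip_free_chain lam P h
    using lam_pos h up_pos by unfold_locales (auto simp: P f_def)
  have mass: "C.mass (Suc k) = m (Suc k)" for k
    using lam_pos by (simp add: C.mass_def P f_def nat_add_distrib)
  have P1: "lam * pmf P 1 = q + S" using lam_pos by (simp add: P f_def)

  have power_sums: "(\<lambda>k. s ^ Suc (Suc k) * m (Suc k)) sums (lam * s * (\<integral>j. s powi (- j) \<partial>measure_pmf P) - (q + S))"
    if "0 < s" "s \<le> 1" for s
  proof -
    have "(\<lambda>k. s ^ Suc (Suc k) * C.mass (Suc k)) sums (lam * s * (\<integral>j. s powi (- j) \<partial>measure_pmf P) - (q + S))"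
      using C.mass_power_sums[OF that] by (subst sums_Suc_iff[of "\<lambda>k. s ^ Suc k * C.mass k"]) (simp add: C.mass_0 P1)
    then show ?thesis by (simp only: mass)
  qed
  have \<phi>_lim: "(\<lambda>k. \<phi> (Suc k)) \<longlonglongrightarrow> 0" using \<phi>_sums by (intro summable_LIMSEQ_zero sums_summable)
  \<comment> \<open>For \<open>s = 1 / x\<close> the factor \<open>x\<close> in \<open>m\<close> is
    absorbed by one power of \<open>s\<close>, so consecutive terms cancel.\<close>
  have telescope: "(\<lambda>k. s ^ Suc (Suc k) * m (Suc k + i)) sums (s * \<phi> (Suc i))" if s: "s = 1 / x" for s i
  proof -
    define g where "g k = s ^ Suc k * \<phi> (Suc k + i)" for k
    have s01: "0 < s" "s \<le> 1" "s * x = 1" using x_ge_1 by (simp_all add: s)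
    have lim: "(\<lambda>k. \<phi> (Suc (k + i))) \<longlonglongrightarrow> 0"
      using LIMSEQ_ignore_initial_segment[OF \<phi>_lim, of i] by simp
    have "norm (g k) \<le> norm (\<phi> (Suc (k + i)))" for k
      using s01 power_le_one[of s "Suc k"] by (simp add: g_def abs_mult mult_left_le_one_le del: power_Suc)
    then have "g \<longlonglongrightarrow> 0"
      by (intro Lim_null_comparison[OF _ tendsto_norm_zero[OF lim]]) (intro always_eventually allI)
    from telescope_sums'[OF this] have "(\<lambda>k. g k - g (Suc k)) sums g 0" by simp
    moreover have "g k - g (Suc k) = s ^ Suc (Suc k) * m (Suc k + i)" for k
    proof -
      have "s ^ Suc (Suc k) * m (Suc k + i) = (s * x) * (s ^ Suc k * \<phi> (Suc k + i)) - s ^ Suc (Suc k) * \<phi> (Suc (Suc k) + i)"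
        by (simp add: m_def algebra_simps)
      then show ?thesis by (simp only: s01(3) g_def mult_1)
    qed
    ultimately show ?thesis by (simp add: g_def)
  qed

  \<comment> \<open>The telescoping sum shows that \<open>1 / x\<close> is a root, so
    \<open>C.p \<le> 1 / x\<close> by minimality; a strictly smaller root is excluded by comparing
    signs.\<close>
  have p: "C.p = 1 / x"
  proof -
    define s where "s = 1 / x"
    have s: "0 < s" "s \<le> 1" "s * x = 1" using x_ge_1 by (simp_all add: s_def)
    let ?e = "\<integral>j. s powi (- j) \<partial>measure_pmf P"
    have "lam * s * ?e - (q + S) = s * \<phi> 1"
      using sums_unique2[OF power_sums[OF s(1,2)]] telescope[OF s_def, of 0] by simp
    \<comment> \<open>This uses \<open>q * s = q\<close>, which holds since \<open>x = 1\<close> or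
      \<open>q = 0\<close>.\<close>
    moreover have "lam * s - (q + S) = s * \<phi> 1"
    proof -
      have "lam * s = q * s + (s * x) * S + s * \<phi> 1" by (simp add: lam_def algebra_simps)
      then show ?thesis using xq s(3) by (auto simp: s_def)
    qed
    ultimately have "lam * s * ?e = lam * s * 1" by linarith
    then have "?e = 1" using lam_pos s(1) by simp
    then have "C.p \<le> s" using s by (intro C.p_least)
    have p01: "0 < C.p" "C.p \<le> 1" by (rule C.p_pos C.p_le_1)+
    define U where "U = (\<Sum>k. \<phi> (Suc k) * C.p ^ Suc k)"
    have U: "(\<lambda>k. \<phi> (Suc k) * C.p ^ Suc k) sums U"
      unfolding U_def using p01 by (intro summable_sums summable_\<phi>_mult power_le_one zero_le_power) auto
    have U_Suc: "(\<lambda>k. \<phi> (Suc (Suc k)) * C.p ^ Suc (Suc k)) sums (U - C.p * \<phi> 1)"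
      using U by (subst sums_Suc_iff[of "\<lambda>k. \<phi> (Suc k) * C.p ^ Suc k"]) (simp add: mult.commute)
    have "(\<lambda>k. C.p ^ Suc (Suc k) * m (Suc k)) sums (x * C.p * U - (U - C.p * \<phi> 1))"
      using sums_diff[OF sums_mult[OF U, of "x * C.p"] U_Suc] by (simp add: m_def algebra_simps)
    moreover have "(\<lambda>k. C.p ^ Suc (Suc k) * m (Suc k)) sums (lam * C.p - (q + S))"
      using power_sums[OF p01] by (simp add: C.p_root)
    ultimately have "x * C.p * U - (U - C.p * \<phi> 1) = lam * C.p - (q + S)" by (rule sums_unique2)
    \<comment> \<open>If \<open>C.p < 1 / x\<close>, the left side is at most 0 and the right side
      at least 0, so both vanish. For \<open>q = 0\<close> this contradicts \<open>S > 0\<close>,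
      for \<open>q > 0\<close> the positivity of the right side.\<close>
    then have key: "(x * C.p - 1) * (S - U) = (1 - C.p) * q" by (simp add: lam_def algebra_simps)
    have "U \<le> S * C.p"
    proof (rule sums_le[OF _ U sums_mult2[OF \<phi>_sums]])
      fix k
      have "C.p * C.p ^ k \<le> C.p * 1" using p01 by (intro mult_left_mono power_le_one) auto
      then show "\<phi> (Suc k) * C.p ^ Suc k \<le> \<phi> (Suc k) * C.p" using \<phi>[of "Suc k"] by (simp add: mult_left_mono)
    qed
    then have SU: "(1 - C.p) * S \<le> S - U" by (simp add: algebra_simps)
    show "C.p = 1 / x"
    proof (rule ccontr)
      assume "C.p \<noteq> 1 / x"
      then have lt: "C.p < s" "C.p < 1" using \<open>C.p \<le> s\<close> s(2) by (auto simp: s_def)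
      have "x * C.p < 1" using lt(1) x_ge_1 by (simp add: s_def field_simps)
      have S_pos: "0 < (1 - C.p) * S" if "q = 0" using that up_pos lt(2) by simp
      show False
      proof (cases "q = 0")
        case True
        then have "S - U = 0" using key \<open>x * C.p < 1\<close> by simp
        then show False using SU S_pos[OF True] by simp
      next
        case False
        then have "x = 1" "0 < q" using xq q by auto
        then have "0 < (1 - C.p) * q" using lt(2) by simp
        moreover have "0 \<le> (1 - C.p) * S" using lt(2) S_nonneg by simp
        then have "(x * C.p - 1) * (S - U) \<le> 0" using SU \<open>x * C.p < 1\<close> by (intro mult_nonpos_nonneg) auto
        ultimately show False using key by simp
      qed
    qed
  qed

  have ladder: "C.ladder_mass (Suc i) = \<phi> (Suc i)" for i
  proof -
    have "(\<lambda>k. C.p ^ Suc k * C.mass (k + Suc i)) sums (x * (C.p * \<phi> (Suc i)))"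
    proof -
      \<comment> \<open>Multiplication by \<open>x = 1 / C.p\<close> lowers the power by one, from
        the telescoping sum to the series of \<open>ladder_mass\<close>.\<close>
      have "(\<lambda>k. x * (C.p ^ Suc (Suc k) * m (Suc k + i))) sums (x * (C.p * \<phi> (Suc i)))"
        by (intro sums_mult telescope p)
      moreover have "x * (C.p ^ Suc (Suc k) * m (Suc k + i)) = C.p ^ Suc k * C.mass (k + Suc i)" for k
      proof -
        have "x * (C.p ^ Suc (Suc k) * m (Suc k + i)) = (x * C.p) * (C.p ^ Suc k * m (Suc (k + i)))" by (simp add: ac_simps)
        also have "x * C.p = 1" using x_ge_1 by (simp add: p)
        finally show ?thesis using mass[of "k + i"] by simp
      qed
      ultimately show ?thesis by (simp only:)
    qed
    then show ?thesis unfolding C.ladder_mass_def using x_ge_1 by (simp add: sums_iff p)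
  qed

  obtain N :: "(real \<Rightarrow> real) measure" and X where X: "compound_poisson N X (jump_measure h lam P)"
    using C.exists_compound_poisson_chain[OF C.P_0, of h] h by auto
  have "has_ladder_data h \<gamma> q \<phi> N X (jump_measure h lam P)"
    unfolding has_ladder_data_def
  proof (intro conjI allI impI)
    show "upwards_skip_free_levy_chain h N X (jump_measure h lam P)" by (rule C.upwards_skip_free_levy_chainI[OF X])
    have "lam * (1 - C.p) = \<gamma>"
    proof (cases "\<gamma> = 0")
      case True
      then show ?thesis using x0 by (simp add: p)
    next
      case False
      then have "q = 0" using \<gamma>q by simp
      then show ?thesis using x1[OF False] by (simp add: solves_x_def p lam_def S_def ac_simps)
    qed
    then show "has_killing_rate N (\<lambda>t \<omega>. strict_ascending_ladder_height (\<lambda>s. X s \<omega>) t) \<gamma>"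
      using C.has_killing_rate_ascending[OF X] by simp
  next
    fix \<beta> :: real assume \<beta>: "0 \<le> \<beta>"
    show "killed_laplace_exponent N (\<lambda>t \<omega>. descending_ladder_height (exp (Phi_0 (jump_measure h lam P) * h)) (\<lambda>s. X s \<omega>) t) \<beta>
        = q + (\<Sum>\<^sub>\<infinity>k\<in>{1..}. \<phi> k * (1 - exp (- \<beta> * real k * h)))"
      using sums_unique2[OF C.killed_laplace_exponent_sums[OF X \<beta>, unfolded ladder P1] exponent_sums[OF \<beta>]] by simp
  qed
  then show ?thesis by blast
qed

end

theorem theorem3p11:
  fixes h \<gamma> q :: real and \<phi> :: "nat \<Rightarrow> real"
  assumes "0 < h" and "0 \<le> \<gamma>" and "0 \<le> q"
    and "\<forall>k\<ge>1. 0 \<le> \<phi> k"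
    and "\<phi> summable_on {1..}"
    and "0 < q + (\<Sum>\<^sub>\<infinity>k\<in>{1..}. \<phi> k)"
  shows
    "((\<exists>(M :: (real \<Rightarrow> real) measure) X \<nu>. has_ladder_data h \<gamma> q \<phi> M X \<nu>)
        \<longleftrightarrow> admissible \<gamma> q \<phi>) \<and>
     (\<gamma> \<noteq> 0 \<and> \<gamma> * q = 0 \<longrightarrow> (\<exists>\<^sub>\<le>\<^sub>1x. solves_x \<gamma> \<phi> x)) \<and>
     (\<forall>(M :: 'a measure) X \<nu>. has_ladder_data h \<gamma> q \<phi> M X \<nu> \<longrightarrow>
        admissible \<gamma> q \<phi> \<and>
        (\<forall>A\<in>sets borel. emeasure \<nu> A =
           (\<Sum>\<^sub>\<infinity>k\<in>{1..}. ennreal (mass_down \<gamma> \<phi> k) * emeasure (return borel (- (real k * h))) A)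
             + ennreal (mass_up q \<phi>) * emeasure (return borel h) A) \<and>
        the_x \<gamma> \<phi> = exp (Phi_0 \<nu> * h)) \<and>
     (\<forall>(M :: 'a measure) X \<nu> (M' :: 'b measure) X' \<nu>'.
        has_ladder_data h \<gamma> q \<phi> M X \<nu> \<and> has_ladder_data h \<gamma> q \<phi> M' X' \<nu>' \<longrightarrow>
        process_law M X = process_law M' X')"
proof -
  interpret ladder_parameters h \<gamma> q \<phi>
    using assms by unfold_locales auto
  show ?thesis
  proof (intro conjI allI impI ballI)
    show "(\<exists>(M :: (real \<Rightarrow> real) measure) X \<nu>. has_ladder_data h \<gamma> q \<phi> M X \<nu>) \<longleftrightarrow> admissible \<gamma> q \<phi>"
      using ladder_data_necessary(1) ladder_data_sufficient by blast
    show "\<exists>\<^sub>\<le>\<^sub>1x. solves_x \<gamma> \<phi> x" if "\<gamma> \<noteq> 0 \<and> \<gamma> * q = 0"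
      using solves_x_unique that by (auto simp: Uniq_def)
  next
    fix M :: "'a measure" and X \<nu> and A :: "real set"
    assume L: "has_ladder_data h \<gamma> q \<phi> M X \<nu>"
    show "admissible \<gamma> q \<phi>" "the_x \<gamma> \<phi> = exp (Phi_0 \<nu> * h)"
      by (rule ladder_data_necessary[OF L])+
    assume "A \<in> sets borel"
    then show "emeasure \<nu> A =
           (\<Sum>\<^sub>\<infinity>k\<in>{1..}. ennreal (mass_down \<gamma> \<phi> k) * emeasure (return borel (- (real k * h))) A)
             + ennreal (mass_up q \<phi>) * emeasure (return borel h) A"
      by (rule ladder_data_necessary(2)[OF L])
  next
    fix M :: "'a measure" and X \<nu> and M' :: "'b measure" and X' \<nu>'
    assume *: "has_ladder_data h \<gamma> q \<phi> M X \<nu> \<and> has_ladder_data h \<gamma> q \<phi> M' X' \<nu>'"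
    then have X: "compound_poisson M X \<nu>" "compound_poisson M' X' \<nu>'"
      by (auto simp: has_ladder_data_def upwards_skip_free_levy_chain_def)
    \<comment> \<open>The formula for the Levy measure involves the ladder data alone, so both
      chains have the same one, and it determines the law.\<close>
    have "\<nu> = \<nu>'"
    proof (rule measure_eqI)
      show sets: "sets \<nu> = sets \<nu>'" using X by (simp add: compound_poisson_def)
      fix A assume "A \<in> sets \<nu>"
      then have "A \<in> sets borel" using X(1) by (simp add: compound_poisson_def)
      then show "emeasure \<nu> A = emeasure \<nu>' A"
        using ladder_data_necessary(2)[of M X \<nu> A] ladder_data_necessary(2)[of M' X' \<nu>' A] * by simp
    qed
    then show "process_law M X = process_law M' X'"
      using compound_poisson_process_law_eq X by blast
  qed
qed

end
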